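(* Let $\rho_0$ be a Borel probability measure on $\mathbb{R}$ with $\int_{\mathbb{R}}x^2\,d\rho_0(x)<\infty$ and let $v_0:\mathbb{R}\to\mathbb{R}$ be absolutely continuous. Then there exists a weak solution pair $\rho$ and $v$ of the Euler-Poisson equations $$\partial_t\rho+\partial_x(\rho v)=0,\qquad \partial_t(\rho v)+\partial_x(\rho v^2)=-\rho(\mathrm{sgn}*\rho)\qquad\text{on }\mathbb{R}\times(0,\infty)$$ which satisfies the initial conditions $\rho|_{t=0}=\rho_0$ and $v|_{t=0}=v_0$. Moreover, this solution pair additionally has the following features. (i) For almost every $t,s\ge0$ with $0\le s\le t$, $$\int_{\mathbb{R}}\frac12v(x,t)^2d\rho_t(x)+\iint_{\mathbb{R}^2}\frac12|x-y|\,d\rho_t(x)d\rho_t(y)\le\int_{\mathbb{R}}\frac12v(x,s)^2d\rho_s(x)+\iint_{\mathbb{R}^2}\frac12|x-y|\,d\rho_s(x)d\rho_s(y).$$ (ii) For almost every $t>0$ and $\rho_t$ almost every $x,y\in\mathbb{R}$, $$(v(x,t)-v(y,t))(x-y)\le\frac1t(x-y)^2.$$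
   Context: Absolute continuity of $v_0$ on $\mathbb{R}$ is meant in the usual $\varepsilon$-$\delta$ sense on the whole line: for each $\varepsilon>0$ there is $\delta>0$ such that $\sum_i|v_0(b_i)-v_0(a_i)|<\varepsilon$ for every finite family of disjoint intervals $(a_i,b_i)$ with $\sum_i(b_i-a_i)<\delta$. $\mathcal{P}(\mathbb{R})$ is the set of Borel probability measures on $\mathbb{R}$; narrow convergence is convergence of integrals against every bounded continuous function. $\mathrm{sgn}(x)=1$ for $x>0$, $\mathrm{sgn}(0)=0$, $\mathrm{sgn}(x)=-1$ for $x<0$, and $(\mathrm{sgn}*\mu)(x)=\int_{\mathbb{R}}\mathrm{sgn}(x-y)\,d\mu(y)$. Definition. A narrowly continuous $\rho:[0,\infty)\to\mathcal{P}(\mathbb{R})$, $t\mapsto\rho_t$, and a Borel measurable $v:\mathbb{R}\times[0,\infty)\to\mathbb{R}$ form a weak solution pair of the Euler-Poisson equations satisfying the initial conditions $\rho|_{t=0}=\rho_0$, $v|_{t=0}=v_0$ if: (a) for each $T>0$, $\int_0^T\int_{\mathbb{R}}v^2\,d\rho_t\,dt<\infty$; (b) for each $\phi\in C_c^\infty(\mathbb{R}\times[0,\infty))$, $\int_0^\infty\int_{\mathbb{R}}(\partial_t\phi+v\,\partial_x\phi)\,d\rho_t\,dt+\int_{\mathbb{R}}\phi(\cdot,0)\,d\rho_0=0$; (c) for each $\phi\in C_c^\infty(\mathbb{R}\times[0,\infty))$, $\int_0^\infty\int_{\mathbb{R}}(v\,\partial_t\phi+v^2\partial_x\phi)\,d\rho_t\,dt+\int_{\mathbb{R}}\phi(\cdot,0)v_0\,d\rho_0=\int_0^\infty\int_{\mathbb{R}}\phi\,(\mathrm{sgn}*\rho_t)\,d\rho_t\,dt$.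 *)

theory Defs
  imports "HOL-Probability.Probability"
begin

text \<open>Absolute continuity of a function on the whole line. The library constant
  \<^term>\<open>absolutely_continuous\<close> is the unrelated notion for measures.\<close>

definition abs_cont_on_line :: "(real \<Rightarrow> real) \<Rightarrow> bool" where
  "abs_cont_on_line f \<longleftrightarrow>
    (\<forall>\<epsilon>>0. \<exists>\<delta>>0. \<forall>(n::nat) (a::nat \<Rightarrow> real) (b::nat \<Rightarrow> real).
      (\<forall>i<n. a i < b i) \<and> disjoint_family_on (\<lambda>i. {a i<..<b i}) {..<n} \<and>
      (\<Sum>i<n. b i - a i) < \<delta> \<longrightarrow> (\<Sum>i<n. \<bar>f (b i) - f (a i)\<bar>) < \<epsilon>)"

definition narrow_limit :: "('a \<Rightarrow> real measure) \<Rightarrow> real measure \<Rightarrow> 'a filter \<Rightarrow> bool" where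
  "narrow_limit \<rho> \<mu> F \<longleftrightarrow>
    (\<forall>f::real \<Rightarrow> real. continuous_on UNIV f \<and> bounded (range f) \<longrightarrow>
      ((\<lambda>t. \<integral>x. f x \<partial>\<rho> t) \<longlongrightarrow> (\<integral>x. f x \<partial>\<mu>)) F)"

text \<open>Curves of measures on $[0,\infty)$ are total functions on the reals; their values at
  negative times are never used. The locale predicate \<^term>\<open>real_distribution\<close>
  says that a measure is a Borel probability measure on the real line.\<close>

definition narrowly_continuous :: "(real \<Rightarrow> real measure) \<Rightarrow> bool" where
  "narrowly_continuous \<rho> \<longleftrightarrow>
    (\<forall>t\<ge>0. real_distribution (\<rho> t)) \<and>
    (\<forall>t\<ge>0. narrow_limit \<rho> (\<rho> t) (at t within {0..}))"

text \<open>Functions on the closed half plane are total functions of a pair (position, time), and only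
  their values at times $t \ge 0$ matter. The time derivative is one-sided at $t = 0$, so
  smoothness is understood up to the boundary, and a test function need not vanish there.\<close>

abbreviation half_plane :: "(real \<times> real) set" where
  "half_plane \<equiv> UNIV \<times> {0..}"

definition dx :: "(real \<times> real \<Rightarrow> real) \<Rightarrow> real \<times> real \<Rightarrow> real" where
  "dx \<phi> = (\<lambda>(x, t). deriv (\<lambda>y. \<phi> (y, t)) x)"

definition dt :: "(real \<times> real \<Rightarrow> real) \<Rightarrow> real \<times> real \<Rightarrow> real" where
  "dt \<phi> = (\<lambda>(x, t). vector_derivative (\<lambda>s. \<phi> (x, s)) (at t within {0..}))"

primrec Ck_half_plane :: "nat \<Rightarrow> (real \<times> real \<Rightarrow> real) \<Rightarrow> bool" where
  "Ck_half_plane 0 \<phi> \<longleftrightarrow> continuous_on half_plane \<phi>"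
| "Ck_half_plane (Suc k) \<phi> \<longleftrightarrow>
    (\<forall>x. \<forall>t\<ge>0. (\<lambda>y. \<phi> (y, t)) differentiable (at x) \<and>
                (\<lambda>s. \<phi> (x, s)) differentiable (at t within {0..})) \<and>
    Ck_half_plane k (dx \<phi>) \<and> Ck_half_plane k (dt \<phi>)"

definition test_function :: "(real \<times> real \<Rightarrow> real) \<Rightarrow> bool" where
  "test_function \<phi> \<longleftrightarrow>
    (\<forall>k. Ck_half_plane k \<phi>) \<and> compact (closure {p \<in> half_plane. \<phi> p \<noteq> 0})"

definition sgn_conv :: "real measure \<Rightarrow> real \<Rightarrow> real" where
  "sgn_conv \<mu> x = (\<integral>y. sgn (x - y) \<partial>\<mu>)"

text \<open>The square integrability condition is an extended nonnegative integral. It makes all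
  integrands in the two weak equations integrable, for almost every time in the inner integral, so
  the Bochner integrals there have their usual meaning.\<close>

definition euler_poisson_weak_solution ::
  "real measure \<Rightarrow> (real \<Rightarrow> real) \<Rightarrow> (real \<Rightarrow> real measure) \<Rightarrow> (real \<times> real \<Rightarrow> real) \<Rightarrow> bool" where
  "euler_poisson_weak_solution \<rho>0 v0 \<rho> v \<longleftrightarrow>
    narrowly_continuous \<rho> \<and>
    v \<in> borel_measurable (restrict_space borel half_plane) \<and>
    (\<forall>T>0. (\<integral>\<^sup>+t\<in>{0..T}. (\<integral>\<^sup>+x. ennreal ((v (x, t))\<^sup>2) \<partial>\<rho> t) \<partial>lborel) < \<infinity>) \<and>
    (\<forall>\<phi>. test_function \<phi> \<longrightarrow>
      (LBINT t:{0..}. (\<integral>x. dt \<phi> (x, t) + v (x, t) * dx \<phi> (x, t) \<partial>\<rho> t))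
        + (\<integral>x. \<phi> (x, 0) \<partial>\<rho>0) = 0) \<and>
    (\<forall>\<phi>. test_function \<phi> \<longrightarrow>
      (LBINT t:{0..}. (\<integral>x. v (x, t) * dt \<phi> (x, t) + (v (x, t))\<^sup>2 * dx \<phi> (x, t) \<partial>\<rho> t))
        + (\<integral>x. \<phi> (x, 0) * v0 x \<partial>\<rho>0)
      = (LBINT t:{0..}. (\<integral>x. \<phi> (x, t) * sgn_conv (\<rho> t) x \<partial>\<rho> t)))"

definition energy :: "real measure \<Rightarrow> (real \<Rightarrow> real) \<Rightarrow> ennreal" where
  "energy \<mu> w =
    (\<integral>\<^sup>+x. ennreal (1/2 * (w x)\<^sup>2) \<partial>\<mu>) + (\<integral>\<^sup>+y. (\<integral>\<^sup>+x. ennreal (1/2 * \<bar>x - y\<bar>) \<partial>\<mu>) \<partial>\<mu>)"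

end

theory Submission
  imports Defs
begin

text \<open>Let $q$ be the quantile function of $\rho_0$ on the mass interval $(0,1)$ and put
  $w = v_0 \circ q$. A free particle with mass label $m$ moves under its initial force
  $-(2m-1)$ along $q(m) + t\,w(m) - \frac{t^2}{2}(2m-1)$. The sticky flow $X_t$ is the monotone
  projection of this free motion: if $\Phi_t$ denotes the primitive of the free motion, then
  $X_t(m) = x$ when $m$ lies between the smallest and the largest minimizer of
  $\Phi_t(p) - xp$ on $[0,1]$. The law of $X_t$ is $\rho_t$, and $v(x,t)$ is the
  average of the free velocity over the fibre of $X_t$ above $x$.

  For $0 < s < t$ the function $\Phi_t/t - \Phi_s/s$ is strictly concave, so minimizers at time $t$
  are strict minimizers at time $s$ and fibres only grow. Hence each trajectory is Lipschitz and is
  differentiable off a countable set of times, with derivative $v$. The weak equations follow by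
  integrating along trajectories and averaging over fibres, the one-sided estimate because
  $X_t - t\,v(X_t,t)$ is the fibre average of the nondecreasing function
  $q + \frac{t^2}{2}(2m-1)$, and the energy inequality because fibre averaging is an orthogonal
  projection in $L^2(0,1)$ whose range decreases in time.\<close>

subsection \<open>Averages of a function over intervals\<close>

text \<open>Why the initial forces may stay frozen: the sign convolution of the law at
  \<open>x\<close> equals \<open>Ml t x + Mr t x - 1\<close>, and this is exactly the average of
  \<open>2 * m - 1\<close> over the fibre above \<open>x\<close>. Averaging the free motion
  therefore already produces the interaction after collisions. In
  \<open>pot t / t - pot s / s\<close> the term with \<open>w\<close> cancels; what remains is a
  negative multiple of the convex function \<open>prim q\<close> plus a positive multiple of m -
  m^2, whence the strict concavity for arbitrary initial velocities. The obstacle is that a fibre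
  may be a single label, where an average has to mean a point value. Pointwise arguments are
  therefore made at continuity points of \<open>q\<close>, which are all labels but countably many.
  There \<open>w\<close> is continuous too, so averages over shrinking intervals converge, and
  \<open>pot t\<close> is differentiable, so a contact point determines its slope. Stickiness
  divides by the earlier time, so time 0 gets its own arguments. Absolute continuity of
  \<open>v0\<close> enters through continuity and through linear growth, which with the second
  moment of \<open>\<rho>0\<close> puts \<open>v0\<close> into L^2.\<close>

abbreviation unit_leb :: "real measure" where
  "unit_leb \<equiv> restrict_space lborel {0<..<1}"

lemma prob_space_unit_leb: "prob_space unit_leb"
  by (auto simp: emeasure_restrict_space space_restrict_space intro!: prob_spaceI)

interpretation unit_leb: prob_space unit_leb
  by (rule prob_space_unit_leb)

lemma space_unit_leb [simp]: "space unit_leb = {0<..<1}"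
  by (simp add: space_restrict_space)

lemma integrable_unit_leb_iff:
  fixes f :: "real \<Rightarrow> real"
  shows "integrable unit_leb f \<longleftrightarrow> set_integrable lborel {0<..<1} f"
  by (simp add: integrable_restrict_space set_integrable_def)

lemma AE_unit_leb_iff: "(AE m in unit_leb. P m) \<longleftrightarrow> (AE m in lborel. m \<in> {0<..<1} \<longrightarrow> P m)"
  by (simp add: AE_restrict_space_iff)

lemma integrable_unit_leb_imp_integrable_on:
  fixes f :: "real \<Rightarrow> real"
  assumes "integrable unit_leb f"
  shows "f integrable_on {0..1}"
proof -
  have "f integrable_on {0<..<1}"
    using assms by (auto simp: integrable_unit_leb_iff intro: set_borel_integral_eq_integral)
  then show ?thesis by (simp add: integrable_on_Icc_iff_Ioo)
qed

lemma integral_unit_leb_interval: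
  fixes f :: "real \<Rightarrow> real"
  assumes "integrable unit_leb f" "0 \<le> \<alpha>" "\<alpha> \<le> \<beta>" "\<beta> \<le> 1"
  shows "(\<integral>m. indicator {\<alpha><..<\<beta>} m * f m \<partial>unit_leb) = integral {\<alpha>..\<beta>} f"
proof -
  have s: "set_integrable lborel {\<alpha><..<\<beta>} f"
    by (rule set_integrable_subset[of lborel "{0<..<1}"])
       (use assms in \<open>auto simp: integrable_unit_leb_iff\<close>)
  have "(\<integral>m. indicator {\<alpha><..<\<beta>} m * f m \<partial>unit_leb) = (LINT m:{\<alpha><..<\<beta>}|lborel. f m)"
    using assms
    by (auto simp: integral_restrict_space set_lebesgue_integral_def indicator_def
        intro!: Bochner_Integration.integral_cong)
  also have "\<dots> = integral {\<alpha><..<\<beta>} f"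
    using s by (rule set_borel_integral_eq_integral)
  also have "\<dots> = integral {\<alpha>..\<beta>} f"
    by (rule integral_open_interval_real[symmetric])
  finally show ?thesis .
qed

text \<open>Clamping the upper limit to the unit interval makes the primitive continuous on the
  whole line, so that closedness and Borel measurability of expressions built from it need no range
  conditions.\<close>

definition prim :: "(real \<Rightarrow> real) \<Rightarrow> real \<Rightarrow> real" where
  "prim f x = integral {0..max 0 (min 1 x)} f"

lemma prim_diff:
  assumes "f integrable_on {0..1}" "0 \<le> \<alpha>" "\<alpha> \<le> \<beta>" "\<beta> \<le> 1"
  shows "integral {\<alpha>..\<beta>} f = prim f \<beta> - prim f \<alpha>"
proof -
  have "f integrable_on {0..\<beta>}"
    using assms by (auto intro: integrable_on_subinterval)
  then show ?thesis
    using assms Henstock_Kurzweil_Integration.integral_combine[of 0 \<alpha> \<beta> f]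
    by (simp add: prim_def)
qed

lemma continuous_on_prim:
  assumes "f integrable_on {0..1}"
  shows "continuous_on UNIV (prim f)"
  unfolding prim_def
  by (rule continuous_on_compose2[OF indefinite_integral_continuous_1[OF assms]])
     (auto intro!: continuous_intros)

lemma prim_has_derivative:
  assumes "f integrable_on {0..1}" "m \<in> {0<..<1}" "isCont f m"
  shows "(prim f has_real_derivative f m) (at m)"
proof -
  have "((\<lambda>u. integral {0..u} f) has_vector_derivative f m) (at m within ({0..1} - {}))"
    by (rule integral_has_vector_derivative_continuous_at)
       (use assms in \<open>auto intro: continuous_at_imp_continuous_at_within\<close>)
  then have "((\<lambda>u. integral {0..u} f) has_real_derivative f m) (at m within {0..1})"
    by (simp add: has_real_derivative_iff_has_vector_derivative)
  then have *: "((\<lambda>u. integral {0..u} f) has_real_derivative f m) (at m)"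
    using assms(2) at_within_Icc_at[of 0 m 1] by simp
  have "\<forall>\<^sub>F u in nhds m. integral {0..u} f = prim f u"
  proof (rule eventually_nhds_in_open[of "{0<..<1}", THEN eventually_mono])
    show "integral {0..u} f = prim f u" if "u \<in> {0<..<1}" for u
      using that by (simp add: prim_def max_def min_def)
  qed (use assms in auto)
  from DERIV_cong_ev[OF refl this refl] * show ?thesis
    by simp
qed

text \<open>The primitive of a nondecreasing function is convex, and \<open>f p\<close> is a
  subgradient at \<open>p\<close>. Monotonicity is known only inside the unit interval, so the
  integrals are compared over open intervals; this lets \<open>y\<close> be an endpoint.\<close>

lemma prim_mono_convex:
  assumes int: "f integrable_on {0..1}" and mono: "mono_on {0<..<1} f"
    and p: "p \<in> {0<..<1}" and y: "y \<in> {0..1}"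
  shows "prim f y \<ge> prim f p + f p * (y - p)"
proof (cases "p \<le> y")
  case True
  have "integral {p..y} (\<lambda>_. f p) \<le> integral {p..y} f"
    unfolding integral_open_interval_real
  proof (rule integral_le)
    show "f integrable_on {p<..<y}"
      using int p y by (simp flip: integrable_on_Icc_iff_Ioo) (auto intro: integrable_on_subinterval)
    show "(\<lambda>_. f p) integrable_on {p<..<y}"
      using integrable_on_Icc_iff_Ioo[of "\<lambda>_. f p" p y] by (simp add: integrable_const_ivl)
    show "f p \<le> f x" if "x \<in> {p<..<y}" for x
      using that p y by (intro mono_onD[OF mono]) auto
  qed
  then show ?thesis
    using prim_diff[OF int, of p y] p y True by (simp add: algebra_simps)
next
  case False
  have "integral {y..p} f \<le> integral {y..p} (\<lambda>_. f p)"
    unfolding integral_open_interval_real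
  proof (rule integral_le)
    show "f integrable_on {y<..<p}"
      using int p y by (simp flip: integrable_on_Icc_iff_Ioo) (auto intro: integrable_on_subinterval)
    show "(\<lambda>_. f p) integrable_on {y<..<p}"
      using integrable_on_Icc_iff_Ioo[of "\<lambda>_. f p" y p] by (simp add: integrable_const_ivl)
    show "f x \<le> f p" if "x \<in> {y<..<p}" for x
      using that p y by (intro mono_onD[OF mono]) auto
  qed
  then show ?thesis
    using prim_diff[OF int, of y p] p y False by (simp add: algebra_simps)
qed

lemma isCont_real_le:
  fixes f :: "real \<Rightarrow> real"
  assumes "isCont f m" "e > 0"
  obtains d where "d > 0" "\<And>x. \<bar>x - m\<bar> < d \<Longrightarrow> \<bar>f x - f m\<bar> \<le> e"
proof -
  obtain d where "d > 0" "\<forall>x. \<bar>x - m\<bar> < d \<longrightarrow> \<bar>f x - f m\<bar> < e"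
    using assms unfolding continuous_at_eps_delta dist_real_def by blast
  then show thesis
    by (intro that[of d]) (auto simp: less_imp_le)
qed

text \<open>The value \<open>f m\<close> for a degenerate interval is the limit of the averages over
  intervals shrinking to a continuity point \<open>m\<close>. It lets single-label fibres and shocks
  be handled by one formula.\<close>

definition avg :: "(real \<Rightarrow> real) \<Rightarrow> real \<Rightarrow> real \<Rightarrow> real \<Rightarrow> real" where
  "avg f m \<alpha> \<beta> = (if \<alpha> < \<beta> then (prim f \<beta> - prim f \<alpha>) / (\<beta> - \<alpha>) else f m)"

lemma avg_close:
  assumes int: "f integrable_on {0..1}" and sub: "0 \<le> \<alpha>" "\<alpha> \<le> m" "m \<le> \<beta>" "\<beta> \<le> 1"
    and close: "\<And>x. \<alpha> \<le> x \<Longrightarrow> x \<le> \<beta> \<Longrightarrow> \<bar>f x - f m\<bar> \<le> e"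
  shows "\<bar>avg f m \<alpha> \<beta> - f m\<bar> \<le> e"
proof (cases "\<alpha> < \<beta>")
  case True
  have i: "f integrable_on {\<alpha>..\<beta>}"
    using int sub by (auto intro: integrable_on_subinterval)
  have "integral {\<alpha>..\<beta>} f \<le> integral {\<alpha>..\<beta>} (\<lambda>_. f m + e)"
    by (rule integral_le) (use i in \<open>auto dest!: close\<close>)
  moreover have "integral {\<alpha>..\<beta>} (\<lambda>_. f m - e) \<le> integral {\<alpha>..\<beta>} f"
    by (rule integral_le) (use i in \<open>auto dest!: close\<close>)
  moreover have "integral {\<alpha>..\<beta>} f = avg f m \<alpha> \<beta> * (\<beta> - \<alpha>)"
    using True sub by (simp add: prim_diff[OF int] avg_def)
  ultimately have "avg f m \<alpha> \<beta> * (\<beta> - \<alpha>) \<le> (f m + e) * (\<beta> - \<alpha>)"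
    "(f m - e) * (\<beta> - \<alpha>) \<le> avg f m \<alpha> \<beta> * (\<beta> - \<alpha>)"
    using True by (simp_all add: algebra_simps)
  then have "avg f m \<alpha> \<beta> \<le> f m + e" "f m - e \<le> avg f m \<alpha> \<beta>"
    using True by (simp_all add: mult_le_cancel_right)
  then show ?thesis by (simp add: abs_le_iff)
next
  case False
  then show ?thesis using close[of m] sub by (auto simp: avg_def)
qed

text \<open>A nondegenerate limit interval is covered by continuity of the primitive. If both ends
  tend to \<open>m\<close>, the quotient is useless and continuity of \<open>f\<close> at
  \<open>m\<close> takes over.\<close>

lemma avg_tendsto:
  assumes int: "f integrable_on {0..1}" and cont: "isCont f m"
    and lim: "(\<alpha> \<longlongrightarrow> \<alpha>0) F" "(\<beta> \<longlongrightarrow> \<beta>0) F"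
    and ev: "\<forall>\<^sub>F r in F. 0 \<le> \<alpha> r \<and> \<alpha> r \<le> m \<and> m \<le> \<beta> r \<and> \<beta> r \<le> 1"
    and le: "\<alpha>0 \<le> m" "m \<le> \<beta>0"
  shows "((\<lambda>r. avg f m (\<alpha> r) (\<beta> r)) \<longlongrightarrow> avg f m \<alpha>0 \<beta>0) F"
proof (cases "\<alpha>0 < \<beta>0")
  case True
  have c: "isCont (prim f) x" for x
    using continuous_on_prim[OF int] by (simp add: continuous_on_eq_continuous_at)
  have "((\<lambda>r. (prim f (\<beta> r) - prim f (\<alpha> r)) / (\<beta> r - \<alpha> r)) \<longlongrightarrow>
      (prim f \<beta>0 - prim f \<alpha>0) / (\<beta>0 - \<alpha>0)) F"
    using True by (intro tendsto_intros isCont_tendsto_compose[OF c] lim) auto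
  moreover have "\<forall>\<^sub>F r in F. 0 < \<beta> r - \<alpha> r"
    using True by (intro order_tendstoD[OF tendsto_diff[OF lim(2,1)]]) auto
  then have "\<forall>\<^sub>F r in F. (prim f (\<beta> r) - prim f (\<alpha> r)) / (\<beta> r - \<alpha> r) = avg f m (\<alpha> r) (\<beta> r)"
    by eventually_elim (simp add: avg_def)
  ultimately have "((\<lambda>r. avg f m (\<alpha> r) (\<beta> r)) \<longlongrightarrow>
      (prim f \<beta>0 - prim f \<alpha>0) / (\<beta>0 - \<alpha>0)) F"
    by (rule Lim_transform_eventually)
  then show ?thesis
    using True by (simp add: avg_def)
next
  case False
  then have eq: "\<alpha>0 = m" "\<beta>0 = m" using le by auto
  show ?thesis
  proof (rule tendstoI)
    fix e :: real assume "e > 0"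
    then obtain d where d: "d > 0" "\<And>x. \<bar>x - m\<bar> < d \<Longrightarrow> \<bar>f x - f m\<bar> \<le> e / 2"
      using isCont_real_le[OF cont, of "e / 2"] by auto
    have "\<forall>\<^sub>F r in F. dist (\<alpha> r) m < d" "\<forall>\<^sub>F r in F. dist (\<beta> r) m < d"
      using lim d(1) unfolding eq by (auto dest: tendstoD)
    with ev show "\<forall>\<^sub>F r in F. dist (avg f m (\<alpha> r) (\<beta> r)) (avg f m \<alpha>0 \<beta>0) < e"
    proof eventually_elim
      case (elim r)
      have "\<bar>f x - f m\<bar> \<le> e / 2" if "\<alpha> r \<le> x" "x \<le> \<beta> r" for x
        by (rule d(2)) (use elim that in \<open>auto simp: dist_real_def\<close>)
      then have "\<bar>avg f m (\<alpha> r) (\<beta> r) - f m\<bar> \<le> e / 2"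
        using elim by (intro avg_close[OF int]) auto
      then show ?case using \<open>e > 0\<close> by (simp add: eq avg_def dist_real_def)
    qed
  qed
qed

text \<open>Short intervals around \<open>m\<close> are controlled by continuity at
  \<open>m\<close>; long ones have a denominator of at least \<open>d\<close> and a numerator
  bounded by twice the maximum of the primitive.\<close>

lemma avg_bounded:
  assumes int: "f integrable_on {0..1}" and cont: "isCont f m"
  obtains C where "C \<ge> 0"
    "\<And>\<alpha> \<beta>. 0 \<le> \<alpha> \<Longrightarrow> \<alpha> \<le> m \<Longrightarrow> m \<le> \<beta> \<Longrightarrow> \<beta> \<le> 1 \<Longrightarrow> \<bar>avg f m \<alpha> \<beta>\<bar> \<le> C"
proof -
  have "compact (prim f ` {0..1})"
    by (intro compact_continuous_image continuous_on_subset[OF continuous_on_prim[OF int]]) auto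
  then have "\<exists>B. \<forall>x\<in>{0..1}. \<bar>prim f x\<bar> \<le> B"
    using compact_imp_bounded[of "prim f ` {0..1}"] by (simp add: bounded_iff)
  then obtain B where B: "\<And>x. x \<in> {0..1} \<Longrightarrow> \<bar>prim f x\<bar> \<le> B"
    by blast
  obtain d where d: "d > 0" "\<And>x. \<bar>x - m\<bar> < d \<Longrightarrow> \<bar>f x - f m\<bar> \<le> 1"
    using isCont_real_le[OF cont, of 1] by auto
  show thesis
  proof
    have B0: "B \<ge> 0" using B[of 0] by auto
    show "\<bar>f m\<bar> + 1 + 2 * B / d \<ge> 0" using d B0 by simp
    fix \<alpha> \<beta> :: real assume *: "0 \<le> \<alpha>" "\<alpha> \<le> m" "m \<le> \<beta>" "\<beta> \<le> 1"
    show "\<bar>avg f m \<alpha> \<beta>\<bar> \<le> \<bar>f m\<bar> + 1 + 2 * B / d"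
    proof (cases "\<beta> - \<alpha> < d")
      case True
      have "\<bar>avg f m \<alpha> \<beta> - f m\<bar> \<le> 1"
        by (rule avg_close[OF int]) (use * True in \<open>auto intro!: d(2)\<close>)
      moreover have "0 \<le> 2 * B / d" using d B0 by simp
      ultimately show ?thesis by linarith
    next
      case False
      then have lt: "\<alpha> < \<beta>" using d(1) by auto
      have "\<bar>avg f m \<alpha> \<beta>\<bar> = \<bar>prim f \<beta> - prim f \<alpha>\<bar> / (\<beta> - \<alpha>)"
        using lt by (simp add: avg_def abs_divide)
      also have "\<dots> \<le> (2 * B) / d"
        using False d(1) B0 B[of \<alpha>] B[of \<beta>] * by (intro frac_le) auto
      finally show ?thesis by linarith
    qed
  qed
qed

subsection \<open>The Lagrangian potential and its contact points\<close>

text \<open>Adding the two inequalities leaves (x - y)(p - u) < 0: minimizers are ordered in the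
  same way as the slopes of the supporting lines.\<close>

lemma strict_min_slope:
  fixes f :: "real \<Rightarrow> real"
  assumes min: "f u - x * u \<le> f p - x * p" and strict: "f p - y * p < f u - y * u"
  shows "u < p \<Longrightarrow> x < y" "p < u \<Longrightarrow> y < x"
proof -
  have "(x - y) * (p - u) < 0" 
    using min strict by (simp add: algebra_simps)
  then show "u < p \<Longrightarrow> x < y" "p < u \<Longrightarrow> y < x"
    by (auto simp: mult_less_0_iff)
qed

text \<open>Later \<open>w\<close> is \<open>v0\<close> composed with the quantile function
  \<open>q\<close>; the locale keeps of this only square integrability, measurability and continuity
  of \<open>w\<close> wherever \<open>q\<close> is continuous.\<close>

locale sticky_flow =
  fixes q w :: "real \<Rightarrow> real"
  assumes q_meas [measurable]: "q \<in> borel_measurable borel"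
    and w_meas [measurable]: "w \<in> borel_measurable borel"
    and q_square: "integrable unit_leb (\<lambda>m. (q m)\<^sup>2)"
    and w_square: "integrable unit_leb (\<lambda>m. (w m)\<^sup>2)"
    and q_mono: "mono_on {0<..<1} q"
    and w_cont: "\<And>m. m \<in> {0<..<1} \<Longrightarrow> isCont q m \<Longrightarrow> isCont w m"
begin

lemma q_integrable: "integrable unit_leb q"
  by (rule unit_leb.square_integrable_imp_integrable[OF _ q_square]) (simp add: measurable_restrict_space1)

lemma w_integrable: "integrable unit_leb w"
  by (rule unit_leb.square_integrable_imp_integrable[OF _ w_square]) (simp add: measurable_restrict_space1)

lemmas q_int = integrable_unit_leb_imp_integrable_on[OF q_integrable]
  and w_int = integrable_unit_leb_imp_integrable_on[OF w_integrable]

definition pot :: "real \<Rightarrow> real \<Rightarrow> real" where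
  "pot t m = prim q m + t * prim w m + t\<^sup>2 / 2 * (m - m\<^sup>2)"

text \<open>Geometrically: the line of slope \<open>x\<close> through the graph point above
  \<open>p\<close> supports \<open>pot t\<close> from below, so \<open>pot t\<close> touches its
  lower convex envelope at \<open>p\<close> and \<open>x\<close> is a slope of the envelope
  there.\<close>

definition contact :: "real \<Rightarrow> real \<Rightarrow> real \<Rightarrow> bool" where
  "contact t x p \<longleftrightarrow> p \<in> {0..1} \<and> (\<forall>y\<in>{0..1}. pot t p - x * p \<le> pot t y - x * y)"

definition Ml :: "real \<Rightarrow> real \<Rightarrow> real" where "Ml t x = Inf {p. contact t x p}"
definition Mr :: "real \<Rightarrow> real \<Rightarrow> real" where "Mr t x = Sup {p. contact t x p}"

text \<open>At these labels \<open>w\<close> is continuous as well, so \<open>pot t\<close> is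
  differentiable at every time. They do not depend on time, which allows following one label along
  its whole trajectory.\<close>

definition good :: "real set" where "good = {m\<in>{0<..<1}. isCont q m}"

lemma continuous_on_pot: "continuous_on UNIV (\<lambda>z. pot (fst z) (snd z))"
  unfolding pot_def
  by (intro continuous_intros continuous_on_compose2[OF continuous_on_prim[OF q_int]]
      continuous_on_compose2[OF continuous_on_prim[OF w_int]]) auto

lemma continuous_on_pot_compose [continuous_intros]:
  assumes "continuous_on S f" "continuous_on S g"
  shows "continuous_on S (\<lambda>z. pot (f z) (g z))"
  using continuous_on_compose2[OF continuous_on_pot continuous_on_Pair[OF assms]] by simp

lemma closed_contact: "closed {(p, t, x). contact t x p}"
proof -
  have eq: "{(p, t, x). contact t x p} =
      {z. 0 \<le> fst z} \<inter> {z. fst z \<le> 1} \<inter>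
      (\<Inter>y\<in>{0..1}. {z. pot (fst (snd z)) (fst z) - snd (snd z) * fst z \<le> pot (fst (snd z)) y - snd (snd z) * y})"
    by (auto simp: contact_def)
  show ?thesis
    unfolding eq by (intro closed_Int closed_INT ballI closed_Collect_le continuous_intros)
qed

text \<open>Projecting a closed set along a compact factor keeps it closed. The level sets of
  \<open>Mr\<close> and \<open>Ml\<close> have this form, which gives their joint measurability in
  time and position.\<close>

lemma closed_contact_between: "closed {(t, x). \<exists>p. p \<in> {c..d} \<and> contact t x p}"
proof -
  have eq: "{(t, x). \<exists>p. p \<in> {c..d} \<and> contact t x p} =
    {y. \<exists>p. p \<in> {c..d} \<and> (p, y) \<in> {(p, t, x). contact t x p}}"
    by auto
  show ?thesis
    unfolding eq by (rule closed_compact_projection[OF compact_Icc closed_contact])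
qed

lemma contact_ex: "\<exists>p. contact t x p"
proof -
  have "continuous_on {0..1} (\<lambda>p. pot t p - x * p)"
    by (intro continuous_intros)
  from continuous_attains_inf[OF compact_Icc _ this] show ?thesis
    by (fastforce simp: contact_def)
qed

lemma closed_contacts: "closed {p. contact t x p}"
proof -
  have "{p. contact t x p} = (\<lambda>p. (p, t, x)) -` {(p, t, x). contact t x p}"
    by auto
  also have "closed \<dots>"
    by (intro continuous_closed_vimage closed_contact) (auto intro!: continuous_intros)
  finally show ?thesis .
qed

lemma contact_bounds: "contact t x p \<Longrightarrow> 0 \<le> p \<and> p \<le> 1"
  by (simp add: contact_def)

lemma contact_le:
  "contact t x p \<Longrightarrow> 0 \<le> y \<Longrightarrow> y \<le> 1 \<Longrightarrow> pot t p - x * p \<le> pot t y - x * y"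
  by (simp add: contact_def)

lemma bdd_contacts: "bdd_below {p. contact t x p}" "bdd_above {p. contact t x p}"
  using contact_bounds by (auto intro!: bdd_belowI[of _ 0] bdd_aboveI[of _ 1])

lemma contact_Ml: "contact t x (Ml t x)"
  using closed_contains_Inf[OF _ bdd_contacts(1) closed_contacts] contact_ex
  unfolding Ml_def by blast

lemma contact_Mr: "contact t x (Mr t x)"
  using closed_contains_Sup[OF _ bdd_contacts(2) closed_contacts] contact_ex
  unfolding Mr_def by blast

lemma Ml_le: "contact t x p \<Longrightarrow> Ml t x \<le> p"
  unfolding Ml_def by (rule cInf_lower) (auto simp: bdd_contacts)

lemma Mr_ge: "contact t x p \<Longrightarrow> p \<le> Mr t x"
  unfolding Mr_def by (rule cSup_upper) (auto simp: bdd_contacts)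

lemma Ml_le_Mr: "Ml t x \<le> Mr t x"
  by (rule Ml_le[OF contact_Mr])

lemma M_bounds: "0 \<le> Ml t x" "Ml t x \<le> 1" "0 \<le> Mr t x" "Mr t x \<le> 1"
  using contact_Ml contact_Mr contact_bounds by blast+

lemma contact_mono:
  assumes "contact t x p" "contact t y r" "x < y"
  shows "p \<le> r"
proof -
  have "pot t p - x * p \<le> pot t r - x * r" "pot t r - y * r \<le> pot t p - y * p"
    using assms by (auto simp: contact_def)
  then have "0 \<le> (y - x) * (r - p)" by (simp add: algebra_simps)
  then show ?thesis using assms(3) by (simp add: zero_le_mult_iff)
qed

lemma Mr_le_Ml: "x < y \<Longrightarrow> Mr t x \<le> Ml t y"
  by (rule contact_mono[OF contact_Mr contact_Ml])

lemma Mr_mono: "x \<le> y \<Longrightarrow> Mr t x \<le> Mr t y"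
  using Mr_le_Ml[of x y t] Ml_le_Mr[of t y] by (cases "x = y") auto

lemma measurable_Mr: "(\<lambda>(t, x). Mr t x) \<in> borel_measurable borel"
  unfolding borel_measurable_iff_ge
proof
  fix c
  have "{z. c \<le> (case z of (t, x) \<Rightarrow> Mr t x)} = {(t, x). \<exists>p. p \<in> {c..1} \<and> contact t x p}"
    using contact_Mr M_bounds Mr_ge by (auto intro: order_trans)
  then show "{z \<in> space borel. c \<le> (case z of (t, x) \<Rightarrow> Mr t x)} \<in> sets borel"
    using closed_contact_between[of c 1] by simp
qed

lemma measurable_Ml: "(\<lambda>(t, x). Ml t x) \<in> borel_measurable borel"
  unfolding borel_measurable_iff_le
proof
  fix c
  have "{z. (case z of (t, x) \<Rightarrow> Ml t x) \<le> c} = {(t, x). \<exists>p. p \<in> {0..c} \<and> contact t x p}"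
    using Ml_le by (auto intro!: exI[of _ "Ml _ _"] simp: contact_Ml M_bounds intro: order_trans)
  then show "{z \<in> space borel. (case z of (t, x) \<Rightarrow> Ml t x) \<le> c} \<in> sets borel"
    using closed_contact_between[of 0 c] by simp
qed

lemma measurable_Ml_compose [measurable (raw)]:
  "f \<in> borel_measurable M \<Longrightarrow> g \<in> borel_measurable M \<Longrightarrow> (\<lambda>z. Ml (f z) (g z)) \<in> borel_measurable M"
  using measurable_compose[OF borel_measurable_Pair measurable_Ml] by simp

lemma measurable_Mr_compose [measurable (raw)]:
  "f \<in> borel_measurable M \<Longrightarrow> g \<in> borel_measurable M \<Longrightarrow> (\<lambda>z. Mr (f z) (g z)) \<in> borel_measurable M"
  using measurable_compose[OF borel_measurable_Pair measurable_Mr] by simp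

text \<open>A generalized inverse of the nondecreasing function \<open>Mr t\<close>. As
  \<open>X t m \<le> x\<close> will be equivalent to \<open>m \<le> Mr t x\<close>,
  \<open>Mr t\<close> is the distribution function of the law of \<open>X t\<close>, and
  \<open>X t\<close> is its quantile function.\<close>

definition X :: "real \<Rightarrow> real \<Rightarrow> real" where "X t m = Inf {x. m \<le> Mr t x}"

lemma pot_bounded: obtains C where "\<And>p. p \<in> {0..1} \<Longrightarrow> \<bar>pot t p\<bar> \<le> C"
proof -
  have "compact (pot t ` {0..1})"
    by (intro compact_continuous_image continuous_intros) auto
  then have "\<exists>C. \<forall>p\<in>{0..1}. \<bar>pot t p\<bar> \<le> C"
    using compact_imp_bounded[of "pot t ` {0..1}"] by (simp add: bounded_iff)
  then show thesis using that by blast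
qed

lemma X_set:
  assumes m: "m \<in> {0<..<1}"
  shows "{x. m \<le> Mr t x} \<noteq> {}" "bdd_below {x. m \<le> Mr t x}" "closed {x. m \<le> Mr t x}"
proof -
  obtain C where C: "\<And>p. p \<in> {0..1} \<Longrightarrow> \<bar>pot t p\<bar> \<le> C" using pot_bounded by blast
  have C': "pot t 0 \<le> C" "pot t 1 \<le> C" "- C \<le> pot t (Mr t x)" for x
    using C[of 0] C[of 1] C[of "Mr t x"] M_bounds by (auto simp: abs_le_iff)
  \<comment> \<open>The potential oscillates by at most \<open>2 * C\<close>. For this
    \<open>x\<close> a minimizer below \<open>m\<close> would lose more than that against the label
    1 in the linear term.\<close>
  define x where "x = (2 * C + 1) / (1 - m)"
  have x: "x * (1 - m) = 2 * C + 1" "x > 0"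
    using m C[of 0] by (auto simp: x_def)
  have "m \<le> Mr t x"
  proof (rule ccontr)
    assume "\<not> m \<le> Mr t x"
    then have "x * (1 - m) \<le> x * (1 - Mr t x)"
      using x by (intro mult_left_mono) auto
    moreover have "pot t (Mr t x) - x * Mr t x \<le> pot t 1 - x * 1"
      using contact_le[OF contact_Mr, of 1] by simp
    ultimately show False using C'(2) C'(3)[of x] x(1) by (simp add: algebra_simps)
  qed
  then show "{x. m \<le> Mr t x} \<noteq> {}" by auto
  show "bdd_below {x. m \<le> Mr t x}"
  \<comment> \<open>The same comparison with the label 0: for \<open>x\<close> below
    \<open>- 2 * C / m\<close> no minimizer can lie at or beyond \<open>m\<close>.\<close>
  proof (rule bdd_belowI[of _ "min 0 (- 2 * C / m)"])
    fix x assume "x \<in> {x. m \<le> Mr t x}"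
    then have le: "m \<le> Mr t x" by simp
    have "pot t (Mr t x) - x * Mr t x \<le> pot t 0 - x * 0"
      using contact_le[OF contact_Mr, of 0] by simp
    then have 1: "- 2 * C \<le> x * Mr t x" using C'(1) C'(3)[of x] by simp
    show "min 0 (- 2 * C / m) \<le> x"
    proof (cases "0 \<le> x")
      case False
      then have "x * Mr t x \<le> x * m" using le by (simp add: mult_left_mono_neg)
      then have "- 2 * C \<le> x * m" using 1 by linarith
      then have "- 2 * C / m \<le> x" using pos_divide_le_eq[of m "- 2 * C" x] m by auto
      then show ?thesis by simp
    qed simp
  qed
  have "{x. m \<le> Mr t x} = (\<lambda>x. (t, x)) -` {(t, x). \<exists>p. p \<in> {m..1} \<and> contact t x p}"
    using contact_Mr M_bounds Mr_ge by (auto intro: order_trans)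
  also have "closed \<dots>"
    by (intro continuous_closed_vimage closed_contact_between) (auto intro!: continuous_intros)
  finally show "closed {x. m \<le> Mr t x}" .
qed

lemma Mr_X: "m \<in> {0<..<1} \<Longrightarrow> m \<le> Mr t (X t m)"
  using closed_contains_Inf[OF X_set] unfolding X_def by blast

lemma X_le_iff:
  assumes "m \<in> {0<..<1}" shows "X t m \<le> x \<longleftrightarrow> m \<le> Mr t x"
proof
  assume "X t m \<le> x"
  then show "m \<le> Mr t x" using Mr_X[OF assms, of t] Mr_mono[of "X t m" x t] by linarith
next
  assume "m \<le> Mr t x"
  then show "X t m \<le> x" unfolding X_def by (intro cInf_lower X_set(2)[OF assms]) simp
qed

text \<open>Every position to the left of \<open>X t m\<close> has a contact point at most
  \<open>m\<close>, and the set of such positions is closed, so \<open>X t m\<close> has one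
  too.\<close>

lemma Ml_X:
  assumes "m \<in> {0<..<1}" shows "Ml t (X t m) \<le> m"
proof -
  let ?S = "(\<lambda>x. (t, x)) -` {(t, x). \<exists>p. p \<in> {0..m} \<and> contact t x p}"
  have "{..<X t m} \<subseteq> ?S"
  proof
    fix x assume "x \<in> {..<X t m}"
    then have "Mr t x \<le> m" using X_le_iff[OF assms, of t x] by simp
    then show "x \<in> ?S" using contact_Mr[of t x] M_bounds[of t x] by auto
  qed
  moreover have "closed ?S"
    by (intro continuous_closed_vimage closed_contact_between) (auto intro!: continuous_intros)
  ultimately have "closure {..<X t m} \<subseteq> ?S" by (rule closure_minimal)
  then obtain p where "p \<le> m" "contact t (X t m) p" by auto
  then show ?thesis using Ml_le by (meson order_trans)
qed

lemma X_eqI: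
  assumes "Ml t x < m" "m < Mr t x" shows "X t m = x"
proof -
  have m: "m \<in> {0<..<1}" using assms M_bounds[of t x] by auto
  have "X t m \<le> x" using assms by (simp add: X_le_iff[OF m])
  moreover have "\<not> X t m < x"
    using Mr_X[OF m, of t] Mr_le_Ml[of "X t m" x t] assms by linarith
  ultimately show ?thesis by simp
qed

lemma X_less_Ml:
  assumes "m \<in> {0<..<1}" "m < Ml t x" shows "X t m < x"
proof -
  have "X t m \<le> x" using assms Ml_le_Mr[of t x] by (simp add: X_le_iff)
  moreover have "X t m \<noteq> x" using Ml_X[OF assms(1), of t] assms(2) by auto
  ultimately show ?thesis by simp
qed

lemma X_greater_Mr: "m \<in> {0<..<1} \<Longrightarrow> Mr t x < m \<Longrightarrow> x < X t m"
  by (simp add: X_le_iff flip: not_le)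

section \<open>Good labels and the growth of fibres in time\<close>

lemma good_unit: "m \<in> good \<Longrightarrow> m \<in> {0<..<1}" "m \<in> good \<Longrightarrow> 0 < m" "m \<in> good \<Longrightarrow> m < 1"
  by (auto simp: good_def)

lemma good_AE: "AE m in unit_leb. m \<in> good"
proof -
  have "countable {m\<in>{0<..<1}. \<not> isCont q m}"
    by (rule mono_on_ctble_discont_open) (auto intro: q_mono)
  then have "AE m in lborel. m \<notin> {m\<in>{0<..<1}. \<not> isCont q m}"
    by (intro AE_not_in countable_imp_null_set_lborel)
  then show ?thesis
    unfolding AE_unit_leb_iff by eventually_elim (auto simp: good_def)
qed

lemma pot_has_derivative:
  assumes "m \<in> good"
  shows "(pot t has_real_derivative q m + t * w m + t\<^sup>2 / 2 * (1 - 2 * m)) (at m)"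
proof -
  have m: "m \<in> {0<..<1}" "isCont q m" "isCont w m" using assms w_cont by (auto simp: good_def)
  note [derivative_intros] = prim_has_derivative[OF q_int m(1,2)] prim_has_derivative[OF w_int m(1,3)]
  show ?thesis
    unfolding pot_def by (auto intro!: derivative_eq_intros)
qed

text \<open>The first-order condition at an interior minimum. A good label that is itself a contact
  point thus sits where its free motion has taken it.\<close>

lemma contact_slope:
  assumes "m \<in> good" "contact t x m"
  shows "x = q m + t * w m + t\<^sup>2 / 2 * (1 - 2 * m)"
proof -
  have "((\<lambda>y. pot t y - x * y) has_real_derivative (q m + t * w m + t\<^sup>2 / 2 * (1 - 2 * m)) - x) (at m)"
    by (auto intro!: derivative_eq_intros pot_has_derivative assms)
  moreover have "0 < min m (1 - m)" using good_unit(2,3)[OF assms(1)] by simp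
  moreover have "\<forall>y. \<bar>m - y\<bar> < min m (1 - m) \<longrightarrow> pot t m - x * m \<le> pot t y - x * y"
  proof (intro allI impI)
    fix y assume "\<bar>m - y\<bar> < min m (1 - m)"
    then have "0 \<le> y" "y \<le> 1" by linarith+
    then show "pot t m - x * m \<le> pot t y - x * y" by (rule contact_le[OF assms(2)])
  qed
  ultimately have "(q m + t * w m + t\<^sup>2 / 2 * (1 - 2 * m)) - x = 0"
    by (rule DERIV_local_min)
  then show ?thesis by simp
qed

text \<open>Stickiness: a contact point at a later time is a strict contact point at all earlier
  positive times, because \<open>pot t / t - pot s / s\<close> is strictly concave for \<open>s < t\<close>.\<close>

lemma contact_strict:
  assumes st: "0 < s" "s < t" and p: "p \<in> {0<..<1}" "contact t x p"
  obtains x' where "\<And>y. y \<in> {0..1} \<Longrightarrow> y \<noteq> p \<Longrightarrow> pot s p - x' * p < pot s y - x' * y"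
proof
  \<comment> \<open>The potential at time \<open>s\<close> is a combination of \<open>pot t\<close>,
    \<open>prim q\<close> and the quadratic; \<open>x'\<close> combines in the same way the
    supporting slope \<open>x\<close>, the subgradient \<open>q p\<close> and the derivative of the
    quadratic at \<open>p\<close>. The leftover s(t - s)/2 (y - p)^2 is what makes the contact
    strict.\<close>
  define x' where "x' = s / t * x + (1 - s / t) * q p - s * (t - s) / 2 * (1 - 2 * p)"
  define c where "c = s * (t - s) / 2"
  define r where "r = s / t"
  fix y :: real assume y: "y \<in> {0..1}" "y \<noteq> p"
  have pot: "pot s z = s / t * pot t z + (1 - s / t) * prim q z - s * (t - s) / 2 * (z - z\<^sup>2)" for z
    using st by (simp add: pot_def field_simps power2_eq_square)
  have 1: "s / t * (x * (y - p)) \<le> s / t * (pot t y - pot t p)"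
    using p y st by (intro mult_left_mono) (auto simp: contact_def algebra_simps)
  have 2: "(1 - s / t) * (q p * (y - p)) \<le> (1 - s / t) * (prim q y - prim q p)"
    using prim_mono_convex[OF q_int q_mono p(1) y(1)] st by (intro mult_left_mono) auto
  have 3: "0 < s * (t - s) / 2 * (y - p)\<^sup>2"
    using st y by simp
  have "(pot s y - x' * y) - (pot s p - x' * p) =
     (s / t * (pot t y - pot t p) - s / t * (x * (y - p))) +
     ((1 - s / t) * (prim q y - prim q p) - (1 - s / t) * (q p * (y - p))) + s * (t - s) / 2 * (y - p)\<^sup>2"
    unfolding pot x'_def c_def[symmetric] r_def[symmetric] by (simp add: algebra_simps power2_eq_square)
  then show "pot s p - x' * p < pot s y - x' * y"
    using 1 2 3 by linarith
qed

definition lo :: "real \<Rightarrow> real \<Rightarrow> real" where "lo t m = Ml t (X t m)"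
definition hi :: "real \<Rightarrow> real \<Rightarrow> real" where "hi t m = Mr t (X t m)"

lemma contact_lo: "contact t (X t m) (lo t m)" and contact_hi: "contact t (X t m) (hi t m)"
  by (auto simp: lo_def hi_def contact_Ml contact_Mr)

lemma lo_hi: "m \<in> {0<..<1} \<Longrightarrow> lo t m \<le> m" "m \<in> {0<..<1} \<Longrightarrow> m \<le> hi t m" "0 \<le> lo t m" "hi t m \<le> 1"
  by (auto simp: lo_def hi_def Ml_X Mr_X M_bounds)

text \<open>Otherwise \<open>lo t m\<close> would be a strict contact point at time
  \<open>s\<close>, with slope \<open>x'\<close>, strictly to the right of \<open>lo s m\<close>.
  Comparison with \<open>lo s m\<close> gives \<open>X s m < x'\<close>, comparison with
  \<open>hi s m\<close> gives the reverse. The latter fails only if \<open>hi s m\<close> and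
  \<open>lo t m\<close> both equal \<open>m\<close>; then differentiability of \<open>pot s\<close>
  at the good label forces the two slopes to agree.\<close>

lemma lo_antimono:
  assumes m: "m \<in> good" and st: "0 < s" "s \<le> t"
  shows "lo t m \<le> lo s m"
proof (rule ccontr)
  assume "\<not> lo t m \<le> lo s m"
  then have lt: "lo s m < lo t m" by simp
  have m1: "m \<in> {0<..<1}" using m good_unit by blast
  have "s < t" using lt st by (cases "s = t") auto
  have p: "lo t m \<in> {0<..<1}" using lt lo_hi(1)[OF m1] lo_hi(3)[of s m] m1
    by (auto intro: le_less_trans order_less_le_trans)
  obtain x' where x': "\<And>y. y \<in> {0..1} \<Longrightarrow> y \<noteq> lo t m \<Longrightarrow> pot s (lo t m) - x' * lo t m < pot s y - x' * y"
    using contact_strict[OF st(1) \<open>s < t\<close> p contact_lo] by blast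
  have c': "contact s x' (lo t m)"
    unfolding contact_def using p x' by (metis greaterThanLessThan_iff atLeastAtMost_iff less_imp_le order_refl)
  have l1: "X s m < x'"
    by (rule strict_min_slope(1)[OF _ x' lt])
       (use p contact_le[OF contact_lo, of "lo t m" s m] contact_bounds[OF contact_lo[of s m]] lt in auto)
  have "lo t m \<le> hi s m"
    using lo_hi(1)[OF m1, of t] lo_hi(2)[OF m1, of s] by simp
  then consider "lo t m < hi s m" | "hi s m = m" "lo t m = m"
    using lo_hi(1)[OF m1, of t] lo_hi(2)[OF m1, of s] by linarith
  then show False
  proof cases
    case 1
    have "x' < X s m"
      by (rule strict_min_slope(2)[OF _ x' 1])
         (use p contact_le[OF contact_hi, of "lo t m" s m] contact_bounds[OF contact_hi[of s m]] 1 in auto)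
    then show False using l1 by simp
  next
    case 2
    then have "X s m = x'"
      using contact_slope[OF m, of s "X s m"] contact_slope[OF m, of s x'] contact_hi[of s m] c' by simp
    then show False using l1 by simp
  qed
qed

lemma hi_mono:
  assumes m: "m \<in> good" and st: "0 < s" "s \<le> t"
  shows "hi s m \<le> hi t m"
proof (rule ccontr)
  assume "\<not> hi s m \<le> hi t m"
  then have lt: "hi t m < hi s m" by simp
  have m1: "m \<in> {0<..<1}" using m good_unit by blast
  have "s < t" using lt st by (cases "s = t") auto
  have p: "hi t m \<in> {0<..<1}" using lt lo_hi(2)[OF m1] lo_hi(4)[of s m] m1
    by (auto intro: less_le_trans)
  obtain x' where x': "\<And>y. y \<in> {0..1} \<Longrightarrow> y \<noteq> hi t m \<Longrightarrow> pot s (hi t m) - x' * hi t m < pot s y - x' * y"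
    using contact_strict[OF st(1) \<open>s < t\<close> p contact_hi] by blast
  have c': "contact s x' (hi t m)"
    unfolding contact_def using p x' by (metis greaterThanLessThan_iff atLeastAtMost_iff less_imp_le order_refl)
  have l1: "x' < X s m"
    by (rule strict_min_slope(2)[OF _ x' lt])
       (use p contact_le[OF contact_hi, of "hi t m" s m] contact_bounds[OF contact_hi[of s m]] lt in auto)
  have "lo s m \<le> hi t m"
    using lo_hi(1)[OF m1, of s] lo_hi(2)[OF m1, of t] by simp
  then consider "lo s m < hi t m" | "lo s m = m" "hi t m = m"
    using lo_hi(1)[OF m1, of s] lo_hi(2)[OF m1, of t] by linarith
  then show False
  proof cases
    case 1
    have "X s m < x'"
      by (rule strict_min_slope(1)[OF _ x' 1])
         (use p contact_le[OF contact_lo, of "hi t m" s m] contact_bounds[OF contact_lo[of s m]] 1 in auto)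
    then show False using l1 by simp
  next
    case 2
    then have "X s m = x'"
      using contact_slope[OF m, of s "X s m"] contact_slope[OF m, of s x'] contact_lo[of s m] c' by simp
    then show False using l1 by simp
  qed
qed

end

subsection \<open>Trajectories\<close>

context sticky_flow
begin

text \<open>Composed with \<open>X t\<close>, this is the conditional expectation of
  \<open>f\<close> given \<open>X t\<close> under the uniform measure on labels. The label passed to
  \<open>avg\<close> matters only for a single-label fibre, where \<open>Ml t x\<close> is that
  label.\<close>

definition K :: "real \<Rightarrow> (real \<Rightarrow> real) \<Rightarrow> real \<Rightarrow> real" where
  "K t f x = avg f (Ml t x) (Ml t x) (Mr t x)"

text \<open>The mean of 1 - 2m over an interval is one minus the sum of its ends, so this is the
  fibre average of the free velocity w(m) + t(1 - 2m).\<close>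

definition vel :: "real \<Rightarrow> real \<Rightarrow> real" where
  "vel t x = K t w x + t * (1 - Ml t x - Mr t x)"

lemma K_X:
  assumes "m \<in> {0<..<1}" shows "K t f (X t m) = avg f m (lo t m) (hi t m)"
proof (cases "lo t m < hi t m")
  case False
  then have "lo t m = m" using lo_hi(1,2)[OF assms, of t] by linarith
  with False show ?thesis by (simp add: K_def avg_def flip: lo_def hi_def)
qed (simp add: K_def avg_def flip: lo_def hi_def)

lemma vel_X:
  assumes "m \<in> {0<..<1}"
  shows "vel t (X t m) = avg w m (lo t m) (hi t m) + t * (1 - lo t m - hi t m)"
  unfolding vel_def K_X[OF assms] by (simp add: lo_def hi_def)

lemma contact_zero:
  assumes "m \<in> {0<..<1}" shows "contact 0 (q m) m"
proof -
  have "pot 0 m - q m * m \<le> pot 0 y - q m * y" if "y \<in> {0..1}" for y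
    using prim_mono_convex[OF q_int q_mono assms that] by (simp add: pot_def algebra_simps)
  then show ?thesis using assms by (auto simp: contact_def)
qed

text \<open>A kink of the convex envelope at \<open>m\<close> would admit a whole interval of
  slopes. Differentiability of \<open>pot t\<close> at a good label leaves only one.\<close>

lemma contact_X:
  assumes m: "m \<in> good" and c: "contact t x m" shows "X t m = x"
proof -
  note m' = good_unit(1)[OF m]
  have "X t m \<le> x" using Mr_ge[OF c] by (simp add: X_le_iff[OF m'])
  moreover have False if "X t m < x"
  proof -
    have "Mr t (X t m) = m"
      using Mr_le_Ml[OF that, of t] Ml_le[OF c] Mr_X[OF m', of t] by linarith
    then show False
      using contact_slope[OF m c] contact_slope[OF m, of t "X t m"] contact_Mr[of t "X t m"] that
      by simp
  qed
  ultimately show ?thesis by fastforce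
qed

lemma X_zero: "m \<in> good \<Longrightarrow> X 0 m = q m"
  using contact_X[OF _ contact_zero] good_unit by blast

text \<open>The summand \<open>prim q\<close> is constant in time and cancels; the difference of
  squares produces the factor \<open>(t + t') / 2\<close>, so the velocity is evaluated at the
  midpoint in time.\<close>

lemma pot_increment:
  assumes "\<alpha> < \<beta>"
  shows "(pot t' \<beta> - pot t \<beta>) - (pot t' \<alpha> - pot t \<alpha>) =
    (t' - t) * (avg w m \<alpha> \<beta> + (t + t') / 2 * (1 - \<alpha> - \<beta>)) * (\<beta> - \<alpha>)"
proof -
  have e: "prim w \<beta> - prim w \<alpha> = avg w m \<alpha> \<beta> * (\<beta> - \<alpha>)"
    using assms by (simp add: avg_def)
  have "(pot t' \<beta> - pot t \<beta>) - (pot t' \<alpha> - pot t \<alpha>) =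
    (t' - t) * (prim w \<beta> - prim w \<alpha>) + (t'\<^sup>2 - t\<^sup>2) / 2 * ((\<beta> - \<beta>\<^sup>2) - (\<alpha> - \<alpha>\<^sup>2))"
    by (simp add: pot_def algebra_simps add_divide_distrib diff_divide_distrib)
  then show ?thesis
    unfolding e by (simp add: algebra_simps power2_eq_square add_divide_distrib diff_divide_distrib)
qed

text \<open>Both slopes are compared across the mixed intervals \<open>[\<alpha>', \<beta>]\<close> and \<open>[\<alpha>, \<beta>']\<close>, on
  which one endpoint is a contact point at each of the two times.\<close>

lemma slope_increment:
  assumes m: "m \<in> good"
    and c: "contact t x \<alpha>" "contact t x \<beta>" "contact t' x' \<alpha>'" "contact t' x' \<beta>'"
    and le: "\<alpha>' \<le> \<alpha>" "\<alpha> \<le> m" "m \<le> \<beta>" "\<beta> \<le> \<beta>'"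
  shows "x' - x \<le> (t' - t) * (avg w m \<alpha>' \<beta> + (t + t') / 2 * (1 - \<alpha>' - \<beta>))"
    and "(t' - t) * (avg w m \<alpha> \<beta>' + (t + t') / 2 * (1 - \<alpha> - \<beta>')) \<le> x' - x"
proof -
  note b = contact_bounds[OF c(1)] contact_bounds[OF c(2)] contact_bounds[OF c(3)] contact_bounds[OF c(4)]
  \<comment> \<open>For the case of a degenerate mixed interval: then \<open>m\<close> is a contact
    point at both times, and both slopes are explicit free positions.\<close>
  have eq: "x' - x = (t' - t) * (w m + (t + t') / 2 * (1 - m - m))"
    if "contact t x m" "contact t' x' m"
    unfolding contact_slope[OF m that(1)] contact_slope[OF m that(2)]
    by (simp add: algebra_simps power2_eq_square add_divide_distrib diff_divide_distrib)
  show "x' - x \<le> (t' - t) * (avg w m \<alpha>' \<beta> + (t + t') / 2 * (1 - \<alpha>' - \<beta>))"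
  proof (cases "\<alpha>' < \<beta>")
    case True
    have "pot t' \<alpha>' - x' * \<alpha>' \<le> pot t' \<beta> - x' * \<beta>" "pot t \<beta> - x * \<beta> \<le> pot t \<alpha>' - x * \<alpha>'"
      using contact_le[OF c(3), of \<beta>] contact_le[OF c(2), of \<alpha>'] b by auto
    then have "(x' - x) * (\<beta> - \<alpha>') \<le> (pot t' \<beta> - pot t \<beta>) - (pot t' \<alpha>' - pot t \<alpha>')"
      by (simp add: algebra_simps)
    then show ?thesis
      unfolding pot_increment[OF True, of t' t m] using True by (simp add: mult_le_cancel_right)
  next
    case False
    then have "\<alpha>' = m" "\<beta> = m" using le by auto
    then show ?thesis using eq c by (simp add: avg_def)
  qed
  show "(t' - t) * (avg w m \<alpha> \<beta>' + (t + t') / 2 * (1 - \<alpha> - \<beta>')) \<le> x' - x"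
  proof (cases "\<alpha> < \<beta>'")
    case True
    have "pot t' \<beta>' - x' * \<beta>' \<le> pot t' \<alpha> - x' * \<alpha>" "pot t \<alpha> - x * \<alpha> \<le> pot t \<beta>' - x * \<beta>'"
      using contact_le[OF c(4), of \<alpha>] contact_le[OF c(1), of \<beta>'] b by auto
    then have "(pot t' \<beta>' - pot t \<beta>') - (pot t' \<alpha> - pot t \<alpha>) \<le> (x' - x) * (\<beta>' - \<alpha>)"
      by (simp add: algebra_simps)
    then show ?thesis
      unfolding pot_increment[OF True, of t' t m] using True by (simp add: mult_le_cancel_right)
  next
    case False
    then have "\<alpha> = m" "\<beta>' = m" using le by auto
    then show ?thesis using eq c by (simp add: avg_def)
  qed
qed

lemma X_increment:
  assumes m: "m \<in> good" and st: "0 < s" "s \<le> t"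
  shows "X t m - X s m \<le> (t - s) * (avg w m (lo t m) (hi s m) + (s + t) / 2 * (1 - lo t m - hi s m))"
    and "(t - s) * (avg w m (lo s m) (hi t m) + (s + t) / 2 * (1 - lo s m - hi t m)) \<le> X t m - X s m"
  using slope_increment[OF m contact_lo[of s m] contact_hi[of s m] contact_lo[of t m] contact_hi[of t m]]
    lo_antimono[OF m st] hi_mono[OF m st] lo_hi(1,2)[OF good_unit(1)[OF m]] lo_hi(3,4) by auto

text \<open>At time 0 the label \<open>m\<close> itself serves as both contact points. It lies
  inside its fibre at time \<open>t\<close>, so the nesting that \<open>lo_antimono\<close> and
  \<open>hi_mono\<close> supply for positive times is immediate.\<close>

lemma X_increment_zero:
  assumes m: "m \<in> good"
  shows "X t m - X 0 m \<le> t * (avg w m (lo t m) m + t / 2 * (1 - lo t m - m))"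
    and "t * (avg w m m (hi t m) + t / 2 * (1 - m - hi t m)) \<le> X t m - X 0 m"
  using slope_increment[OF m contact_zero contact_zero contact_lo[of t m] contact_hi[of t m]]
    lo_hi(1,2)[OF good_unit(1)[OF m]] lo_hi(3,4) good_unit(1)[OF m] X_zero[OF m] by auto

text \<open>Increments lie between velocities averaged over intervals that contain \<open>m\<close>.
  For fixed \<open>m\<close> the averages of \<open>w\<close> over all these intervals are bounded,
  and the force contributes at most \<open>\<bar>T\<bar>\<close>. The constant depends on the
  label.\<close>

lemma X_Lipschitz:
  assumes m: "m \<in> good"
  obtains C where "C \<ge> 0"
    "\<And>s t. 0 \<le> s \<Longrightarrow> s \<le> t \<Longrightarrow> t \<le> T \<Longrightarrow> \<bar>X t m - X s m\<bar> \<le> C * (t - s)"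
    "\<And>t. 0 \<le> t \<Longrightarrow> t \<le> T \<Longrightarrow> \<bar>vel t (X t m)\<bar> \<le> C"
proof -
  note m' = good_unit(1)[OF m]
  have "isCont w m" using m w_cont by (auto simp: good_def)
  from avg_bounded[OF w_int this] obtain C where C: "C \<ge> 0"
    "\<And>\<alpha> \<beta>. 0 \<le> \<alpha> \<Longrightarrow> \<alpha> \<le> m \<Longrightarrow> m \<le> \<beta> \<Longrightarrow> \<beta> \<le> 1 \<Longrightarrow> \<bar>avg w m \<alpha> \<beta>\<bar> \<le> C"
    by blast
  have bd: "\<bar>avg w m \<alpha> \<beta> + r * (1 - \<alpha> - \<beta>)\<bar> \<le> C + \<bar>T\<bar>"
    if "0 \<le> \<alpha>" "\<alpha> \<le> m" "m \<le> \<beta>" "\<beta> \<le> 1" "0 \<le> r" "r \<le> T" for \<alpha> \<beta> r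
  proof -
    have "\<bar>1 - \<alpha> - \<beta>\<bar> \<le> 1" using that by auto
    then have "\<bar>r * (1 - \<alpha> - \<beta>)\<bar> \<le> \<bar>T\<bar> * 1"
      unfolding abs_mult using that by (intro mult_mono) auto
    then show ?thesis using C(2)[OF that(1-4)] by linarith
  qed
  have key: "\<bar>y\<bar> \<le> (C + \<bar>T\<bar>) * d" if "d \<ge> 0" "y \<le> d * a" "d * b \<le> y" "\<bar>a\<bar> \<le> C + \<bar>T\<bar>" "\<bar>b\<bar> \<le> C + \<bar>T\<bar>"
    for y d a b :: real
  proof -
    have "d * a \<le> d * (C + \<bar>T\<bar>)" "d * (- (C + \<bar>T\<bar>)) \<le> d * b"
      using that by (auto intro!: mult_left_mono)
    then show ?thesis using that by (auto simp: abs_le_iff algebra_simps)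
  qed
  note lh = lo_hi(1,2)[OF m'] lo_hi(3,4)
  show thesis
  proof
    show "C + \<bar>T\<bar> \<ge> 0" using C by simp
    show "\<bar>vel t (X t m)\<bar> \<le> C + \<bar>T\<bar>" if "0 \<le> t" "t \<le> T" for t
      unfolding vel_X[OF m'] using that lh by (intro bd) auto
    show "\<bar>X t m - X s m\<bar> \<le> (C + \<bar>T\<bar>) * (t - s)" if st: "0 \<le> s" "s \<le> t" "t \<le> T" for s t
    proof (cases "s = 0")
      case True
      have "\<bar>X t m - X 0 m\<bar> \<le> (C + \<bar>T\<bar>) * t"
        by (intro key[OF _ X_increment_zero[OF m]] bd) (use st lh m' in auto)
      then show ?thesis using True by simp
    next
      case False
      then have "0 < s" using st by simp
      show ?thesis
        by (intro key[OF _ X_increment[OF m \<open>0 < s\<close> st(2)]] bd) (use st lh in auto)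
    qed
  qed
qed

text \<open>The difference quotient is squeezed between \<open>D1\<close> and \<open>D2\<close>, in
  each of which one fibre end is frozen at time \<open>t\<close> and the other moves. Which of them
  is the upper bound depends on the sign of \<open>r - t\<close>, hence the minimum and maximum.
  Continuity of the two ends at \<open>t\<close> sends both to the fibre-averaged velocity.\<close>

lemma X_has_derivative:
  assumes m: "m \<in> good" and t: "0 < t"
    and cont: "isCont (\<lambda>r. lo r m) t" "isCont (\<lambda>r. hi r m) t"
  shows "((\<lambda>r. X r m) has_real_derivative vel t (X t m)) (at t)"
proof -
  note m' = good_unit(1)[OF m]
  have wc: "isCont w m" using m w_cont by (auto simp: good_def)
  define D1 where "D1 r = avg w m (lo t m) (hi r m) + (t + r) / 2 * (1 - lo t m - hi r m)" for r
  define D2 where "D2 r = avg w m (lo r m) (hi t m) + (t + r) / 2 * (1 - lo r m - hi t m)" for r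
  note lims = cont[unfolded isCont_def]
  have half: "((\<lambda>r. (t + r) / 2) \<longlongrightarrow> t) (at t)"
    by (rule tendsto_eq_intros refl | simp)+
  have d1: "(D1 \<longlongrightarrow> vel t (X t m)) (at t)"
    unfolding D1_def vel_X[OF m'] using lo_hi(1,2)[OF m'] lo_hi(3,4)
    by (intro tendsto_add tendsto_mult tendsto_diff half lims tendsto_const avg_tendsto[OF w_int wc]) auto
  have d2: "(D2 \<longlongrightarrow> vel t (X t m)) (at t)"
    unfolding D2_def vel_X[OF m'] using lo_hi(1,2)[OF m'] lo_hi(3,4)
    by (intro tendsto_add tendsto_mult tendsto_diff half lims tendsto_const avg_tendsto[OF w_int wc]) auto
  have "\<forall>\<^sub>F r in at t. min (D1 r) (D2 r) \<le> (X r m - X t m) / (r - t) \<and>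
      (X r m - X t m) / (r - t) \<le> max (D1 r) (D2 r)"
  proof (rule eventually_mono[OF eventually_conj])
    show "\<forall>\<^sub>F r in at t. r \<in> {0<..}"
      using t by (intro eventually_at_in_open') auto
    show "\<forall>\<^sub>F r in at t. r \<noteq> t" by (simp add: eventually_at_filter)
    fix r assume r: "r \<in> {0<..} \<and> r \<noteq> t"
    show "min (D1 r) (D2 r) \<le> (X r m - X t m) / (r - t) \<and>
        (X r m - X t m) / (r - t) \<le> max (D1 r) (D2 r)"
    proof (cases "t < r")
      case True
      have "X r m - X t m \<le> (r - t) * D2 r" "(r - t) * D1 r \<le> X r m - X t m"
        using X_increment[OF m t, of r] True by (auto simp: D1_def D2_def)
      then have "(X r m - X t m) / (r - t) \<le> D2 r" "D1 r \<le> (X r m - X t m) / (r - t)"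
        using True by (auto simp: divide_le_eq le_divide_eq mult.commute)
      then show ?thesis by auto
    next
      case False
      then have rt: "r < t" using r by auto
      have "X t m - X r m \<le> (t - r) * D1 r" "(t - r) * D2 r \<le> X t m - X r m"
        using X_increment[OF m, of r t] r rt by (auto simp: D1_def D2_def add.commute)
      then have "(X t m - X r m) / (t - r) \<le> D1 r" "D2 r \<le> (X t m - X r m) / (t - r)"
        using rt by (auto simp: divide_le_eq le_divide_eq mult.commute)
      moreover have "(X t m - X r m) / (t - r) = (X r m - X t m) / (r - t)"
        by (metis minus_diff_eq minus_divide_divide)
      ultimately show ?thesis by auto
    qed
  qed
  then have ev: "\<forall>\<^sub>F r in at t. min (D1 r) (D2 r) \<le> (X r m - X t m) / (r - t)"
    "\<forall>\<^sub>F r in at t. (X r m - X t m) / (r - t) \<le> max (D1 r) (D2 r)"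
    by (auto elim: eventually_mono)
  have "((\<lambda>r. (X r m - X t m) / (r - t)) \<longlongrightarrow> vel t (X t m)) (at t)"
    by (rule tendsto_sandwich[OF ev])
       (use tendsto_min[OF d1 d2] tendsto_max[OF d1 d2] in auto)
  then show ?thesis by (simp add: has_field_derivative_iff)
qed

text \<open>For a good label both fibre ends are monotone in time, so they jump at countably many
  times only.\<close>

lemma X_has_derivative_AE:
  assumes m: "m \<in> good"
  shows "AE t in lborel. 0 < t \<longrightarrow> ((\<lambda>r. X r m) has_real_derivative vel t (X t m)) (at t)"
proof -
  have "countable {t\<in>{0<..}. \<not> isCont (\<lambda>r. - lo r m) t}"
    by (rule mono_on_ctble_discont_open) (auto intro!: mono_onI lo_antimono[OF m])
  moreover have "isCont (\<lambda>r. - lo r m) t \<longleftrightarrow> isCont (\<lambda>r. lo r m) t" for t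
    using continuous_minus[of "at t" "\<lambda>r. - lo r m"] continuous_minus[of "at t" "\<lambda>r. lo r m"] by auto
  moreover have "countable {t\<in>{0<..}. \<not> isCont (\<lambda>r. hi r m) t}"
    by (rule mono_on_ctble_discont_open) (auto intro!: mono_onI hi_mono[OF m])
  ultimately have "countable ({t\<in>{0<..}. \<not> isCont (\<lambda>r. lo r m) t} \<union> {t\<in>{0<..}. \<not> isCont (\<lambda>r. hi r m) t})"
    (is "countable ?N") by simp
  then have "AE t in lborel. t \<notin> ?N"
    by (intro AE_not_in countable_imp_null_set_lborel)
  then show ?thesis
    by eventually_elim (auto intro: X_has_derivative[OF m])
qed

end

subsection \<open>Averaging over fibres\<close>

lemma measurable_unit_leb_borel:
  "g \<in> measurable M unit_leb \<Longrightarrow> g \<in> borel_measurable M"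
  by (simp add: measurable_restrict_space2_iff)

lemma unit_leb_measurable_iff:
  "f \<in> borel_measurable unit_leb \<longleftrightarrow> f \<in> borel_measurable (restrict_space borel {0<..<1})"
  by (intro arg_cong2[where f="(\<in>)"] refl measurable_cong_sets sets_restrict_space_cong) simp_all

lemma measurable_ident_unit_leb [measurable]:
  "(\<lambda>m. m) \<in> borel_measurable unit_leb"
  "(\<lambda>m. m) \<in> borel_measurable (restrict_space borel {0<..<1::real})"
  by (simp_all add: unit_leb_measurable_iff measurable_restrict_space1)

lemma prim_linear:
  assumes "f integrable_on {0..1}" "g integrable_on {0..1}"
  shows "prim (\<lambda>m. f m + c * g m) x = prim f x + c * prim g x"
proof -
  have "f integrable_on {0..max 0 (min 1 x)}" "g integrable_on {0..max 0 (min 1 x)}"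
    using assms[THEN integrable_on_subinterval, of 0 "max 0 (min 1 x)"] by auto
  then show ?thesis
    by (simp add: prim_def Henstock_Kurzweil_Integration.integral_add integrable_on_mult_right)
qed

lemma prim_affine:
  assumes "0 \<le> x" "x \<le> 1"
  shows "prim (\<lambda>m. 2 * m - 1) x = x\<^sup>2 - x"
proof -
  have "((\<lambda>m. 2 * m - 1) has_integral (x\<^sup>2 - x) - (0\<^sup>2 - 0)) {0..x}"
    by (rule fundamental_theorem_of_calculus)
       (use assms in \<open>auto intro!: derivative_eq_intros simp flip: has_real_derivative_iff_has_vector_derivative\<close>)
  then show ?thesis using assms by (simp add: prim_def integral_unique)
qed

context sticky_flow
begin

lemma measurable_X [measurable (raw)]:
  assumes f [measurable]: "f \<in> borel_measurable M" and g: "g \<in> measurable M unit_leb"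
  shows "(\<lambda>z. X (f z) (g z)) \<in> borel_measurable M"
  unfolding borel_measurable_iff_le
proof
  fix c
  note [measurable] = measurable_unit_leb_borel[OF g]
  have "X (f z) (g z) \<le> c \<longleftrightarrow> g z \<le> Mr (f z) c" if "z \<in> space M" for z
    using measurable_space[OF g that] by (intro X_le_iff) simp
  then have "{z \<in> space M. X (f z) (g z) \<le> c} = {z \<in> space M. g z \<le> Mr (f z) c}"
    by blast
  also have "\<dots> \<in> sets M" by measurable
  finally show "{z \<in> space M. X (f z) (g z) \<le> c} \<in> sets M" .
qed

lemma measurable_K:
  assumes f [measurable]: "f \<in> borel_measurable borel" "integrable unit_leb f"
    and [measurable]: "g \<in> borel_measurable M" "h \<in> borel_measurable M"
  shows "(\<lambda>z. K (g z) f (h z)) \<in> borel_measurable M"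
proof -
  have [measurable]: "prim f \<in> borel_measurable borel"
    by (intro borel_measurable_continuous_onI continuous_on_prim integrable_unit_leb_imp_integrable_on f)
  show ?thesis unfolding K_def avg_def by measurable
qed

lemma measurable_vel [measurable (raw)]:
  assumes [measurable]: "g \<in> borel_measurable M" "h \<in> borel_measurable M"
  shows "(\<lambda>z. vel (g z) (h z)) \<in> borel_measurable M"
proof -
  note [measurable (raw)] = measurable_K[OF w_meas w_integrable]
  show ?thesis unfolding vel_def by measurable
qed

lemma K_linear:
  assumes "integrable unit_leb f" "integrable unit_leb g"
  shows "K t (\<lambda>m. f m + c * g m) x = K t f x + c * K t g x"
proof -
  note i = assms[THEN integrable_unit_leb_imp_integrable_on]
  show ?thesis
    by (auto simp: K_def avg_def prim_linear[OF i] add_divide_distrib diff_divide_distrib algebra_simps)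
qed

lemma affine_integrable: "integrable unit_leb (\<lambda>m. 2 * m - 1)"
  by (rule unit_leb.integrable_const_bound[where B=1]) (auto simp: AE_unit_leb_iff)

lemma K_affine: "K t (\<lambda>m. 2 * m - 1) x = Ml t x + Mr t x - 1"
proof (cases "Ml t x < Mr t x")
  case True
  have "((Mr t x)\<^sup>2 - Mr t x - ((Ml t x)\<^sup>2 - Ml t x)) = (Ml t x + Mr t x - 1) * (Mr t x - Ml t x)"
    by (simp add: algebra_simps power2_eq_square)
  then show ?thesis using True M_bounds by (simp add: K_def avg_def prim_affine)
next
  case False
  then show ?thesis using Ml_le_Mr[of t x] by (simp add: K_def avg_def)
qed

lemma K_nonneg:
  assumes "integrable unit_leb f" "\<And>m. f m \<ge> 0" shows "K t f x \<ge> 0"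
proof (cases "Ml t x < Mr t x")
  case True
  have "f integrable_on {Ml t x..Mr t x}"
    by (rule integrable_on_subinterval[OF integrable_unit_leb_imp_integrable_on[OF assms(1)]])
       (use M_bounds[of t x] in auto)
  then have "0 \<le> integral {Ml t x..Mr t x} f"
    by (rule Henstock_Kurzweil_Integration.integral_nonneg) (rule assms(2))
  then show ?thesis
    using True prim_diff[OF integrable_unit_leb_imp_integrable_on[OF assms(1)], of "Ml t x" "Mr t x"] M_bounds
    by (simp add: K_def avg_def)
qed (simp add: K_def avg_def assms)

text \<open>Jensen's inequality, obtained by averaging the square of \<open>f m - c\<close> for the
  choice \<open>c = K t f x\<close>.\<close>

lemma K_square_le:
  assumes [measurable]: "f \<in> borel_measurable borel" and sq: "integrable unit_leb (\<lambda>m. (f m)\<^sup>2)"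
  shows "(K t f x)\<^sup>2 \<le> K t (\<lambda>m. (f m)\<^sup>2) x"
proof -
  define c where "c = K t f x"
  have f: "integrable unit_leb f"
    by (rule unit_leb.square_integrable_imp_integrable[OF _ sq]) measurable
  have eq: "(f m - c)\<^sup>2 = (f m)\<^sup>2 + 1 * (c\<^sup>2 + (- 2 * c) * f m)" for m
    by (simp add: power2_eq_square algebra_simps)
  have i: "integrable unit_leb (\<lambda>m. c\<^sup>2 + (- 2 * c) * f m)"
    using f by simp
  have one: "K t (\<lambda>m. c\<^sup>2) x = c\<^sup>2"
    using M_bounds[of t x] by (auto simp: K_def avg_def prim_def field_simps)
  have "0 \<le> K t (\<lambda>m. (f m - c)\<^sup>2) x"
  proof (rule K_nonneg)
    show "integrable unit_leb (\<lambda>m. (f m - c)\<^sup>2)"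
      unfolding eq using sq i by simp
  qed simp
  also have "K t (\<lambda>m. (f m - c)\<^sup>2) x = K t (\<lambda>m. (f m)\<^sup>2) x + K t (\<lambda>m. c\<^sup>2 + (- 2 * c) * f m) x"
    unfolding eq using K_linear[OF sq i, of t 1 x] by simp
  also have "K t (\<lambda>m. c\<^sup>2 + (- 2 * c) * f m) x = c\<^sup>2 + (- 2 * c) * c"
    using K_linear[OF _ f, of "\<lambda>m. c\<^sup>2" t "- 2 * c" x] one by (simp add: c_def)
  finally show ?thesis by (simp add: c_def power2_eq_square)
qed

section \<open>Decomposition of the mass interval into shocks and single labels\<close>

definition shocks :: "real \<Rightarrow> real set" where "shocks t = {x. Ml t x < Mr t x}"
text \<open>Taken open, so that distinct fibres are disjoint and disjointness already forces
  countably many shocks. The omitted ends form a countable null set.\<close>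

definition fibre :: "real \<Rightarrow> real \<Rightarrow> real set" where "fibre t x = {Ml t x<..<Mr t x}"

lemma fibre_disjoint: "x \<noteq> y \<Longrightarrow> fibre t x \<inter> fibre t y = {}"
proof (rule ccontr)
  assume "x \<noteq> y" "fibre t x \<inter> fibre t y \<noteq> {}"
  then obtain m where "m \<in> fibre t x" "m \<in> fibre t y" by blast
  then have "X t m = x" "X t m = y" by (auto simp: fibre_def intro: X_eqI)
  with \<open>x \<noteq> y\<close> show False by simp
qed

lemma open_fibre: "open (fibre t x)"
  by (simp add: fibre_def)

lemma countable_shocks: "countable (shocks t)"
proof -
  have "countable (fibre t ` shocks t)"
    by (rule countable_disjoint_open_subsets)
       (auto simp: open_fibre pairwise_def disjnt_def intro!: fibre_disjoint)
  moreover have "fibre t x \<noteq> {}" if "x \<in> shocks t" for x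
    using that by (simp add: fibre_def shocks_def)
  then have "inj_on (fibre t) (shocks t)"
    using fibre_disjoint by (intro inj_onI) (metis Int_absorb)
  ultimately show ?thesis by (rule countable_image_inj_on)
qed

lemma fibre_sets [measurable]: "fibre t x \<in> sets unit_leb"
  using M_bounds[of t x] by (auto simp: fibre_def sets_restrict_space_iff)

lemma emeasure_fibre: "x \<in> shocks t \<Longrightarrow> emeasure unit_leb (fibre t x) = ennreal (Mr t x - Ml t x)"
  using M_bounds[of t x]
  by (subst emeasure_restrict_space) (auto simp: fibre_def shocks_def)

lemma fibre_X: "m \<in> fibre t x \<Longrightarrow> X t m = x"
  by (auto simp: fibre_def intro: X_eqI)

definition shock_masses :: "real \<Rightarrow> real set" where "shock_masses t = (\<Union>x\<in>shocks t. fibre t x)"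

lemma shock_masses_sets [measurable]: "shock_masses t \<in> sets unit_leb"
  unfolding shock_masses_def by (intro sets.countable_UN' countable_shocks fibre_sets) auto

text \<open>A label in a nondegenerate fibre but outside the open fibres is an end of a shock, and
  there are countably many such ends.\<close>

lemma AE_degenerate: "AE m in unit_leb. m \<notin> shock_masses t \<longrightarrow> lo t m = m \<and> hi t m = m"
proof -
  have "countable (Ml t ` shocks t \<union> Mr t ` shocks t)"
    using countable_shocks by auto
  then have "AE m in lborel. m \<notin> Ml t ` shocks t \<union> Mr t ` shocks t"
    by (intro AE_not_in countable_imp_null_set_lborel)
  then show ?thesis
    unfolding AE_unit_leb_iff
  proof eventually_elim
    case (elim m)
    show ?case
    proof (intro impI)
      assume m: "m \<in> {0<..<1}" and ns: "m \<notin> shock_masses t"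
      note lh = lo_hi(1,2)[OF m, of t]
      show "lo t m = m \<and> hi t m = m"
      proof (cases "lo t m < hi t m")
        case True
        then have "X t m \<in> shocks t" by (simp add: shocks_def lo_def hi_def)
        then have "m \<noteq> lo t m" "m \<noteq> hi t m" using elim by (auto simp: lo_def hi_def)
        then have "m \<in> fibre t (X t m)" using lh by (auto simp: fibre_def simp flip: lo_def hi_def)
        then show ?thesis using ns \<open>X t m \<in> shocks t\<close> by (auto simp: shock_masses_def)
      qed (use lh in linarith)
    qed
  qed
qed

lemma K_degenerate: "AE m in unit_leb. m \<notin> shock_masses t \<longrightarrow> K t f (X t m) = f m"
  using AE_degenerate[of t] AE_space
  by eventually_elim (simp add: K_X avg_def)

lemma integral_fibre:
  assumes "integrable unit_leb f" "x \<in> shocks t"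
  shows "(\<integral>m. indicator (fibre t x) m * f m \<partial>unit_leb) = K t f x * (Mr t x - Ml t x)"
  using assms M_bounds[of t x]
  by (simp add: fibre_def integral_unit_leb_interval prim_diff[OF integrable_unit_leb_imp_integrable_on]
      K_def avg_def shocks_def)

lemma nn_integral_split_fibres:
  assumes [measurable]: "g \<in> borel_measurable unit_leb"
  shows "(\<integral>\<^sup>+m. g m \<partial>unit_leb) =
    (\<integral>\<^sup>+x. (\<integral>\<^sup>+m. g m * indicator (fibre t x) m \<partial>unit_leb) \<partial>count_space (shocks t)) +
    (\<integral>\<^sup>+m. g m * indicator (- shock_masses t) m \<partial>unit_leb)"
proof -
  have [measurable]: "- shock_masses t \<inter> {0<..<1} \<in> sets unit_leb"
    using sets.compl_sets[OF shock_masses_sets, of t] by (simp add: Diff_eq Int_commute)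
  have "(\<lambda>m. g m * indicator (- shock_masses t \<inter> {0<..<1}) m) \<in> borel_measurable unit_leb"
    by measurable
  then have m: "(\<lambda>m. g m * indicator (- shock_masses t) m) \<in> borel_measurable unit_leb"
    by (rule measurable_cong[THEN iffD1, rotated]) (simp add: indicator_def)
  have "(\<integral>\<^sup>+m. g m \<partial>unit_leb) =
     (\<integral>\<^sup>+m. g m * indicator (shock_masses t) m + g m * indicator (- shock_masses t) m \<partial>unit_leb)"
    by (intro nn_integral_cong) (auto simp: indicator_def)
  also have "\<dots> = (\<integral>\<^sup>+m. g m * indicator (shock_masses t) m \<partial>unit_leb) +
      (\<integral>\<^sup>+m. g m * indicator (- shock_masses t) m \<partial>unit_leb)"
    by (intro nn_integral_add m) measurable
  also have "(\<integral>\<^sup>+m. g m * indicator (shock_masses t) m \<partial>unit_leb) =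
      emeasure (density unit_leb g) (\<Union>x\<in>shocks t. fibre t x)"
    by (simp add: emeasure_density flip: shock_masses_def)
  also have "\<dots> = (\<integral>\<^sup>+x. emeasure (density unit_leb g) (fibre t x) \<partial>count_space (shocks t))"
    by (intro emeasure_UN_countable countable_shocks)
       (auto simp: disjoint_family_on_def fibre_disjoint)
  finally show ?thesis by (simp add: emeasure_density)
qed

text \<open>Conditional expectation preserves the integral: on each shock \<open>K\<close> is the
  mean of \<open>f\<close>, and on the remaining labels it agrees with \<open>f\<close> almost
  everywhere.\<close>

lemma nn_integral_K:
  assumes [measurable]: "f \<in> borel_measurable borel" and f: "integrable unit_leb f" and nn: "\<And>m. f m \<ge> 0"
  shows "(\<integral>\<^sup>+m. ennreal (K t f (X t m)) \<partial>unit_leb) = (\<integral>\<^sup>+m. ennreal (f m) \<partial>unit_leb)"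
proof -
  have KX [measurable]: "(\<lambda>m. K t f (X t m)) \<in> borel_measurable unit_leb"
    by (intro measurable_K f) measurable
  have 1: "(\<integral>\<^sup>+m. ennreal (K t f (X t m)) * indicator (- shock_masses t) m \<partial>unit_leb) =
      (\<integral>\<^sup>+m. ennreal (f m) * indicator (- shock_masses t) m \<partial>unit_leb)"
    by (intro nn_integral_cong_AE eventually_mono[OF K_degenerate[of t f]]) (auto simp: indicator_def)
  have 2: "(\<integral>\<^sup>+m. ennreal (K t f (X t m)) * indicator (fibre t x) m \<partial>unit_leb) =
      (\<integral>\<^sup>+m. ennreal (f m) * indicator (fibre t x) m \<partial>unit_leb)" if x: "x \<in> shocks t" for x
  proof -
    have "(\<integral>\<^sup>+m. ennreal (K t f (X t m)) * indicator (fibre t x) m \<partial>unit_leb) =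
      (\<integral>\<^sup>+m. ennreal (K t f x) * indicator (fibre t x) m \<partial>unit_leb)"
      by (intro nn_integral_cong) (auto simp: indicator_def fibre_X)
    also have "\<dots> = ennreal (K t f x) * ennreal (Mr t x - Ml t x)"
      by (simp add: nn_integral_cmult_indicator emeasure_fibre[OF x])
    also have "\<dots> = ennreal (\<integral>m. indicator (fibre t x) m * f m \<partial>unit_leb)"
      using x K_nonneg[OF f nn] by (simp add: integral_fibre[OF f x] ennreal_mult' shocks_def)
    also have "\<dots> = (\<integral>\<^sup>+m. ennreal (indicator (fibre t x) m * f m) \<partial>unit_leb)"
      using nn by (intro nn_integral_eq_integral[symmetric]) (auto intro!: integrable_real_mult_indicator f simp: mult.commute[of "indicator _ _"])
    finally show ?thesis by (simp add: ennreal_mult' nn ennreal_indicator mult.commute)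
  qed
  show ?thesis
    by (subst (1 2) nn_integral_split_fibres[of _ t]) (auto simp: 1 intro!: nn_integral_cong 2 arg_cong2[where f="(+)"])
qed

lemma K_square_integrable:
  assumes [measurable]: "f \<in> borel_measurable borel" and sq: "integrable unit_leb (\<lambda>m. (f m)\<^sup>2)"
  shows "integrable unit_leb (\<lambda>m. (K t f (X t m))\<^sup>2)"
    and "(\<integral>m. (K t f (X t m))\<^sup>2 \<partial>unit_leb) \<le> (\<integral>m. (f m)\<^sup>2 \<partial>unit_leb)"
proof -
  have f: "integrable unit_leb f"
    by (rule unit_leb.square_integrable_imp_integrable[OF _ sq]) measurable
  have [measurable]: "(\<lambda>m. K t f (X t m)) \<in> borel_measurable unit_leb"
    by (intro measurable_K f) measurable
  have "(\<integral>\<^sup>+m. ennreal ((K t f (X t m))\<^sup>2) \<partial>unit_leb) \<le> (\<integral>\<^sup>+m. ennreal (K t (\<lambda>m. (f m)\<^sup>2) (X t m)) \<partial>unit_leb)"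
    by (intro nn_integral_mono ennreal_leI K_square_le sq) measurable
  also have "\<dots> = (\<integral>\<^sup>+m. ennreal ((f m)\<^sup>2) \<partial>unit_leb)"
    by (rule nn_integral_K[OF _ sq]) simp_all
  also have "\<dots> = ennreal (\<integral>m. (f m)\<^sup>2 \<partial>unit_leb)"
    using sq by (intro nn_integral_eq_integral) auto
  finally have le: "(\<integral>\<^sup>+m. ennreal ((K t f (X t m))\<^sup>2) \<partial>unit_leb) \<le> ennreal (\<integral>m. (f m)\<^sup>2 \<partial>unit_leb)" .
  then show i: "integrable unit_leb (\<lambda>m. (K t f (X t m))\<^sup>2)"
    by (intro integrableI_nonneg) (auto simp: less_top[symmetric] top_unique)
  show "(\<integral>m. (K t f (X t m))\<^sup>2 \<partial>unit_leb) \<le> (\<integral>m. (f m)\<^sup>2 \<partial>unit_leb)"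
    using le by (subst (asm) nn_integral_eq_integral[OF i]) auto
qed

text \<open>The defining property of a conditional expectation: against a factor that is constant on
  fibres, \<open>f\<close> and its fibre average are interchangeable. The difference
  \<open>h\<close> vanishes almost everywhere off the shocks and integrates to zero over each
  fibre.\<close>

lemma integral_K_mult:
  assumes [measurable]: "f \<in> borel_measurable borel" and f: "integrable unit_leb f"
    and int: "integrable unit_leb (\<lambda>m. f m * k m)" "integrable unit_leb (\<lambda>m. K t f (X t m) * k m)"
    and k: "\<And>x. x \<in> shocks t \<Longrightarrow> \<exists>c. AE m in unit_leb. m \<in> fibre t x \<longrightarrow> k m = c"
  shows "(\<integral>m. f m * k m \<partial>unit_leb) = (\<integral>m. K t f (X t m) * k m \<partial>unit_leb)"
proof -
  define h where "h m = f m * k m - K t f (X t m) * k m" for m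
  \<comment> \<open>The countably many fibres are listed along the naturals, with the empty set at
    indices that belong to no shock, so that countable additivity of the integral applies.\<close>
  define A where "A i = (\<Union>x\<in>{x\<in>shocks t. to_nat_on (shocks t) x = i}. fibre t x)" for i
  have h: "integrable unit_leb h" unfolding h_def using int by simp
  have inj: "x = y" if "x \<in> shocks t" "y \<in> shocks t" "to_nat_on (shocks t) x = to_nat_on (shocks t) y" for x y
    using inj_onD[OF inj_on_to_nat_on[OF countable_shocks]] that by metis
  have A: "A i = {} \<or> (\<exists>x\<in>shocks t. A i = fibre t x)" for i
  proof (cases "\<exists>x\<in>shocks t. to_nat_on (shocks t) x = i")
    case True
    then obtain x where x: "x \<in> shocks t" "to_nat_on (shocks t) x = i" by blast
    then have "{x\<in>shocks t. to_nat_on (shocks t) x = i} = {x}" using inj by blast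
    then show ?thesis using x by (auto simp: A_def)
  qed (auto simp: A_def)
  have Asets: "A i \<in> sets unit_leb" for i using A[of i] by auto
  have UA: "(\<Union>i. A i) = shock_masses t" by (auto simp: A_def shock_masses_def)
  have fibre0: "(LINT m:fibre t x|unit_leb. h m) = 0" if x: "x \<in> shocks t" for x
  proof -
    obtain c where c: "AE m in unit_leb. m \<in> fibre t x \<longrightarrow> k m = c" using k[OF x] by blast
    have h_eq: "AE m in unit_leb. indicator (fibre t x) m *\<^sub>R h m =
        c * (indicator (fibre t x) m * f m) - c * K t f x * indicator (fibre t x) m"
      using c by eventually_elim (auto simp: indicator_def h_def fibre_X algebra_simps)
    have i1: "integrable unit_leb (\<lambda>m. indicator (fibre t x) m * f m)"
      using integrable_mult_indicator[OF fibre_sets f] by simp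
    have i2: "integrable unit_leb (\<lambda>m. indicator (fibre t x) m :: real)"
      by (rule integrable_real_indicator) (simp_all add: unit_leb.emeasure_finite less_top[symmetric])
    have sub: "fibre t x \<inter> {0<..<1} = fibre t x"
      using M_bounds[of t x] by (auto simp: fibre_def)
    have "(LINT m:fibre t x|unit_leb. h m) =
      (\<integral>m. c * (indicator (fibre t x) m * f m) - c * K t f x * indicator (fibre t x) m \<partial>unit_leb)"
      unfolding set_lebesgue_integral_def using h_eq h
      by (intro integral_cong_AE) auto
    also have "\<dots> = c * (K t f x * (Mr t x - Ml t x)) - c * K t f x * measure unit_leb (fibre t x)"
      using i1 i2 sub by (simp add: integral_fibre[OF f x])
    also have "measure unit_leb (fibre t x) = Mr t x - Ml t x"
      using emeasure_fibre[OF x] x by (simp add: measure_def shocks_def)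
    finally show ?thesis by simp
  qed
  have "integral\<^sup>L unit_leb h = (LINT m:shock_masses t|unit_leb. h m)"
    unfolding set_lebesgue_integral_def
  proof (rule integral_cong_AE)
    show "h \<in> borel_measurable unit_leb" using h by simp
    then show "(\<lambda>m. indicator (shock_masses t) m *\<^sub>R h m) \<in> borel_measurable unit_leb" by measurable
    show "AE m in unit_leb. h m = indicator (shock_masses t) m *\<^sub>R h m"
      using K_degenerate[of t f] by eventually_elim (auto simp: h_def)
  qed
  also have "\<dots> = (LINT m:(\<Union>i. A i)|unit_leb. h m)"
    by (simp only: UA)
  also have "\<dots> = (\<Sum>i. (LINT m:(A i)|unit_leb. h m))"
  proof (rule lebesgue_integral_countable_add[of A unit_leb h])
    show "A i \<in> sets unit_leb" for i by (rule Asets)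
    show "A i \<inter> A j = {}" if "i \<noteq> j" for i j
    proof (rule ccontr)
      assume "A i \<inter> A j \<noteq> {}"
      then obtain m x y where "m \<in> fibre t x" "m \<in> fibre t y"
        "to_nat_on (shocks t) x = i" "to_nat_on (shocks t) y = j"
        by (auto simp: A_def)
      then show False using that fibre_X by metis
    qed
    show "set_integrable unit_leb (\<Union> (range A)) h"
      unfolding UA set_integrable_def by (intro integrable_mult_indicator shock_masses_sets h)
  qed
  also have "\<dots> = (\<Sum>i. 0)"
  proof (intro suminf_cong)
    show "(LINT m:(A i)|unit_leb. h m) = 0" for i
      using A[of i] fibre0 by (auto simp: set_lebesgue_integral_def)
  qed
  finally have "integral\<^sup>L unit_leb h = 0" by simp
  then show ?thesis
    unfolding h_def using int by simp
qed

end

subsection \<open>Laws, forces and the one-sided Lipschitz estimate\<close>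

interpretation unit_leb_pair: pair_prob_space unit_leb unit_leb ..

lemma integrable_pair_fst:
  fixes f :: "real \<Rightarrow> real"
  assumes "integrable unit_leb f"
  shows "integrable (unit_leb \<Otimes>\<^sub>M unit_leb) (\<lambda>z. f (fst z))"
proof -
  have "distr (unit_leb \<Otimes>\<^sub>M unit_leb) unit_leb fst = unit_leb"
    by (rule unit_leb.distr_pair_fst)
  with assms show ?thesis
    by (intro integrable_distr[of fst _ unit_leb f]) simp_all
qed

lemma integrable_pair_snd:
  fixes f :: "real \<Rightarrow> real"
  assumes "integrable unit_leb f"
  shows "integrable (unit_leb \<Otimes>\<^sub>M unit_leb) (\<lambda>z. f (snd z))"
  using unit_leb_pair.integrable_product_swap[OF integrable_pair_fst[OF assms]]
  by (simp add: case_prod_beta')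

text \<open>Exchanging the two variables turns the second half of the integrand into the first. It
  will be applied with the sign of \<open>X t m - X t m'\<close>, whose inner integral is the
  force.\<close>

lemma integral_antisymmetric_pairing:
  fixes f :: "real \<Rightarrow> real" and \<sigma> :: "real \<Rightarrow> real \<Rightarrow> real"
  assumes f: "integrable unit_leb f"
    and \<sigma> [measurable]: "(\<lambda>z. \<sigma> (fst z) (snd z)) \<in> borel_measurable (unit_leb \<Otimes>\<^sub>M unit_leb)"
    and bound: "\<And>m m'. \<bar>\<sigma> m m'\<bar> \<le> 1" and anti: "\<And>m m'. \<sigma> m' m = - \<sigma> m m'"
  shows "integrable (unit_leb \<Otimes>\<^sub>M unit_leb) (\<lambda>z. \<sigma> (fst z) (snd z) * (f (fst z) - f (snd z)))"
    and "(\<integral>z. \<sigma> (fst z) (snd z) * (f (fst z) - f (snd z)) \<partial>(unit_leb \<Otimes>\<^sub>M unit_leb)) =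
      2 * (\<integral>m. (\<integral>m'. \<sigma> m m' \<partial>unit_leb) * f m \<partial>unit_leb)"
proof -
  let ?P = "unit_leb \<Otimes>\<^sub>M unit_leb"
  have [measurable]: "(\<lambda>z. f (fst z)) \<in> borel_measurable ?P" "(\<lambda>z. f (snd z)) \<in> borel_measurable ?P"
    using integrable_pair_fst[OF f] integrable_pair_snd[OF f] by auto
  have le: "\<bar>\<sigma> m m' * y\<bar> \<le> \<bar>y\<bar>" for m m' y
    using mult_right_mono[OF bound[of m m'], of "\<bar>y\<bar>"] by (simp add: abs_mult)
  have i1: "integrable ?P (\<lambda>z. \<sigma> (fst z) (snd z) * f (fst z))"
    by (rule Bochner_Integration.integrable_bound[OF integrable_pair_fst[OF f]]) (use le in auto)
  have i2: "integrable ?P (\<lambda>z. \<sigma> (fst z) (snd z) * f (snd z))"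
    by (rule Bochner_Integration.integrable_bound[OF integrable_pair_snd[OF f]]) (use le in auto)
  show "integrable ?P (\<lambda>z. \<sigma> (fst z) (snd z) * (f (fst z) - f (snd z)))"
    using i1 i2 by (simp add: right_diff_distrib)
  have I1: "(\<integral>z. \<sigma> (fst z) (snd z) * f (fst z) \<partial>?P) = (\<integral>m. (\<integral>m'. \<sigma> m m' \<partial>unit_leb) * f m \<partial>unit_leb)"
    using unit_leb_pair.integral_fst'[OF i1] by simp
  have "(\<integral>z. \<sigma> (fst z) (snd z) * f (snd z) \<partial>?P) = (\<integral>z. \<sigma> (snd z) (fst z) * f (fst z) \<partial>?P)"
    using unit_leb_pair.integral_product_swap[OF borel_measurable_integrable[OF i2]]
    by (simp add: case_prod_beta')
  also have "\<dots> = - (\<integral>z. \<sigma> (fst z) (snd z) * f (fst z) \<partial>?P)"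
    by (simp add: anti[of "fst _" "snd _"])
  finally show "(\<integral>z. \<sigma> (fst z) (snd z) * (f (fst z) - f (snd z)) \<partial>?P) =
      2 * (\<integral>m. (\<integral>m'. \<sigma> m m' \<partial>unit_leb) * f m \<partial>unit_leb)"
    using i1 i2 I1 by (simp add: right_diff_distrib)
qed

lemma integral_unit_leb_indicator:
  assumes "0 \<le> a" "a \<le> 1" "0 \<le> b" "b \<le> 1"
  shows "(\<integral>m. indicator {..<a} m - indicator {b<..} m \<partial>unit_leb) = a + b - 1"
proof -
  have "{..<a} \<inter> {0<..<1} = {0<..<a}" "{b<..} \<inter> {0<..<1} = {b<..<1}" using assms by auto
  moreover have "{0<..<a} \<in> sets unit_leb" "{b<..<1} \<in> sets unit_leb"
    using assms by (auto simp: sets_restrict_space_iff)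
  moreover have "measure unit_leb {0<..<a} = a"
    using assms by (subst measure_restrict_space) auto
  moreover have "measure unit_leb {b<..<1} = 1 - b"
    using assms by (subst measure_restrict_space) auto
  ultimately show ?thesis
    by (subst Bochner_Integration.integral_diff)
       (auto intro!: integrable_real_indicator simp: sets_restrict_space_iff unit_leb.emeasure_finite less_top[symmetric]
         integrable_indicator_iff Int_commute)
qed

context sticky_flow
begin

section \<open>The law of the flow and its force field\<close>

definition law :: "real \<Rightarrow> real measure" where "law t = distr unit_leb borel (X t)"

lemma X_meas [measurable]: "X t \<in> borel_measurable unit_leb"
  by (rule measurable_X) measurable

lemma real_distribution_law: "real_distribution (law t)"
  unfolding law_def by (rule unit_leb.real_distribution_distr) measurable

lemma integral_law:
  fixes f :: "real \<Rightarrow> real"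
  assumes [measurable]: "f \<in> borel_measurable borel"
  shows "(\<integral>x. f x \<partial>law t) = (\<integral>m. f (X t m) \<partial>unit_leb)"
  unfolding law_def by (rule integral_distr) measurable

lemma nn_integral_law:
  assumes [measurable]: "f \<in> borel_measurable borel"
  shows "(\<integral>\<^sup>+x. f x \<partial>law t) = (\<integral>\<^sup>+m. f (X t m) \<partial>unit_leb)"
  unfolding law_def by (rule nn_integral_distr[OF X_meas]) simp

definition force :: "real \<Rightarrow> real \<Rightarrow> real" where "force t x = Ml t x + Mr t x - 1"

lemma measurable_force [measurable (raw)]:
  assumes [measurable]: "f \<in> borel_measurable M" "g \<in> borel_measurable M"
  shows "(\<lambda>z. force (f z) (g z)) \<in> borel_measurable M"
  unfolding force_def by measurable

lemma force_bound: "\<bar>force t x\<bar> \<le> 1"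
  using M_bounds[of t x] by (auto simp: force_def)

text \<open>Labels below \<open>Ml t x\<close> lie left of \<open>x\<close> and count +1, labels
  above \<open>Mr t x\<close> lie right of it and count -1, and the mass in between sits exactly at
  \<open>x\<close>, where the sign is 0.\<close>

lemma integral_sgn_X: "(\<integral>m. sgn (x - X t m) \<partial>unit_leb) = force t x"
proof -
  have "AE m in lborel. m \<noteq> Ml t x" "AE m in lborel. m \<noteq> Mr t x"
    by (rule AE_lborel_singleton)+
  then have "AE m in unit_leb. m \<noteq> Ml t x" "AE m in unit_leb. m \<noteq> Mr t x"
    by (auto simp: AE_unit_leb_iff)
  then have "AE m in unit_leb. sgn (x - X t m) = indicator {..<Ml t x} m - indicator {Mr t x<..} m"
    using AE_space
  proof eventually_elim
    case (elim m)
    then have m: "m \<in> {0<..<1}" by simp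
    consider "m < Ml t x" | "Mr t x < m" | "Ml t x < m" "m < Mr t x" using elim by linarith
    then show ?case
    proof cases
      case 1
      then have "X t m < x" by (rule X_less_Ml[OF m])
      then show ?thesis using 1 Ml_le_Mr[of t x] by (simp add: sgn_if indicator_def)
    next
      case 2
      then have "x < X t m" by (rule X_greater_Mr[OF m])
      then show ?thesis using 2 Ml_le_Mr[of t x] by (simp add: sgn_if indicator_def)
    next
      case 3
      then have "X t m = x" by (rule X_eqI)
      then show ?thesis using 3 by (simp add: indicator_def)
    qed
  qed
  then have "(\<integral>m. sgn (x - X t m) \<partial>unit_leb) =
      (\<integral>m. indicator {..<Ml t x} m - indicator {Mr t x<..} m \<partial>unit_leb)"
    by (intro integral_cong_AE) measurable
  also have "\<dots> = force t x"
    unfolding force_def by (rule integral_unit_leb_indicator) (simp_all add: M_bounds)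
  finally show ?thesis .
qed

lemma sgn_conv_law: "sgn_conv (law t) x = force t x"
  unfolding sgn_conv_def by (subst integral_law) (auto simp: integral_sgn_X)

lemma vel_force: "vel t x = K t w x - t * force t x"
  by (simp add: vel_def force_def algebra_simps)

lemma force_K: "force t x = K t (\<lambda>m. 2 * m - 1) x"
  by (simp only: force_def K_affine)

text \<open>Both free quantities are written as a function plus a multiple of
  \<open>2 * m - 1\<close>, the shape to which \<open>K_linear\<close> and \<open>K_affine\<close>
  apply.\<close>

definition free_pos :: "real \<Rightarrow> real \<Rightarrow> real" where
  "free_pos t m = (q m + t * w m) + (- (t\<^sup>2 / 2)) * (2 * m - 1)"
definition free_vel :: "real \<Rightarrow> real \<Rightarrow> real" where
  "free_vel t m = w m + (- t) * (2 * m - 1)"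

lemma free_meas [measurable]: "free_pos t \<in> borel_measurable borel" "free_vel t \<in> borel_measurable borel"
  unfolding free_pos_def[abs_def] free_vel_def[abs_def] by measurable

lemma free_square:
  "integrable unit_leb (\<lambda>m. (free_pos t m)\<^sup>2)" "integrable unit_leb (\<lambda>m. (free_vel t m)\<^sup>2)"
proof -
  have sq: "(a + c * b)\<^sup>2 \<le> 2 * a\<^sup>2 + 2 * c\<^sup>2 * b\<^sup>2" for a b c :: real
  proof -
    have "(a + c * b)\<^sup>2 + (a - c * b)\<^sup>2 = 2 * a\<^sup>2 + 2 * c\<^sup>2 * b\<^sup>2"
      by (simp add: power2_sum power2_diff power_mult_distrib)
    then show ?thesis using zero_le_power2[of "a - c * b"] by linarith
  qed
  have lin: "integrable unit_leb (\<lambda>m. (f m + c * g m)\<^sup>2)"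
    if [measurable]: "f \<in> borel_measurable borel" "g \<in> borel_measurable borel"
      and "integrable unit_leb (\<lambda>m. (f m)\<^sup>2)" "integrable unit_leb (\<lambda>m. (g m)\<^sup>2)" for f g and c :: real
    by (rule Bochner_Integration.integrable_bound[where f="\<lambda>m. 2 * (f m)\<^sup>2 + 2 * c\<^sup>2 * (g m)\<^sup>2"])
       (use that sq in auto)
  have a: "integrable unit_leb (\<lambda>m. (2 * m - 1)\<^sup>2)"
    by (rule unit_leb.integrable_const_bound[where B=1])
       (auto simp: AE_unit_leb_iff abs_square_le_1)
  show "integrable unit_leb (\<lambda>m. (free_vel t m)\<^sup>2)"
    unfolding free_vel_def by (intro lin w_square a) measurable
  show "integrable unit_leb (\<lambda>m. (free_pos t m)\<^sup>2)"
    unfolding free_pos_def by (intro lin q_square w_square a) measurable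
qed

lemma square_imp_integrable:
  fixes f :: "real \<Rightarrow> real"
  assumes "f \<in> borel_measurable unit_leb" "integrable unit_leb (\<lambda>m. (f m)\<^sup>2)"
  shows "integrable unit_leb f"
  using unit_leb.square_integrable_imp_integrable assms by blast

lemma free_integrable: "integrable unit_leb (free_pos t)" "integrable unit_leb (free_vel t)"
  by (auto intro!: square_imp_integrable free_square)

lemma K_free_vel: "K s (free_vel t) x = K s w x - t * force s x"
  unfolding free_vel_def[abs_def] K_linear[OF w_integrable affine_integrable] force_K by simp

lemma vel_K: "vel t x = K t (free_vel t) x"
  by (simp add: K_free_vel vel_force)

lemma K_free_pos: "K s (free_pos t) x = K s q x + t * K s w x - t\<^sup>2 / 2 * force s x"
proof -
  have i: "integrable unit_leb (\<lambda>m. q m + t * w m)" using q_integrable w_integrable by simp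
  show ?thesis
    unfolding free_pos_def[abs_def] K_linear[OF i affine_integrable] K_linear[OF q_integrable w_integrable] force_K
    by simp
qed

text \<open>On a shock both ends minimize the tilted potential, so \<open>X t m\<close> is the slope
  of the chord of \<open>pot t\<close> between them, which is the mean of the free position. On a
  single-label fibre it is the free position by \<open>contact_slope\<close>.\<close>

lemma X_K:
  assumes m: "m \<in> good" shows "X t m = K t (free_pos t) (X t m)"
proof -
  note m' = good_unit(1)[OF m]
  show ?thesis
  proof (cases "lo t m < hi t m")
    case True
    have "pot t (lo t m) - X t m * lo t m = pot t (hi t m) - X t m * hi t m"
      using contact_le[OF contact_lo, of "hi t m" t m] contact_le[OF contact_hi, of "lo t m" t m]
        contact_bounds[OF contact_lo[of t m]] contact_bounds[OF contact_hi[of t m]] by auto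
    then have e: "X t m * (hi t m - lo t m) = pot t (hi t m) - pot t (lo t m)"
      by (simp add: algebra_simps)
    define c where "c = t\<^sup>2 / 2"
    have avg: "K t f (X t m) * (hi t m - lo t m) = prim f (hi t m) - prim f (lo t m)" for f
      using True by (simp add: K_X[OF m'] avg_def)
    have "K t (free_pos t) (X t m) * (hi t m - lo t m) =
        K t q (X t m) * (hi t m - lo t m) + t * (K t w (X t m) * (hi t m - lo t m)) -
        t\<^sup>2 / 2 * ((lo t m + hi t m - 1) * (hi t m - lo t m))"
      unfolding K_free_pos c_def[symmetric] by (simp add: force_def algebra_simps flip: lo_def hi_def)
    also have "\<dots> = pot t (hi t m) - pot t (lo t m)"
      unfolding avg pot_def c_def[symmetric] by (simp add: algebra_simps power2_eq_square[of "lo t m"] power2_eq_square[of "hi t m"])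
    finally have "K t (free_pos t) (X t m) * (hi t m - lo t m) = pot t (hi t m) - pot t (lo t m)" .
    then have "X t m * (hi t m - lo t m) = K t (free_pos t) (X t m) * (hi t m - lo t m)"
      using e by simp
    then show ?thesis using True by simp
  next
    case False
    then have eq: "lo t m = m" "hi t m = m" using lo_hi(1,2)[OF m', of t] by auto
    have "contact t (X t m) m" using contact_lo[of t m] eq by simp
    from contact_slope[OF m this] show ?thesis
      unfolding K_X[OF m'] eq by (simp add: avg_def free_pos_def algebra_simps diff_divide_distrib)
  qed
qed

lemma X_K_AE: "AE m in unit_leb. K t (free_pos t) (X t m) = X t m"
  using good_AE by eventually_elim (simp flip: X_K)

lemma vel_square_integrable: "integrable unit_leb (\<lambda>m. (vel t (X t m))\<^sup>2)"
  and vel_square_le: "(\<integral>m. (vel t (X t m))\<^sup>2 \<partial>unit_leb) \<le> (\<integral>m. (free_vel t m)\<^sup>2 \<partial>unit_leb)"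
  unfolding vel_K by (rule K_square_integrable free_square free_meas)+

lemma X_square_integrable: "integrable unit_leb (\<lambda>m. (X t m)\<^sup>2)"
proof -
  have "integrable unit_leb (\<lambda>m. (K t (free_pos t) (X t m))\<^sup>2)"
    by (intro K_square_integrable free_square free_meas)
  then show ?thesis
    by (rule integrable_cong_AE_imp[OF _ _ eventually_mono[OF X_K_AE[of t]]]) auto
qed

lemma square_integrable_mult:
  fixes f g :: "real \<Rightarrow> real"
  assumes [measurable]: "f \<in> borel_measurable unit_leb" "g \<in> borel_measurable unit_leb"
    and "integrable unit_leb (\<lambda>m. (f m)\<^sup>2)" "integrable unit_leb (\<lambda>m. (g m)\<^sup>2)"
  shows "integrable unit_leb (\<lambda>m. f m * g m)"
proof (rule Bochner_Integration.integrable_bound[where f="\<lambda>m. (f m)\<^sup>2 + (g m)\<^sup>2"])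
  show "AE m in unit_leb. norm (f m * g m) \<le> norm ((f m)\<^sup>2 + (g m)\<^sup>2)"
  proof (intro AE_I2)
    fix m
    have "2 * \<bar>f m\<bar> * \<bar>g m\<bar> \<le> (f m)\<^sup>2 + (g m)\<^sup>2"
      using sum_squares_bound[of "\<bar>f m\<bar>" "\<bar>g m\<bar>"] by simp
    moreover have "0 \<le> \<bar>f m\<bar> * \<bar>g m\<bar>" by simp
    ultimately have "\<bar>f m\<bar> * \<bar>g m\<bar> \<le> (f m)\<^sup>2 + (g m)\<^sup>2" by linarith
    then show "norm (f m * g m) \<le> norm ((f m)\<^sup>2 + (g m)\<^sup>2)" by (simp add: abs_mult)
  qed
qed (use assms in auto)

text \<open>For \<open>x < y\<close> the labels \<open>Mr t x \<le> Ml t y\<close> separate the two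
  fibres, and the side conditions put both inside the open unit interval. Monotonicity of
  \<open>q\<close> then orders the fibre averages of \<open>q\<close>, the force is ordered in the
  same way, and their combination is position minus \<open>t\<close> times velocity.\<close>

lemma oleinik_core:
  assumes x: "x = K t (free_pos t) x" "0 < Mr t x" and y: "y = K t (free_pos t) y" "Ml t y < 1"
    and lt: "x < y" and t: "0 < t"
  shows "vel t y - vel t x \<le> (y - x) / t"
proof -
  define p p' where "p = Mr t x" and "p' = Ml t y"
  have pp: "p \<le> p'" using Mr_le_Ml[OF lt] by (simp add: p_def p'_def)
  then have p: "p \<in> {0<..<1}" "p' \<in> {0<..<1}" using x y by (auto simp: p_def p'_def)
  have "K t q x \<le> q p"
  proof (cases "Ml t x < Mr t x")
    case True
    have "prim q (Ml t x) \<ge> prim q p + q p * (Ml t x - p)"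
      using M_bounds p by (intro prim_mono_convex q_int q_mono) auto
    then show ?thesis using True by (simp add: K_def avg_def p_def divide_le_eq algebra_simps)
  next
    case False
    then show ?thesis using Ml_le_Mr[of t x] by (simp add: K_def avg_def p_def)
  qed
  also have "q p \<le> q p'" using p pp by (intro mono_onD[OF q_mono])
  also have "q p' \<le> K t q y"
  proof (cases "Ml t y < Mr t y")
    case True
    have "prim q (Mr t y) \<ge> prim q p' + q p' * (Mr t y - p')"
      using M_bounds p by (intro prim_mono_convex q_int q_mono) auto
    then show ?thesis using True by (simp add: K_def avg_def p'_def le_divide_eq algebra_simps)
  next
    case False
    then show ?thesis using Ml_le_Mr[of t y] by (simp add: K_def avg_def p'_def)
  qed
  finally have 1: "K t q x \<le> K t q y" .
  have "force t x \<le> force t y"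
    using Mr_le_Ml[OF lt, of t] Ml_le_Mr[of t x] Ml_le_Mr[of t y] by (simp add: force_def)
  then have 2: "t\<^sup>2 / 2 * force t x \<le> t\<^sup>2 / 2 * force t y"
    by (intro mult_left_mono) auto
  have e: "z - t * vel t z = K t q z + t\<^sup>2 / 2 * force t z" if "z = K t (free_pos t) z" for z
  proof -
    have "z = K t q z + t * K t w z - t\<^sup>2 / 2 * force t z"
      using that unfolding K_free_pos .
    then show ?thesis by (simp add: vel_force algebra_simps power2_eq_square)
  qed
  have "t * (vel t y - vel t x) \<le> y - x"
    using 1 2 e[OF x(1)] e[OF y(1)] by (simp add: algebra_simps)
  then show ?thesis using t by (simp add: le_divide_eq mult.commute)
qed

lemma oleinik:
  assumes t: "0 < t"
  shows "AE (x, y) in law t \<Otimes>\<^sub>M law t. (vel t x - vel t y) * (x - y) \<le> 1 / t * (x - y)\<^sup>2"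
proof -
  interpret L: real_distribution "law t" by (rule real_distribution_law)
  interpret LL: pair_prob_space "law t" "law t" ..
  \<comment> \<open>Collects the conditions of \<open>oleinik_core\<close> at a point; they hold
    along \<open>X t\<close> for almost every label, hence almost everywhere for the law.\<close>
  define Q where "Q x \<longleftrightarrow> x = K t (free_pos t) x \<and> 0 < Mr t x \<and> Ml t x < 1" for x
  have [measurable]: "(\<lambda>x. K t (free_pos t) x) \<in> borel_measurable borel"
    by (intro measurable_K free_meas free_integrable) measurable
  have Qm [measurable]: "Measurable.pred borel Q" unfolding Q_def[abs_def] by measurable
  have "AE m in unit_leb. Q (X t m)"
    using good_AE AE_space
  proof eventually_elim
    case (elim m)
    then show ?case
      using X_K[OF elim(1), of t] Mr_X[of m t] Ml_X[of m t] good_unit[OF elim(1)] unfolding Q_def by auto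
  qed
  then have AQ: "AE x in law t. Q x"
    unfolding law_def by (subst AE_distr_iff) auto
  have "AE z in law t \<Otimes>\<^sub>M law t. Q (fst z) \<and> Q (snd z)"
  proof (rule LL.AE_pair_measure)
    show "{z \<in> space (law t \<Otimes>\<^sub>M law t). Q (fst z) \<and> Q (snd z)} \<in> sets (law t \<Otimes>\<^sub>M law t)"
      by measurable
    show "AE x in law t. AE y in law t. Q (fst (x, y)) \<and> Q (snd (x, y))"
      using AQ by (auto elim!: eventually_mono)
  qed
  then show ?thesis
  proof eventually_elim
    case (elim z)
    obtain x y where z: "z = (x, y)" by (cases z)
    have Q: "Q x" "Q y" using elim z by auto
    have *: "(vel t u - vel t v) * (u - v) \<le> 1 / t * (u - v)\<^sup>2" if "v < u" "Q u" "Q v" for u v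
    proof -
      have "(vel t u - vel t v) * (u - v) \<le> (u - v) / t * (u - v)"
        using that t by (intro mult_right_mono oleinik_core) (auto simp: Q_def)
      then show ?thesis by (simp add: power2_eq_square)
    qed
    have "(vel t x - vel t y) * (x - y) \<le> 1 / t * (x - y)\<^sup>2"
    proof (cases x y rule: linorder_cases)
      case less
      from *[OF less] Q show ?thesis by (simp add: algebra_simps power2_commute)
    qed (use *[of y x] Q in auto)
    then show ?case by (simp add: z)
  qed
qed

section \<open>Interaction energy and conditioning on earlier fibres\<close>

lemma X_integrable: "integrable unit_leb (X t)"
  by (rule square_imp_integrable[OF _ X_square_integrable]) measurable

definition interaction :: "real \<Rightarrow> real" where
  "interaction t = (\<integral>z. 1 / 2 * \<bar>X t (fst z) - X t (snd z)\<bar> \<partial>(unit_leb \<Otimes>\<^sub>M unit_leb))"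

lemma interaction_integrable:
  "integrable (unit_leb \<Otimes>\<^sub>M unit_leb) (\<lambda>z. 1 / 2 * \<bar>X t (fst z) - X t (snd z)\<bar>)"
  using integrable_pair_fst[OF X_integrable] integrable_pair_snd[OF X_integrable] by simp

lemma force_pairing:
  "integrable (unit_leb \<Otimes>\<^sub>M unit_leb) (\<lambda>z. sgn (X t (fst z) - X t (snd z)) * (X s (fst z) - X s (snd z)))"
  "(\<integral>z. sgn (X t (fst z) - X t (snd z)) * (X s (fst z) - X s (snd z)) \<partial>(unit_leb \<Otimes>\<^sub>M unit_leb)) =
    2 * (\<integral>m. force t (X t m) * X s m \<partial>unit_leb)"
proof -
  have "(\<lambda>z. sgn (X t (fst z) - X t (snd z))) \<in> borel_measurable (unit_leb \<Otimes>\<^sub>M unit_leb)"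
    by measurable
  note * = integral_antisymmetric_pairing[OF X_integrable[of s] this]
  show "integrable (unit_leb \<Otimes>\<^sub>M unit_leb) (\<lambda>z. sgn (X t (fst z) - X t (snd z)) * (X s (fst z) - X s (snd z)))"
    by (rule *(1)) (auto simp: sgn_if)
  have "(\<integral>z. sgn (X t (fst z) - X t (snd z)) * (X s (fst z) - X s (snd z)) \<partial>(unit_leb \<Otimes>\<^sub>M unit_leb)) =
    2 * (\<integral>m. (\<integral>m'. sgn (X t m - X t m') \<partial>unit_leb) * X s m \<partial>unit_leb)"
    by (rule *(2)) (auto simp: sgn_if)
  then show "(\<integral>z. sgn (X t (fst z) - X t (snd z)) * (X s (fst z) - X s (snd z)) \<partial>(unit_leb \<Otimes>\<^sub>M unit_leb)) =
    2 * (\<integral>m. force t (X t m) * X s m \<partial>unit_leb)"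
    by (simp add: integral_sgn_X)
qed

lemma interaction_eq: "interaction t = (\<integral>m. force t (X t m) * X t m \<partial>unit_leb)"
proof -
  have "interaction t = 1 / 2 *
      (\<integral>z. sgn (X t (fst z) - X t (snd z)) * (X t (fst z) - X t (snd z)) \<partial>(unit_leb \<Otimes>\<^sub>M unit_leb))"
    unfolding interaction_def by (simp add: sgn_mult_self_eq[symmetric] abs_sgn mult.commute)
  then show ?thesis by (simp add: force_pairing)
qed

text \<open>The subgradient inequality for the convex interaction energy: the pairing of the force
  at time \<open>t\<close> with positions is exact at time \<open>t\<close> by
  \<open>interaction_eq\<close> and a lower bound at any other time, since sgn(a) b never exceeds
  the modulus of b.\<close>

lemma interaction_ge: "(\<integral>m. force t (X t m) * X s m \<partial>unit_leb) \<le> interaction s"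
proof -
  have le: "sgn a * b \<le> \<bar>b\<bar>" for a b :: real by (auto simp: sgn_if)
  have "1 / 2 * (\<integral>z. sgn (X t (fst z) - X t (snd z)) * (X s (fst z) - X s (snd z)) \<partial>(unit_leb \<Otimes>\<^sub>M unit_leb)) =
    (\<integral>z. 1 / 2 * (sgn (X t (fst z) - X t (snd z)) * (X s (fst z) - X s (snd z))) \<partial>(unit_leb \<Otimes>\<^sub>M unit_leb))"
    by simp
  also have "\<dots> \<le> interaction s"
    unfolding interaction_def
    by (intro integral_mono interaction_integrable integrable_mult_right force_pairing(1) mult_left_mono le) auto
  finally show ?thesis by (simp add: force_pairing)
qed

lemma energy_law:
  "energy (law t) (vel t) = ennreal (1 / 2 * (\<integral>m. (vel t (X t m))\<^sup>2 \<partial>unit_leb) + interaction t)"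
proof -
  have "(\<integral>\<^sup>+x. ennreal (1 / 2 * (vel t x)\<^sup>2) \<partial>law t) = (\<integral>\<^sup>+m. ennreal (1 / 2 * (vel t (X t m))\<^sup>2) \<partial>unit_leb)"
    by (rule nn_integral_law) measurable
  also have "\<dots> = ennreal (\<integral>m. 1 / 2 * (vel t (X t m))\<^sup>2 \<partial>unit_leb)"
    using vel_square_integrable[of t] by (intro nn_integral_eq_integral) auto
  finally have 1: "(\<integral>\<^sup>+x. ennreal (1 / 2 * (vel t x)\<^sup>2) \<partial>law t) =
      ennreal (1 / 2 * (\<integral>m. (vel t (X t m))\<^sup>2 \<partial>unit_leb))"
    by simp
  have "(\<integral>\<^sup>+y. (\<integral>\<^sup>+x. ennreal (1 / 2 * \<bar>x - y\<bar>) \<partial>law t) \<partial>law t) =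
      (\<integral>\<^sup>+y. (\<integral>\<^sup>+m. ennreal (1 / 2 * \<bar>X t m - y\<bar>) \<partial>unit_leb) \<partial>law t)"
    by (intro nn_integral_cong nn_integral_law) measurable
  also have "\<dots> = (\<integral>\<^sup>+m'. (\<integral>\<^sup>+m. ennreal (1 / 2 * \<bar>X t m - X t m'\<bar>) \<partial>unit_leb) \<partial>unit_leb)"
    by (rule nn_integral_law) measurable
  also have "\<dots> = (\<integral>\<^sup>+m'. (\<integral>\<^sup>+m. ennreal (1 / 2 * \<bar>X t (fst (m', m)) - X t (snd (m', m))\<bar>) \<partial>unit_leb) \<partial>unit_leb)"
    by (simp add: abs_minus_commute)
  also have "\<dots> = (\<integral>\<^sup>+z. ennreal (1 / 2 * \<bar>X t (fst z) - X t (snd z)\<bar>) \<partial>(unit_leb \<Otimes>\<^sub>M unit_leb))"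
    by (rule unit_leb.nn_integral_fst) measurable
  also have "\<dots> = ennreal (interaction t)"
    unfolding interaction_def by (intro nn_integral_eq_integral interaction_integrable) auto
  finally show ?thesis
    unfolding energy_def 1
    by (subst ennreal_plus) (auto simp: interaction_def)
qed

text \<open>Fibres only grow, so a single good label fixes the later position of its whole fibre. If
  a fibre contained no good label, the claim would be vacuous almost everywhere.\<close>

lemma fibre_later:
  assumes st: "0 < s" "s \<le> t" and x: "x \<in> shocks s"
  obtains y where "AE m in unit_leb. m \<in> fibre s x \<longrightarrow> X t m = y"
proof (cases "\<exists>m\<in>good. m \<in> fibre s x")
  case True
  then obtain m0 where m0: "m0 \<in> good" "m0 \<in> fibre s x" by blast
  have "m \<in> fibre s x \<longrightarrow> X t m = X t m0" for m
  proof
    assume m: "m \<in> fibre s x"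
    have "Ml t (X t m0) \<le> Ml s x" "Mr s x \<le> Mr t (X t m0)"
      using lo_antimono[OF m0(1) st] hi_mono[OF m0(1) st] by (auto simp: lo_def hi_def fibre_X[OF m0(2)])
    then show "X t m = X t m0"
      using m by (intro X_eqI) (auto simp: fibre_def)
  qed
  then show thesis by (intro that[of "X t m0"]) auto
next
  case False
  then show thesis
    by (intro that[of 0] eventually_mono[OF good_AE]) auto
qed

text \<open>A function of the later position is constant on earlier fibres. The alternative
  \<open>s = t\<close> makes the exchange available at time 0 too, where it holds without
  stickiness.\<close>

lemma integral_K_mult_X:
  assumes [measurable]: "f \<in> borel_measurable borel" "\<kappa> \<in> borel_measurable borel"
    and sq: "integrable unit_leb (\<lambda>m. (f m)\<^sup>2)" "integrable unit_leb (\<lambda>m. (\<kappa> (X t m))\<^sup>2)"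
    and st: "s = t \<or> 0 < s \<and> s \<le> t"
  shows "(\<integral>m. f m * \<kappa> (X t m) \<partial>unit_leb) = (\<integral>m. K s f (X s m) * \<kappa> (X t m) \<partial>unit_leb)"
proof (rule integral_K_mult)
  show f: "integrable unit_leb f" by (rule square_imp_integrable[OF _ sq(1)]) measurable
  have [measurable]: "(\<lambda>m. K s f (X s m)) \<in> borel_measurable unit_leb"
    by (intro measurable_K f) measurable
  show "integrable unit_leb (\<lambda>m. K s f (X s m) * \<kappa> (X t m))"
    by (intro square_integrable_mult K_square_integrable(1) sq) measurable
  show "integrable unit_leb (\<lambda>m. f m * \<kappa> (X t m))"
    by (intro square_integrable_mult sq) measurable
  fix x assume x: "x \<in> shocks s"
  show "\<exists>c. AE m in unit_leb. m \<in> fibre s x \<longrightarrow> \<kappa> (X t m) = c"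
  proof (cases "s = t")
    case True
    then show ?thesis by (intro exI[of _ "\<kappa> x"] AE_I2) (auto simp: fibre_X)
  next
    case False
    then obtain y where "AE m in unit_leb. m \<in> fibre s x \<longrightarrow> X t m = y"
      using fibre_later[OF _ _ x, of t] st by auto
    then have "AE m in unit_leb. m \<in> fibre s x \<longrightarrow> \<kappa> (X t m) = \<kappa> y"
      by eventually_elim auto
    then show ?thesis by blast
  qed
qed measurable

end

subsection \<open>Lipschitz paths and test functions\<close>

text \<open>Difference quotients with step \<open>\<delta> n\<close> are dominated by the Lipschitz
  constant and converge almost everywhere to \<open>g'\<close>, while their integrals converge to
  \<open>g R - g 0\<close>. The hypothesis reaches to \<open>R + 1\<close> to leave room for the
  step.\<close>

lemma Lipschitz_FTC:
  fixes g g' :: "real \<Rightarrow> real"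
  assumes R: "0 \<le> R"
    and lip: "\<And>s t. 0 \<le> s \<Longrightarrow> s \<le> t \<Longrightarrow> t \<le> R + 1 \<Longrightarrow> \<bar>g t - g s\<bar> \<le> C * (t - s)"
    and meas: "(\<lambda>t. indicator {0..R} t * g' t) \<in> borel_measurable borel"
    and deriv: "AE t in lborel. 0 < t \<longrightarrow> t < R \<longrightarrow> (g has_real_derivative g' t) (at t)"
  shows "(LBINT t:{0..R}. g' t) = g R - g 0"
proof -
  have C: "0 \<le> C" using lip[of 0 1] R by (auto intro: order_trans[OF abs_ge_zero])
  have lip': "\<bar>g t - g s\<bar> \<le> C * \<bar>t - s\<bar>" if "s \<in> {0..R + 1}" "t \<in> {0..R + 1}" for s t
    using that lip[of s t] lip[of t s] by (cases "s \<le> t") (auto simp: abs_minus_commute)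
  then have "C-lipschitz_on {0..R + 1} g"
    by (intro lipschitz_onI C) (simp add: dist_real_def abs_minus_commute)
  then have cont: "continuous_on {0..R + 1} g" by (rule lipschitz_on_continuous_on)
  define \<delta> where "\<delta> n = 1 / real (Suc n)" for n
  have \<delta>: "0 < \<delta> n" "\<delta> n \<le> 1" for n by (auto simp: \<delta>_def)
  have \<delta>0: "\<delta> \<longlonglongrightarrow> 0" unfolding \<delta>_def by (rule LIMSEQ_Suc[OF lim_1_over_n])
  define h where "h n t = (g (t + \<delta> n) - g t) / \<delta> n" for n t
  have hc: "continuous_on {0..R} (h n)" for n
    unfolding h_def using \<delta>[of n]
    by (intro continuous_intros continuous_on_compose2[OF cont] continuous_on_subset[OF cont]) auto
  have hi: "set_integrable lborel {0..R} (h n)" for n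
    unfolding set_integrable_def by (rule borel_integrable_compact) (auto intro: hc)
  have G: "((\<lambda>x. integral {0..x} g) has_real_derivative g t) (at t within {0..R + 1})" if "t \<in> {0..R + 1}" for t
    by (rule integral_has_real_derivative[OF cont that])
  have lim: "(\<lambda>n. (integral {0..t + \<delta> n} g - integral {0..t} g) / \<delta> n) \<longlonglongrightarrow> g t" if "t \<in> {0..R}" for t
  proof -
    have "((\<lambda>y. (integral {0..y} g - integral {0..t} g) / (y - t)) \<longlongrightarrow> g t) (at t within {0..R + 1})"
      using G[of t] that by (simp add: has_field_derivative_iff)
    moreover have "filterlim (\<lambda>n. t + \<delta> n) (at t within {0..R + 1}) sequentially"
      unfolding filterlim_at
    proof
      show "\<forall>\<^sub>F n in sequentially. t + \<delta> n \<in> {0..R + 1} \<and> t + \<delta> n \<noteq> t"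
        using that \<delta> by (intro always_eventually) (smt (verit) atLeastAtMost_iff)
      show "(\<lambda>n. t + \<delta> n) \<longlonglongrightarrow> t"
        using tendsto_add[OF tendsto_const \<delta>0, of t] by simp
    qed
    ultimately show ?thesis by (drule_tac filterlim_compose) (auto simp: add.commute)
  qed
  \<comment> \<open>A translation of the integral telescopes: only the averages of \<open>g\<close>
    just after \<open>R\<close> and just after 0 survive.\<close>
  have val: "(LBINT t:{0..R}. h n t) = (integral {0..R + \<delta> n} g - integral {0..R} g) / \<delta> n -
      (integral {0..0 + \<delta> n} g - integral {0..0} g) / \<delta> n" for n
  proof -
    have c1: "continuous_on {0 + \<delta> n..R + \<delta> n} g" and c2: "continuous_on {0..R} g"
      and c3: "continuous_on {0..R + \<delta> n} g"
      using \<delta>[of n] by (auto intro: continuous_on_subset[OF cont])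
    have sh: "integral {0..R} (\<lambda>t. g (t + \<delta> n)) = integral {0 + \<delta> n..R + \<delta> n} g"
      using integral_shift[OF c1] by (simp add: o_def)
    have i1: "(\<lambda>t. g (t + \<delta> n)) integrable_on {0..R}"
      using \<delta>[of n] by (intro integrable_continuous_interval continuous_on_compose2[OF cont] continuous_intros) auto
    have "integral {0..\<delta> n} g + integral {\<delta> n..R + \<delta> n} g = integral {0..R + \<delta> n} g"
      using \<delta>[of n] R by (intro Henstock_Kurzweil_Integration.integral_combine integrable_continuous_interval c3) auto
    moreover have "(LBINT t:{0..R}. h n t) = integral {0..R} (h n)"
      by (rule set_borel_integral_eq_integral[OF hi])
    moreover have "integral {0..R} (h n) = (integral {0..R} (\<lambda>t. g (t + \<delta> n)) - integral {0..R} g) / \<delta> n"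
      unfolding h_def using i1 integrable_continuous_interval[OF c2]
      by (simp add: Henstock_Kurzweil_Integration.integral_diff integral_divide)
    ultimately show ?thesis
      using sh by (simp add: diff_divide_distrib add_divide_distrib) (simp add: algebra_simps flip: add_divide_distrib)
  qed
  have l1: "(\<lambda>n. LBINT t:{0..R}. h n t) \<longlonglongrightarrow> g R - g 0"
    unfolding val by (intro tendsto_diff lim) (use R in auto)
  have l2: "(\<lambda>n. LBINT t:{0..R}. h n t) \<longlonglongrightarrow> (LBINT t:{0..R}. g' t)"
    unfolding set_lebesgue_integral_def
  proof (rule integral_dominated_convergence[where w="\<lambda>t. indicator {0..R} t * C"])
    show "(\<lambda>t. indicator {0..R} t *\<^sub>R g' t) \<in> borel_measurable lborel" using meas by simp
    show "(\<lambda>t. indicator {0..R} t *\<^sub>R h n t) \<in> borel_measurable lborel" for n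
      using hi[of n] unfolding set_integrable_def by simp
    show "integrable lborel (\<lambda>t. indicator {0..R} t * C)"
      using borel_integrable_compact[OF compact_Icc continuous_on_const, of 0 R C] by simp
    show "AE t in lborel. norm (indicator {0..R} t *\<^sub>R h n t) \<le> indicator {0..R} t * C" for n
    proof (intro AE_I2)
      fix t
      show "norm (indicator {0..R} t *\<^sub>R h n t) \<le> indicator {0..R} t * C"
        using lip'[of t "t + \<delta> n"] \<delta>[of n] by (auto simp: indicator_def h_def divide_le_eq)
    qed
    have "AE t in lborel. t \<noteq> 0" "AE t in lborel. t \<noteq> R" by (rule AE_lborel_singleton)+
    with deriv show "AE t in lborel. (\<lambda>n. indicator {0..R} t *\<^sub>R h n t) \<longlonglongrightarrow> indicator {0..R} t *\<^sub>R g' t"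
    proof eventually_elim
      case (elim t)
      show ?case
      proof (cases "t \<in> {0..R}")
        case True
        then have "((\<lambda>y. (g (t + y) - g t) / y) \<longlongrightarrow> g' t) (at 0)"
          using elim by (auto simp: DERIV_def)
        moreover have "filterlim \<delta> (at 0) sequentially"
          unfolding filterlim_at using \<delta>0 \<delta> by (auto intro!: always_eventually simp: less_imp_neq[symmetric])
        ultimately have "(\<lambda>n. h n t) \<longlonglongrightarrow> g' t"
          unfolding h_def by (rule filterlim_compose)
        then show ?thesis using True by simp
      qed simp
    qed
  qed
  show ?thesis using LIMSEQ_unique[OF l2 l1] .
qed

lemma test_function_derivatives:
  assumes "test_function \<phi>"
  shows "continuous_on half_plane \<phi>" "continuous_on half_plane (dx \<phi>)" "continuous_on half_plane (dt \<phi>)"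
    and "\<And>x t. 0 \<le> t \<Longrightarrow> ((\<lambda>y. \<phi> (y, t)) has_real_derivative dx \<phi> (x, t)) (at x)"
    and "\<And>x t. 0 \<le> t \<Longrightarrow> ((\<lambda>s. \<phi> (x, s)) has_real_derivative dt \<phi> (x, t)) (at t within {0..})"
proof -
  have "Ck_half_plane 0 \<phi>" and C1: "Ck_half_plane (Suc 0) \<phi>"
    using assms by (auto simp only: test_function_def)
  then show "continuous_on half_plane \<phi>" "continuous_on half_plane (dx \<phi>)" "continuous_on half_plane (dt \<phi>)"
    by auto
  show "((\<lambda>y. \<phi> (y, t)) has_real_derivative dx \<phi> (x, t)) (at x)" if "0 \<le> t" for x t
    using C1 that by (auto simp: dx_def DERIV_deriv_iff_real_differentiable)
  show "((\<lambda>s. \<phi> (x, s)) has_real_derivative dt \<phi> (x, t)) (at t within {0..})" if "0 \<le> t" for x t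
    using C1 that by (auto simp: dt_def vector_derivative_works has_real_derivative_iff_has_vector_derivative)
qed

lemma test_function_support:
  assumes \<phi>: "test_function \<phi>"
  obtains R B :: real where "0 \<le> R" "0 \<le> B"
    "\<And>x t. 0 \<le> t \<Longrightarrow> \<bar>\<phi> (x, t)\<bar> \<le> B \<and> \<bar>dx \<phi> (x, t)\<bar> \<le> B \<and> \<bar>dt \<phi> (x, t)\<bar> \<le> B"
    "\<And>x t. R \<le> t \<Longrightarrow> \<phi> (x, t) = 0 \<and> dx \<phi> (x, t) = 0 \<and> dt \<phi> (x, t) = 0"
proof -
  note d = test_function_derivatives[OF \<phi>]
  have "bounded (closure {p \<in> half_plane. \<phi> p \<noteq> 0})"
    using \<phi> by (auto simp: test_function_def compact_imp_bounded)
  then have "bounded {p \<in> half_plane. \<phi> p \<noteq> 0}"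
    by (rule bounded_subset[OF _ closure_subset])
  then obtain a where a: "\<And>p. p \<in> half_plane \<Longrightarrow> \<phi> p \<noteq> 0 \<Longrightarrow> norm p \<le> a"
    unfolding bounded_iff by blast
  \<comment> \<open>The support lies within distance \<open>R - 1\<close> of the origin. The unit
    margin places \<open>t = R\<close> inside a relatively open set where the function vanishes, so
    its derivatives vanish there as well.\<close>
  define R where "R = max a 0 + 1"
  have z: "\<phi> (x, t) = 0" if "0 \<le> t" "R - 1 < t \<or> R - 1 < \<bar>x\<bar>" for x t
  proof (rule ccontr)
    assume "\<phi> (x, t) \<noteq> 0"
    with a[of "(x, t)"] that have "norm (x, t) \<le> a" by auto
    moreover have "\<bar>x\<bar> \<le> norm (x, t)" "\<bar>t\<bar> \<le> norm (x, t)"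
      using norm_fst_le[of x t] norm_snd_le[of t x] by auto
    ultimately show False using that by (auto simp: R_def)
  qed
  have zx: "dx \<phi> (x, t) = 0" if "0 \<le> t" "R - 1 < t \<or> R - 1 < \<bar>x\<bar>" for x t
  proof -
    have "open {y. R - 1 < t \<or> R - 1 < \<bar>y\<bar>}"
      by (intro open_Collect_disj open_Collect_less continuous_intros open_Collect_const)
    then have "\<forall>\<^sub>F y in nhds x. y \<in> {y. R - 1 < t \<or> R - 1 < \<bar>y\<bar>}"
      using that by (intro eventually_nhds_in_open) auto
    then have "\<forall>\<^sub>F y in nhds x. \<phi> (y, t) = 0"
      by eventually_elim (use z that in auto)
    from DERIV_cong_ev[OF refl this refl, of "dx \<phi> (x, t)"] have "((\<lambda>y. 0) has_real_derivative dx \<phi> (x, t)) (at x)"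
      using d(4)[OF that(1)] by simp
    then show ?thesis using DERIV_unique DERIV_const by blast
  qed
  have zt: "dt \<phi> (x, t) = 0" if "0 \<le> t" "R - 1 < t \<or> R - 1 < \<bar>x\<bar>" for x t
  proof -
    have "open {s. R - 1 < s \<or> R - 1 < \<bar>x\<bar>}"
      by (intro open_Collect_disj open_Collect_less continuous_intros open_Collect_const)
    then have ev: "\<forall>\<^sub>F s in nhds t. s \<in> {s. R - 1 < s \<or> R - 1 < \<bar>x\<bar>}"
      using that by (intro eventually_nhds_in_open) auto
    have "\<forall>\<^sub>F s in at t within {0..}. \<phi> (x, s) = 0"
      unfolding eventually_at_filter using ev by eventually_elim (use z in auto)
    moreover have "\<phi> (x, t) = 0" using z that by auto
    ultimately have "((\<lambda>s. 0) has_real_derivative dt \<phi> (x, t)) (at t within {0..})"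
      using d(5)[OF that(1), of x] unfolding has_field_derivative_iff
      by (auto elim!: Lim_transform_eventually elim: eventually_mono)
    moreover have "((\<lambda>s. 0) has_real_derivative 0) (at t within {0..})" by simp
    \<comment> \<open>The time derivative may be one-sided; it is unique because \<open>t\<close> is
      a limit point of the half line.\<close>
    moreover have "at t within {0..} \<noteq> bot"
    proof -
      have "closure {t<..} \<subseteq> closure ({0..} - {t})"
        using that(1) by (intro closure_mono) auto
      then show ?thesis unfolding at_within_eq_bot_iff by auto
    qed
    ultimately show ?thesis
      using has_field_derivative_unique by blast
  qed
  have bdd: "\<exists>B\<ge>0. \<forall>x t. 0 \<le> t \<longrightarrow> \<bar>f (x, t)\<bar> \<le> B"
    if f: "continuous_on half_plane f" and v: "\<And>x t. 0 \<le> t \<Longrightarrow> R - 1 < t \<or> R - 1 < \<bar>x\<bar> \<Longrightarrow> f (x, t) = 0"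
    for f :: "real \<times> real \<Rightarrow> real"
  proof -
    have "compact (f ` ({- R..R} \<times> {0..R}))"
      by (intro compact_continuous_image continuous_on_subset[OF f] compact_Times compact_Icc) auto
    from compact_imp_bounded[OF this] obtain B where B: "\<And>p. p \<in> {- R..R} \<times> {0..R} \<Longrightarrow> \<bar>f p\<bar> \<le> B"
      unfolding bounded_iff by auto
    have "\<bar>f (x, t)\<bar> \<le> max B 0" if "0 \<le> t" for x t
    proof (cases "R - 1 < t \<or> R - 1 < \<bar>x\<bar>")
      case False
      then have "(x, t) \<in> {- R..R} \<times> {0..R}" using that by auto
      then show ?thesis using B[of "(x, t)"] by linarith
    qed (use v that in auto)
    then show ?thesis by (intro exI[of _ "max B 0"]) auto
  qed
  obtain B0 where B0: "B0 \<ge> 0" "\<And>x t. 0 \<le> t \<Longrightarrow> \<bar>\<phi> (x, t)\<bar> \<le> B0" using bdd[OF d(1) z] by blast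
  obtain B1 where B1: "B1 \<ge> 0" "\<And>x t. 0 \<le> t \<Longrightarrow> \<bar>dx \<phi> (x, t)\<bar> \<le> B1" using bdd[OF d(2) zx] by blast
  obtain B2 where B2: "B2 \<ge> 0" "\<And>x t. 0 \<le> t \<Longrightarrow> \<bar>dt \<phi> (x, t)\<bar> \<le> B2" using bdd[OF d(3) zt] by blast
  show thesis
  proof
    show "0 \<le> R" by (simp add: R_def)
    show "0 \<le> B0 + B1 + B2" using B0 B1 B2 by simp
    show "\<bar>\<phi> (x, t)\<bar> \<le> B0 + B1 + B2 \<and> \<bar>dx \<phi> (x, t)\<bar> \<le> B0 + B1 + B2 \<and> \<bar>dt \<phi> (x, t)\<bar> \<le> B0 + B1 + B2"
      if "0 \<le> t" for x t
      using B0(1) B1(1) B2(1) B0(2)[OF that, of x] B1(2)[OF that, of x] B2(2)[OF that, of x] by linarith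
    show "\<phi> (x, t) = 0 \<and> dx \<phi> (x, t) = 0 \<and> dt \<phi> (x, t) = 0" if "R \<le> t" for x t
    proof -
      have "0 \<le> t" "R - 1 < t" using that by (auto simp: R_def)
      then show ?thesis using z zx zt by auto
    qed
  qed
qed

lemma test_function_Lipschitz:
  assumes \<phi>: "test_function \<phi>"
    and B: "\<And>x t. 0 \<le> t \<Longrightarrow> \<bar>dx \<phi> (x, t)\<bar> \<le> B" "\<And>x t. 0 \<le> t \<Longrightarrow> \<bar>dt \<phi> (x, t)\<bar> \<le> B"
    and st: "0 \<le> s" "0 \<le> t"
  shows "\<bar>\<phi> (y, t) - \<phi> (x, s)\<bar> \<le> B * \<bar>y - x\<bar> + B * \<bar>t - s\<bar>"
proof -
  note d = test_function_derivatives[OF \<phi>]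
  have "norm (\<phi> (y, t) - \<phi> (x, t)) \<le> B * norm (y - x)"
    by (rule field_differentiable_bound[where S=UNIV and f'="\<lambda>z. dx \<phi> (z, t)"])
       (use d(4) B st in auto)
  moreover have "norm (\<phi> (x, t) - \<phi> (x, s)) \<le> B * norm (t - s)"
    by (rule field_differentiable_bound[where S="{0..}" and f'="\<lambda>z. dt \<phi> (x, z)"])
       (use d(5) B st in auto)
  ultimately show ?thesis by simp
qed

text \<open>Only partial derivatives are given. Continuity of \<open>dt \<phi>\<close> upgrades them
  to a total derivative relative to the closed half plane, and at a positive time the derivative
  along the path is two-sided.\<close>

lemma test_function_chain:
  assumes \<phi>: "test_function \<phi>" and t: "0 < t" and f: "(f has_real_derivative f') (at t)"
  shows "((\<lambda>r. \<phi> (f r, r)) has_real_derivative dt \<phi> (f t, t) + f' * dx \<phi> (f t, t)) (at t)"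
proof -
  note d = test_function_derivatives[OF \<phi>]
  have "((\<lambda>(x, y). \<phi> (x, y)) has_derivative
      (\<lambda>(tx, ty). dx \<phi> (f t, t) * tx + (dt \<phi> (f t, t) *\<^sub>R id_blinfun) ty)) (at (f t, t) within UNIV \<times> {0..})"
  proof (rule has_derivative_partialsI[where fy="\<lambda>x y. dt \<phi> (x, y) *\<^sub>R id_blinfun" and f="\<lambda>x y. \<phi> (x, y)"])
    show "((\<lambda>x. \<phi> (x, t)) has_derivative (*) (dx \<phi> (f t, t))) (at (f t))"
      using d(4)[of t "f t"] t by (simp add: has_field_derivative_def)
    show "((\<lambda>y. \<phi> (x, y)) has_derivative blinfun_apply (dt \<phi> (x, y) *\<^sub>R id_blinfun)) (at y within {0..})"
      if "y \<in> {0..}" for x y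
      using d(5)[of y x] that by (simp add: has_field_derivative_def scaleR_blinfun.rep_eq mult_commute_abs)
    have "continuous (at (f t, t) within half_plane) (dt \<phi>)"
      using d(3) t by (auto simp: continuous_on_eq_continuous_within)
    then show "continuous (at (f t, t) within half_plane) (\<lambda>(x, y). dt \<phi> (x, y) *\<^sub>R id_blinfun)"
      by (simp add: case_prod_beta' continuous_intros)
  qed (use t in auto)
  then have 1: "(\<phi> has_derivative (\<lambda>z. dx \<phi> (f t, t) * fst z + dt \<phi> (f t, t) * snd z)) (at (f t, t) within half_plane)"
    by (simp add: case_prod_beta' scaleR_blinfun.rep_eq)
  have "(f has_derivative (*) f') (at t within {0..})"
    using f by (simp add: has_field_derivative_def has_derivative_at_withinI)
  then have 2: "((\<lambda>r. (f r, r)) has_derivative (\<lambda>h. (f' * h, h))) (at t within {0..})"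
    by (intro has_derivative_Pair has_derivative_ident)
  have "((\<lambda>r. \<phi> (f r, r)) has_derivative
      (\<lambda>h. dx \<phi> (f t, t) * fst (f' * h, h) + dt \<phi> (f t, t) * snd (f' * h, h))) (at t within {0..})"
    by (rule has_derivative_in_compose[OF 2]) (rule has_derivative_subset[OF 1], auto)
  moreover have "at t within {0..} = at t"
    using t by (intro at_within_interior) simp
  moreover have "(\<lambda>h. dx \<phi> (f t, t) * fst (f' * h, h) + dt \<phi> (f t, t) * snd (f' * h, h)) =
      (*) (dt \<phi> (f t, t) + f' * dx \<phi> (f t, t))"
    by (auto simp: fun_eq_iff algebra_simps)
  ultimately show ?thesis
    unfolding has_field_derivative_def by simp
qed

subsection \<open>Energy, narrow continuity and integrability\<close>

interpretation time_mass: pair_sigma_finite lborel unit_leb ..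

context sticky_flow
begin

text \<open>Conditioning the free velocity of time \<open>s\<close> on the position at time
  \<open>t\<close> gives \<open>\<kappa>\<close>, and by stickiness it is also the projection of the
  velocity \<open>W\<close> at time \<open>s\<close>. Its norm is thus at most that of
  \<open>W\<close>, and expanding \<open>\<kappa>\<close> produces the terms in \<open>A * V\<close>
  and \<open>A^2\<close>. The interaction can increase by at most half of these terms, so they
  cancel in the total energy.\<close>

lemma energy_decrease:
  assumes st: "0 < s" "s \<le> t"
  shows "energy (law t) (vel t) \<le> energy (law s) (vel s)"
proof -
  define \<Delta> where "\<Delta> = t - s"
  define \<kappa> where "\<kappa> x = vel t x + \<Delta> * force t x" for x
  define V where "V = (\<lambda>m. vel t (X t m))"
  define A where "A = (\<lambda>m. force t (X t m))"
  define W where "W = (\<lambda>m. vel s (X s m))"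
  have [measurable]: "\<kappa> \<in> borel_measurable borel" "V \<in> borel_measurable unit_leb"
    "A \<in> borel_measurable unit_leb" "W \<in> borel_measurable unit_leb"
    unfolding \<kappa>_def[abs_def] V_def A_def W_def by measurable
  have sq [simp]: "integrable unit_leb (\<lambda>m. (V m)\<^sup>2)" "integrable unit_leb (\<lambda>m. (W m)\<^sup>2)"
    "integrable unit_leb (\<lambda>m. (X s m)\<^sup>2)"
    unfolding V_def W_def by (rule vel_square_integrable X_square_integrable)+
  have sqA [simp]: "integrable unit_leb (\<lambda>m. (A m)\<^sup>2)"
    by (rule unit_leb.integrable_const_bound[where B=1])
       (auto simp: A_def force_bound abs_square_le_1)
  have prods [simp]: "integrable unit_leb (\<lambda>m. A m * V m)" "integrable unit_leb (\<lambda>m. A m * X s m)"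
    by (auto intro!: square_integrable_mult)
  have \<kappa>X: "\<kappa> (X t m) = V m + \<Delta> * A m" for m by (simp add: \<kappa>_def V_def A_def)
  have eq2: "(V m + \<Delta> * A m)\<^sup>2 = (V m)\<^sup>2 + 2 * \<Delta> * (A m * V m) + \<Delta>\<^sup>2 * (A m)\<^sup>2" for m
    by (simp add: power2_eq_square algebra_simps)
  have \<kappa>2 [simp]: "integrable unit_leb (\<lambda>m. (\<kappa> (X t m))\<^sup>2)"
    unfolding \<kappa>X eq2 by simp
  have K\<kappa>: "K t (free_vel s) x = \<kappa> x" for x
    by (simp add: K_free_vel \<kappa>_def vel_force \<Delta>_def algebra_simps)
  \<comment> \<open>\<open>W\<close> is the average of \<open>free_vel s\<close> over fibres at time
    \<open>s\<close>. The average is undone against a function of \<open>X t\<close>, then taken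
    again over the larger fibres at time \<open>t\<close>.\<close>
  have "(\<integral>m. W m * \<kappa> (X t m) \<partial>unit_leb) = (\<integral>m. free_vel s m * \<kappa> (X t m) \<partial>unit_leb)"
    unfolding W_def vel_K by (rule integral_K_mult_X[symmetric]) (use st in \<open>auto simp: free_square\<close>)
  also have "\<dots> = (\<integral>m. K t (free_vel s) (X t m) * \<kappa> (X t m) \<partial>unit_leb)"
    by (rule integral_K_mult_X) (auto simp: free_square)
  finally have W\<kappa>: "(\<integral>m. W m * \<kappa> (X t m) \<partial>unit_leb) = (\<integral>m. (\<kappa> (X t m))\<^sup>2 \<partial>unit_leb)"
    by (simp add: K\<kappa> power2_eq_square)
  have W\<kappa>i: "integrable unit_leb (\<lambda>m. W m * \<kappa> (X t m))"
    by (intro square_integrable_mult) simp_all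
  have "0 \<le> (\<integral>m. (W m - \<kappa> (X t m))\<^sup>2 \<partial>unit_leb)" by simp
  also have "\<dots> = (\<integral>m. (W m)\<^sup>2 - 2 * (W m * \<kappa> (X t m)) + (\<kappa> (X t m))\<^sup>2 \<partial>unit_leb)"
    by (simp add: power2_diff algebra_simps)
  also have "\<dots> = (\<integral>m. (W m)\<^sup>2 \<partial>unit_leb) - (\<integral>m. (\<kappa> (X t m))\<^sup>2 \<partial>unit_leb)"
    using W\<kappa>i W\<kappa> by simp
  also have "(\<integral>m. (\<kappa> (X t m))\<^sup>2 \<partial>unit_leb) =
      (\<integral>m. (V m)\<^sup>2 \<partial>unit_leb) + 2 * \<Delta> * (\<integral>m. A m * V m \<partial>unit_leb) + \<Delta>\<^sup>2 * (\<integral>m. (A m)\<^sup>2 \<partial>unit_leb)"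
    unfolding \<kappa>X eq2 by simp
  finally have kin: "(\<integral>m. (V m)\<^sup>2 \<partial>unit_leb) + 2 * \<Delta> * (\<integral>m. A m * V m \<partial>unit_leb) +
      \<Delta>\<^sup>2 * (\<integral>m. (A m)\<^sup>2 \<partial>unit_leb) \<le> (\<integral>m. (W m)\<^sup>2 \<partial>unit_leb)"
    by simp
  \<comment> \<open>Free motion traced back from time \<open>t\<close> to time \<open>s\<close>: the
    force term has a plus sign because the velocity is the one at the end of the time span.\<close>
  have Kp: "K t (free_pos t) x = K t (free_pos s) x + \<Delta> * vel t x + \<Delta>\<^sup>2 / 2 * force t x" for x
    unfolding K_free_pos vel_force \<Delta>_def
    by (simp add: algebra_simps power2_eq_square add_divide_distrib diff_divide_distrib)
  have [measurable]: "(\<lambda>m. K t (free_pos s) (X t m)) \<in> borel_measurable unit_leb"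
    "(\<lambda>m. K s (free_pos s) (X s m)) \<in> borel_measurable unit_leb"
    by (intro measurable_K free_integrable; measurable)+
  have KAi [simp]: "integrable unit_leb (\<lambda>m. K t (free_pos s) (X t m) * A m)"
    by (intro square_integrable_mult K_square_integrable(1) free_square sqA) measurable
  have "(\<integral>m. K t (free_pos s) (X t m) * A m \<partial>unit_leb) = (\<integral>m. free_pos s m * A m \<partial>unit_leb)"
    unfolding A_def by (rule integral_K_mult_X[symmetric]) (use sqA in \<open>auto simp: free_square A_def\<close>)
  also have "\<dots> = (\<integral>m. K s (free_pos s) (X s m) * A m \<partial>unit_leb)"
    unfolding A_def by (rule integral_K_mult_X) (use sqA st in \<open>auto simp: free_square A_def\<close>)
  also have "\<dots> = (\<integral>m. A m * X s m \<partial>unit_leb)"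
  proof (rule integral_cong_AE)
    show "(\<lambda>m. K s (free_pos s) (X s m) * A m) \<in> borel_measurable unit_leb" by measurable
    show "(\<lambda>m. A m * X s m) \<in> borel_measurable unit_leb" by measurable
    show "AE m in unit_leb. K s (free_pos s) (X s m) * A m = A m * X s m"
      using X_K_AE[of s] by eventually_elim simp
  qed
  finally have KA: "(\<integral>m. K t (free_pos s) (X t m) * A m \<partial>unit_leb) = (\<integral>m. A m * X s m \<partial>unit_leb)" .
  have "interaction t = (\<integral>m. A m * X t m \<partial>unit_leb)"
    by (simp add: interaction_eq A_def)
  also have "\<dots> = (\<integral>m. K t (free_pos s) (X t m) * A m + \<Delta> * (A m * V m) + \<Delta>\<^sup>2 / 2 * (A m)\<^sup>2 \<partial>unit_leb)"
  proof (rule integral_cong_AE)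
    show "(\<lambda>m. A m * X t m) \<in> borel_measurable unit_leb" by measurable
    show "(\<lambda>m. K t (free_pos s) (X t m) * A m + \<Delta> * (A m * V m) + \<Delta>\<^sup>2 / 2 * (A m)\<^sup>2) \<in> borel_measurable unit_leb"
      by measurable
    show "AE m in unit_leb. A m * X t m =
        K t (free_pos s) (X t m) * A m + \<Delta> * (A m * V m) + \<Delta>\<^sup>2 / 2 * (A m)\<^sup>2"
      using X_K_AE[of t]
    proof eventually_elim
      case (elim m)
      then have "X t m = K t (free_pos s) (X t m) + \<Delta> * V m + \<Delta>\<^sup>2 / 2 * A m"
        by (simp add: Kp V_def A_def)
      then have "A m * X t m = A m * (K t (free_pos s) (X t m) + \<Delta> * V m + \<Delta>\<^sup>2 / 2 * A m)"
        by (rule arg_cong)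
      then show ?case by (simp add: algebra_simps power2_eq_square)
    qed
  qed
  also have "\<dots> = (\<integral>m. A m * X s m \<partial>unit_leb) + \<Delta> * (\<integral>m. A m * V m \<partial>unit_leb) + \<Delta>\<^sup>2 / 2 * (\<integral>m. (A m)\<^sup>2 \<partial>unit_leb)"
    using KA by simp
  also have "(\<integral>m. A m * X s m \<partial>unit_leb) \<le> interaction s"
    unfolding A_def by (rule interaction_ge)
  finally have "interaction t \<le> interaction s + \<Delta> * (\<integral>m. A m * V m \<partial>unit_leb) + \<Delta>\<^sup>2 / 2 * (\<integral>m. (A m)\<^sup>2 \<partial>unit_leb)"
    by simp
  \<comment> \<open>Half of \<open>kin\<close> is added; the terms with \<open>\<Delta>\<close> are
    the same on both sides.\<close>
  then have "1 / 2 * (\<integral>m. (V m)\<^sup>2 \<partial>unit_leb) + interaction t \<le> 1 / 2 * (\<integral>m. (W m)\<^sup>2 \<partial>unit_leb) + interaction s"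
    using kin by simp
  then show ?thesis
    unfolding energy_law V_def W_def by (intro ennreal_leI)
qed

section \<open>Continuity of the curve of laws and integrability over time and mass\<close>

lemma X_continuous:
  assumes "m \<in> good" "0 \<le> t"
  shows "((\<lambda>r. X r m) \<longlongrightarrow> X t m) (at t within {0..})"
proof -
  obtain C where C: "C \<ge> 0"
    "\<And>r s. 0 \<le> r \<Longrightarrow> r \<le> s \<Longrightarrow> s \<le> t + 1 \<Longrightarrow> \<bar>X s m - X r m\<bar> \<le> C * (s - r)"
    by (rule X_Lipschitz[OF assms(1), of "t + 1"]) (rule that)
  have "((\<lambda>r. C * \<bar>r - t\<bar>) \<longlongrightarrow> C * \<bar>t - t\<bar>) (at t within {0..})"
    by (intro tendsto_intros)
  then have lim: "((\<lambda>r. C * \<bar>r - t\<bar>) \<longlongrightarrow> 0) (at t within {0..})" by simp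
  have "\<forall>\<^sub>F r in at t within {0..}. r < t + 1"
    by (intro order_tendstoD(2)[OF tendsto_ident_at]) simp
  moreover have "\<forall>\<^sub>F r in at t within {0..}. 0 \<le> r"
    by (simp add: eventually_at_filter)
  ultimately have "\<forall>\<^sub>F r in at t within {0..}. norm (X r m - X t m) \<le> C * \<bar>r - t\<bar>"
  proof eventually_elim
    case (elim r)
    then show ?case
      using C(2)[of r t] C(2)[of t r] assms(2) by (cases "r \<le> t") (auto simp: abs_minus_commute)
  qed
  from Lim_null_comparison[OF this lim] show ?thesis
    by (simp add: LIM_zero_iff)
qed

lemma narrowly_continuous_law: "narrowly_continuous law"
  unfolding narrowly_continuous_def narrow_limit_def
proof (intro conjI allI impI real_distribution_law)
  fix t :: real and f :: "real \<Rightarrow> real"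
  assume t: "0 \<le> t" and f: "continuous_on UNIV f \<and> bounded (range f)"
  have fm [measurable]: "f \<in> borel_measurable borel" using f by (intro borel_measurable_continuous_onI) simp
  obtain B where B: "\<And>x. \<bar>f x\<bar> \<le> B" using f by (auto simp: bounded_iff)
  show "((\<lambda>t. \<integral>x. f x \<partial>law t) \<longlongrightarrow> (\<integral>x. f x \<partial>law t)) (at t within {0..})"
    unfolding integral_law[OF fm] tendsto_at_iff_sequentially
  proof (intro allI impI)
    fix r :: "nat \<Rightarrow> real" assume r: "\<forall>i. r i \<in> {0..} - {t}" "r \<longlonglongrightarrow> t"
    have "(\<lambda>i. \<integral>m. f (X (r i) m) \<partial>unit_leb) \<longlonglongrightarrow> (\<integral>m. f (X t m) \<partial>unit_leb)"
    proof (rule integral_dominated_convergence[where w="\<lambda>_. B"])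
      show "AE m in unit_leb. (\<lambda>i. f (X (r i) m)) \<longlonglongrightarrow> f (X t m)"
        using good_AE
      proof eventually_elim
        case (elim m)
        have "(\<lambda>i. X (r i) m) \<longlonglongrightarrow> X t m"
          using X_continuous[OF elim t] r unfolding tendsto_at_iff_sequentially o_def by blast
        moreover have "isCont f (X t m)"
          using f by (auto simp: continuous_on_eq_continuous_at)
        ultimately show ?case by (rule isCont_tendsto_compose[rotated])
      qed
    qed (auto simp: B)
    then show "((\<lambda>t. \<integral>m. f (X t m) \<partial>unit_leb) \<circ> r) \<longlonglongrightarrow> (\<integral>m. f (X t m) \<partial>unit_leb)"
      by (simp add: o_def)
  qed
qed

text \<open>A time cutoff as a factor on pairs of time and label, so that local integrability is
  stated in the full product measure and Fubini applies directly.\<close>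

definition slab :: "real \<Rightarrow> real \<times> real \<Rightarrow> real" where "slab R z = indicator {0..R} (fst z)"

lemma slab_measurable [measurable]: "slab R \<in> borel_measurable (lborel \<Otimes>\<^sub>M unit_leb)"
  unfolding slab_def[abs_def] by measurable

lemma X_pair_meas [measurable]: "(\<lambda>z. X (fst z) (snd z)) \<in> borel_measurable (lborel \<Otimes>\<^sub>M unit_leb)"
  by (rule measurable_X) measurable

lemma snd_unit_leb [measurable]: "(\<lambda>z. snd z) \<in> borel_measurable (M \<Otimes>\<^sub>M unit_leb)"
  by (rule measurable_unit_leb_borel) measurable

lemma integrable_slab:
  assumes [measurable]: "f \<in> borel_measurable (lborel \<Otimes>\<^sub>M unit_leb)"
    and nn: "\<And>z. 0 \<le> f z" and C: "0 \<le> C"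
    and le: "\<And>r. 0 \<le> r \<Longrightarrow> r \<le> R \<Longrightarrow> (\<integral>\<^sup>+m. ennreal (f (r, m)) \<partial>unit_leb) \<le> ennreal C"
  shows "integrable (lborel \<Otimes>\<^sub>M unit_leb) (\<lambda>z. slab R z * f z)"
proof (rule integrableI_nonneg)
  have "(\<integral>\<^sup>+z. ennreal (slab R z * f z) \<partial>(lborel \<Otimes>\<^sub>M unit_leb)) =
      (\<integral>\<^sup>+r. (\<integral>\<^sup>+m. ennreal (slab R (r, m) * f (r, m)) \<partial>unit_leb) \<partial>lborel)"
    by (rule unit_leb.nn_integral_fst[symmetric]) measurable
  also have "\<dots> \<le> (\<integral>\<^sup>+r. ennreal C * indicator {0..R} r \<partial>lborel)"
    using le by (intro nn_integral_mono) (auto simp: slab_def indicator_def)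
  also have "\<dots> < \<infinity>"
    by (simp add: nn_integral_cmult_indicator ennreal_mult_less_top emeasure_lborel_Icc_eq)
  finally show "(\<integral>\<^sup>+z. ennreal (slab R z * f z) \<partial>(lborel \<Otimes>\<^sub>M unit_leb)) < \<infinity>" .
qed (use nn in \<open>auto simp: slab_def\<close>)

text \<open>By the parallelogram identity and the bound 1 for the modulus of 2m - 1. The bound is
  uniform in \<open>r\<close>, and \<open>vel_square_le\<close> passes it on to the
  velocity.\<close>

lemma free_vel_square_bound:
  assumes "0 \<le> r" "r \<le> R"
  shows "(\<integral>m. (free_vel r m)\<^sup>2 \<partial>unit_leb) \<le> 2 * (\<integral>m. (w m)\<^sup>2 \<partial>unit_leb) + 2 * R\<^sup>2"
proof -
  have "(\<integral>m. (free_vel r m)\<^sup>2 \<partial>unit_leb) \<le> (\<integral>m. 2 * (w m)\<^sup>2 + 2 * R\<^sup>2 \<partial>unit_leb)"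
  proof (rule integral_mono_AE)
    show "AE m in unit_leb. (free_vel r m)\<^sup>2 \<le> 2 * (w m)\<^sup>2 + 2 * R\<^sup>2"
      using AE_space
    proof eventually_elim
      case (elim m)
      have "\<bar>r * (2 * m - 1)\<bar> \<le> R * 1"
        unfolding abs_mult using assms elim by (intro mult_mono) auto
      then have "(r * (2 * m - 1))\<^sup>2 \<le> R\<^sup>2"
        using assms by (simp add: abs_le_square_iff[symmetric])
      moreover have "(free_vel r m)\<^sup>2 + (w m + r * (2 * m - 1))\<^sup>2 = 2 * (w m)\<^sup>2 + 2 * (r * (2 * m - 1))\<^sup>2"
        by (simp add: free_vel_def power2_sum power2_diff)
      moreover have "0 \<le> (w m + r * (2 * m - 1))\<^sup>2" by simp
      ultimately show ?case by linarith
    qed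
  qed (use free_square w_square in auto)
  then show ?thesis using w_square unit_leb.prob_space by simp
qed

lemma vel_slab: "integrable (lborel \<Otimes>\<^sub>M unit_leb) (\<lambda>z. slab R z * (vel (fst z) (X (fst z) (snd z)))\<^sup>2)"
  and free_vel_slab: "integrable (lborel \<Otimes>\<^sub>M unit_leb) (\<lambda>z. slab R z * (free_vel (fst z) (snd z))\<^sup>2)"
  and one_slab: "integrable (lborel \<Otimes>\<^sub>M unit_leb) (\<lambda>z. slab R z)"
proof -
  let ?C = "2 * (\<integral>m. (w m)\<^sup>2 \<partial>unit_leb) + 2 * R\<^sup>2"
  show "integrable (lborel \<Otimes>\<^sub>M unit_leb) (\<lambda>z. slab R z * (vel (fst z) (X (fst z) (snd z)))\<^sup>2)"
  proof (rule integrable_slab[where C="?C"])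
    fix r assume "0 \<le> r" "r \<le> R"
    from order_trans[OF vel_square_le free_vel_square_bound[OF this]]
    show "(\<integral>\<^sup>+m. ennreal ((vel (fst (r, m)) (X (fst (r, m)) (snd (r, m))))\<^sup>2) \<partial>unit_leb) \<le> ennreal ?C"
      using vel_square_integrable by (simp add: nn_integral_eq_integral ennreal_leI del: ennreal_plus)
  qed auto
  have [measurable]: "(\<lambda>z. free_vel (fst z) (snd z)) \<in> borel_measurable (lborel \<Otimes>\<^sub>M unit_leb)"
    unfolding free_vel_def by measurable
  show "integrable (lborel \<Otimes>\<^sub>M unit_leb) (\<lambda>z. slab R z * (free_vel (fst z) (snd z))\<^sup>2)"
  proof (rule integrable_slab[where C="?C"])
    fix r assume "0 \<le> r" "r \<le> R"
    from free_vel_square_bound[OF this]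
    show "(\<integral>\<^sup>+m. ennreal ((free_vel (fst (r, m)) (snd (r, m)))\<^sup>2) \<partial>unit_leb) \<le> ennreal ?C"
      using free_square by (simp add: nn_integral_eq_integral ennreal_leI del: ennreal_plus)
  qed auto
  show "integrable (lborel \<Otimes>\<^sub>M unit_leb) (\<lambda>z. slab R z)"
    using integrable_slab[of "\<lambda>_. 1" 1 R] unit_leb.emeasure_space_1 by simp
qed

lemma vel_locally_square_integrable:
  "(\<integral>\<^sup>+t\<in>{0..T}. (\<integral>\<^sup>+x. ennreal ((vel t x)\<^sup>2) \<partial>law t) \<partial>lborel) < \<infinity>"
proof -
  have "(\<integral>\<^sup>+t\<in>{0..T}. (\<integral>\<^sup>+x. ennreal ((vel t x)\<^sup>2) \<partial>law t) \<partial>lborel) =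
    (\<integral>\<^sup>+t. (\<integral>\<^sup>+m. ennreal (slab T (t, m) * (vel (fst (t, m)) (X (fst (t, m)) (snd (t, m))))\<^sup>2) \<partial>unit_leb) \<partial>lborel)"
    by (intro nn_integral_cong) (auto simp: slab_def indicator_def nn_integral_law)
  also have "\<dots> = (\<integral>\<^sup>+z. ennreal (slab T z * (vel (fst z) (X (fst z) (snd z)))\<^sup>2) \<partial>(lborel \<Otimes>\<^sub>M unit_leb))"
    by (rule unit_leb.nn_integral_fst) measurable
  also have "\<dots> < \<infinity>"
    using vel_slab[of T] by (subst nn_integral_eq_integral) (auto simp: slab_def)
  finally show ?thesis .
qed

end

subsection \<open>The weak equations\<close>

text \<open>A test function and its derivatives are controlled only for nonnegative times.
  Multiplication by the indicator gives a globally Borel function that can be composed with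
  trajectories.\<close>

lemma half_plane_indicator_measurable:
  fixes f :: "real \<times> real \<Rightarrow> real"
  assumes "continuous_on half_plane f"
  shows "(\<lambda>z. indicator half_plane z * f z) \<in> borel_measurable borel"
proof -
  have "closed half_plane" by (intro closed_Times closed_UNIV closed_atLeast)
  then have "half_plane \<in> sets borel" by (rule borel_closed)
  from borel_measurable_continuous_on_indicator[OF this assms] show ?thesis by simp
qed

section \<open>Continuity and growth of the initial velocity\<close>

lemma abs_cont_uniform:
  assumes "abs_cont_on_line f" "0 < e"
  obtains d where "0 < d" "\<And>x y. \<bar>x - y\<bar> < d \<Longrightarrow> \<bar>f x - f y\<bar> < e"
proof -
  obtain d where d: "0 < d" "\<And>(n::nat) (a::nat \<Rightarrow> real) b. (\<forall>i<n. a i < b i) \<and>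
      disjoint_family_on (\<lambda>i. {a i<..<b i}) {..<n} \<and> (\<Sum>i<n. b i - a i) < d \<Longrightarrow> (\<Sum>i<n. \<bar>f (b i) - f (a i)\<bar>) < e"
    using assms unfolding abs_cont_on_line_def by meson
  have lt: "\<bar>f y - f x\<bar> < e" if "x < y" "y - x < d" for x y
    using d(2)[of 1 "\<lambda>_. x" "\<lambda>_. y"] that by (auto simp: disjoint_family_on_def)
  show thesis
  proof
    show "0 < d" by (rule d)
    show "\<bar>f x - f y\<bar> < e" if "\<bar>x - y\<bar> < d" for x y
      using lt[of x y] lt[of y x] that assms(2)
      by (cases x y rule: linorder_cases) (auto simp: abs_minus_commute)
  qed
qed

lemma abs_cont_imp_isCont:
  assumes "abs_cont_on_line f" shows "isCont f x"
  unfolding continuous_at_eps_delta dist_real_def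
proof (intro allI impI)
  fix e :: real assume "0 < e"
  from abs_cont_uniform[OF assms this] obtain d where "0 < d" "\<And>x y. \<bar>x - y\<bar> < d \<Longrightarrow> \<bar>f x - f y\<bar> < e"
    by metis
  then show "\<exists>d>0. \<forall>x'. \<bar>x' - x\<bar> < d \<longrightarrow> \<bar>f x' - f x\<bar> < e" by auto
qed

text \<open>A uniformly continuous function changes by less than 1 over each step of length
  \<open>d / 2\<close>, and the number of steps from 0 to \<open>x\<close> is linear in the modulus
  of \<open>x\<close>.\<close>

lemma abs_cont_linear_growth:
  assumes "abs_cont_on_line f"
  obtains C where "\<And>x. \<bar>f x\<bar> \<le> C * (1 + \<bar>x\<bar>)"
proof -
  obtain d where d: "0 < d" "\<And>x y. \<bar>x - y\<bar> < d \<Longrightarrow> \<bar>f x - f y\<bar> < 1"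
    using abs_cont_uniform[OF assms, of 1] by auto
  have steps: "\<bar>x\<bar> \<le> real n * (d / 2) \<Longrightarrow> \<bar>f x - f 0\<bar> \<le> real n" for n x
  proof (induction n arbitrary: x)
    case (Suc n)
    \<comment> \<open>One of \<open>n + 1\<close> equal steps back towards 0: \<open>y\<close> is
      then reachable in \<open>n\<close> steps and lies within \<open>d / 2\<close> of
      \<open>x\<close>.\<close>
    define y where "y = x * (real n / real (Suc n))"
    have "\<bar>y\<bar> = \<bar>x\<bar> * (real n / real (Suc n))" by (simp add: y_def abs_mult)
    also have "\<dots> \<le> real (Suc n) * (d / 2) * (real n / real (Suc n))"
      using Suc.prems by (intro mult_right_mono) auto
    also have "\<dots> = real n * (d / 2)" by (simp add: field_simps del: of_nat_Suc)
    finally have "\<bar>y\<bar> \<le> real n * (d / 2)" .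
    then have 1: "\<bar>f y - f 0\<bar> \<le> real n" by (rule Suc.IH)
    have "x - y = x / real (Suc n)" by (simp add: y_def field_simps)
    then have "\<bar>x - y\<bar> \<le> d / 2"
      using Suc.prems by (simp add: abs_divide divide_le_eq mult.commute)
    then have "\<bar>f x - f y\<bar> < 1" using d by simp
    then show ?case using 1 by simp
  qed simp
  show thesis
  proof
    fix x :: real
    define n where "n = nat \<lceil>\<bar>x\<bar> / (d / 2)\<rceil>"
    have "\<bar>x\<bar> / (d / 2) \<le> real n" "real n \<le> \<bar>x\<bar> / (d / 2) + 1"
      using d(1) by (auto simp: n_def real_nat_ceiling_ge intro: order_trans[OF of_nat_ceiling])
    then have n: "\<bar>x\<bar> \<le> real n * (d / 2)" "real n \<le> \<bar>x\<bar> * (2 / d) + 1"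
      using d(1) by (auto simp: divide_le_eq)
    define e where "e = 2 / d"
    have "0 \<le> \<bar>x\<bar> * \<bar>f 0\<bar>" "0 \<le> e" using d(1) by (auto simp: e_def)
    moreover have "\<bar>f x\<bar> \<le> \<bar>f 0\<bar> + (\<bar>x\<bar> * e + 1)"
      using steps[OF n(1)] n(2) unfolding e_def by linarith
    moreover have "(\<bar>f 0\<bar> + 1 + e) * (1 + \<bar>x\<bar>) = \<bar>f 0\<bar> + 1 + e + \<bar>x\<bar> * \<bar>f 0\<bar> + \<bar>x\<bar> + \<bar>x\<bar> * e"
      by (simp add: algebra_simps)
    ultimately show "\<bar>f x\<bar> \<le> (\<bar>f 0\<bar> + 1 + 2 / d) * (1 + \<bar>x\<bar>)"
      unfolding e_def[symmetric] by linarith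
  qed
qed

context sticky_flow
begin

text \<open>One identity for both weak equations. With \<open>c0 = 1\<close> and
  \<open>c1 = 0\<close> it tests mass; with \<open>c0 = w m\<close> and
  \<open>c1 = 1 - 2 * m\<close> the factor \<open>c0 + r * c1\<close> is the free velocity of the
  label and \<open>c1\<close> its acceleration. The product with the test function is Lipschitz
  along the path and vanishes at time \<open>R\<close>.\<close>

lemma path_FTC:
  assumes \<phi>: "test_function \<phi>" and m: "m \<in> good" and RB: "0 \<le> R" "0 \<le> B"
    and bound: "\<And>x t. 0 \<le> t \<Longrightarrow> \<bar>\<phi> (x, t)\<bar> \<le> B \<and> \<bar>dx \<phi> (x, t)\<bar> \<le> B \<and> \<bar>dt \<phi> (x, t)\<bar> \<le> B"
    and zero: "\<And>x. \<phi> (x, R) = 0"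
  shows "(LBINT r:{0..R}. c1 * \<phi> (X r m, r) +
      (c0 + r * c1) * (dt \<phi> (X r m, r) + vel r (X r m) * dx \<phi> (X r m, r))) = - (c0 * \<phi> (q m, 0))"
proof -
  note m' = good_unit(1)[OF m] and d = test_function_derivatives[OF \<phi>]
  define g where "g r = (c0 + r * c1) * \<phi> (X r m, r)" for r
  define g' where "g' r = c1 * \<phi> (X r m, r) +
      (c0 + r * c1) * (dt \<phi> (X r m, r) + vel r (X r m) * dx \<phi> (X r m, r))" for r
  obtain C where C: "C \<ge> 0"
    "\<And>s t. 0 \<le> s \<Longrightarrow> s \<le> t \<Longrightarrow> t \<le> R + 1 \<Longrightarrow> \<bar>X t m - X s m\<bar> \<le> C * (t - s)"
    by (rule X_Lipschitz[OF m, of "R + 1"]) (rule that)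
  \<comment> \<open>Product rule for Lipschitz constants: the bound of the factor
    \<open>c0 + r * c1\<close> times the constant of the test function along the path, plus
    \<open>\<bar>c1\<bar>\<close> times the bound of the test function.\<close>
  define L where "L = (\<bar>c0\<bar> + (R + 1) * \<bar>c1\<bar>) * (B * C + B) + \<bar>c1\<bar> * B"
  have "(LBINT r:{0..R}. g' r) = g R - g 0"
  proof (rule Lipschitz_FTC[where C=L])
    fix s t assume st: "0 \<le> s" "s \<le> t" "t \<le> R + 1"
    have "\<bar>\<phi> (X t m, t) - \<phi> (X s m, s)\<bar> \<le> B * \<bar>X t m - X s m\<bar> + B * \<bar>t - s\<bar>"
      by (rule test_function_Lipschitz[OF \<phi>]) (use bound st in auto)
    also have "\<dots> \<le> B * (C * (t - s)) + B * (t - s)"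
      using C(2)[OF st] RB st by (intro add_mono mult_left_mono) auto
    finally have 1: "\<bar>\<phi> (X t m, t) - \<phi> (X s m, s)\<bar> \<le> (B * C + B) * (t - s)"
      by (simp add: algebra_simps)
    have "\<bar>t * c1\<bar> \<le> (R + 1) * \<bar>c1\<bar>"
      using st by (simp add: abs_mult mult_right_mono)
    then have 2: "\<bar>c0 + t * c1\<bar> \<le> \<bar>c0\<bar> + (R + 1) * \<bar>c1\<bar>" by linarith
    have "g t - g s = (c0 + t * c1) * (\<phi> (X t m, t) - \<phi> (X s m, s)) + (t - s) * c1 * \<phi> (X s m, s)"
      by (simp add: g_def algebra_simps)
    then have "\<bar>g t - g s\<bar> \<le> \<bar>c0 + t * c1\<bar> * \<bar>\<phi> (X t m, t) - \<phi> (X s m, s)\<bar> + (t - s) * \<bar>c1\<bar> * \<bar>\<phi> (X s m, s)\<bar>"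
      using abs_triangle_ineq[of "(c0 + t * c1) * (\<phi> (X t m, t) - \<phi> (X s m, s))" "(t - s) * c1 * \<phi> (X s m, s)"] st
      by (simp add: abs_mult)
    also have "\<dots> \<le> (\<bar>c0\<bar> + (R + 1) * \<bar>c1\<bar>) * ((B * C + B) * (t - s)) + (t - s) * \<bar>c1\<bar> * B"
      using 1 2 bound[of s "X s m"] st RB by (intro add_mono mult_mono mult_left_mono) auto
    also have "\<dots> = L * (t - s)" by (simp add: L_def algebra_simps)
    finally show "\<bar>g t - g s\<bar> \<le> L * (t - s)" .
  next
    define Y where "Y r = X r m" for r
    define H where "H f r = indicator half_plane (Y r, r) * f (Y r, r)" for f :: "real \<times> real \<Rightarrow> real" and r
    have [measurable]: "Y \<in> borel_measurable borel"
    proof -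
      have "(\<lambda>r. m) \<in> measurable borel unit_leb" using m' by (intro measurable_const) simp
      from measurable_X[OF _ this, of "\<lambda>r. r"] show ?thesis by (simp add: Y_def[abs_def])
    qed
    have pair: "(\<lambda>r. (Y r, r)) \<in> borel_measurable borel"
      by (rule borel_measurable_Pair) measurable
    have Hm: "H f \<in> borel_measurable borel" if "continuous_on half_plane f" for f
      using measurable_compose[OF pair half_plane_indicator_measurable[OF that]] by (simp add: H_def[abs_def])
    note [measurable] = Hm[OF d(1)] Hm[OF d(2)] Hm[OF d(3)]
    have "(\<lambda>r. indicator {0..R} r * g' r) = (\<lambda>r. indicator {0..R} r * (c1 * H \<phi> r +
        (c0 + r * c1) * (H (dt \<phi>) r + vel r (Y r) * H (dx \<phi>) r)))"
      by (auto simp: fun_eq_iff g'_def indicator_def Y_def H_def)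
    also have "\<dots> \<in> borel_measurable borel" by measurable
    finally show "(\<lambda>r. indicator {0..R} r * g' r) \<in> borel_measurable borel" .
    show "AE t in lborel. 0 < t \<longrightarrow> t < R \<longrightarrow> (g has_real_derivative g' t) (at t)"
      using X_has_derivative_AE[OF m]
    proof eventually_elim
      case (elim t)
      show ?case
      proof (intro impI)
        assume t: "0 < t"
        have "((\<lambda>r. \<phi> (X r m, r)) has_real_derivative dt \<phi> (X t m, t) + vel t (X t m) * dx \<phi> (X t m, t)) (at t)"
          using elim t by (intro test_function_chain[OF \<phi> t]) auto
        then show "(g has_real_derivative g' t) (at t)"
          unfolding g_def[abs_def] g'_def by (auto intro!: derivative_eq_intros)
      qed
    qed
  qed (rule RB)
  then show ?thesis by (simp add: g_def g'_def zero X_zero[OF m])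
qed

text \<open>\<open>path_FTC\<close> integrated over labels, with Fubini to bring the time integral
  outside. Square integrability of the factor on slabs makes its product with the velocity
  integrable.\<close>

lemma weak_identity:
  assumes \<phi>: "test_function \<phi>"
    and [measurable]: "c0 \<in> borel_measurable borel" "c1 \<in> borel_measurable borel"
    and c1: "\<And>m. m \<in> {0<..<1} \<Longrightarrow> \<bar>c1 m\<bar> \<le> 1"
    and sq: "\<And>R. integrable (lborel \<Otimes>\<^sub>M unit_leb) (\<lambda>z. slab R z * (c0 (snd z) + fst z * c1 (snd z))\<^sup>2)"
  shows "(LBINT r:{0..}. (\<integral>m. (c0 m + r * c1 m) * (dt \<phi> (X r m, r) + vel r (X r m) * dx \<phi> (X r m, r)) \<partial>unit_leb))
      + (\<integral>m. c0 m * \<phi> (q m, 0) \<partial>unit_leb) = - (LBINT r:{0..}. (\<integral>m. c1 m * \<phi> (X r m, r) \<partial>unit_leb))"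
proof -
  obtain R B where RB: "0 \<le> R" "0 \<le> B"
    and bound: "\<And>x t. 0 \<le> t \<Longrightarrow> \<bar>\<phi> (x, t)\<bar> \<le> B \<and> \<bar>dx \<phi> (x, t)\<bar> \<le> B \<and> \<bar>dt \<phi> (x, t)\<bar> \<le> B"
    and zero: "\<And>x t. R \<le> t \<Longrightarrow> \<phi> (x, t) = 0 \<and> dx \<phi> (x, t) = 0 \<and> dt \<phi> (x, t) = 0"
    by (rule test_function_support[OF \<phi>]) (rule that)
  note d = test_function_derivatives[OF \<phi>]
  let ?P = "lborel \<Otimes>\<^sub>M unit_leb"
  define c where "c r m = c0 m + r * c1 m" for r m
  define h where "h r m = dt \<phi> (X r m, r) + vel r (X r m) * dx \<phi> (X r m, r)" for r m
  define F1 where "F1 r m = indicator {0..R} r * (c r m * h r m)" for r m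
  define F2 where "F2 r m = indicator {0..R} r * (c1 m * \<phi> (X r m, r))" for r m
  let ?h = "\<lambda>f z. indicator half_plane (X (fst z) (snd z), fst z) * f (X (fst z) (snd z), fst z)"
  have hm: "?h f \<in> borel_measurable ?P" if "continuous_on half_plane f" for f :: "real \<times> real \<Rightarrow> real"
  proof -
    have fst: "(\<lambda>z. fst z) \<in> borel_measurable ?P" by measurable
    show ?thesis
      using measurable_compose[OF borel_measurable_Pair[OF X_pair_meas fst] half_plane_indicator_measurable[OF that]]
      by simp
  qed
  note [measurable] = hm[OF d(1)] hm[OF d(2)] hm[OF d(3)]
  have [measurable]: "(\<lambda>z. c (fst z) (snd z)) \<in> borel_measurable ?P" "(\<lambda>z. c1 (snd z)) \<in> borel_measurable ?P"
    unfolding c_def by measurable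
  have F1eq: "(\<lambda>z. F1 (fst z) (snd z)) = (\<lambda>z. slab R z * (c (fst z) (snd z) *
      (?h (dt \<phi>) z + vel (fst z) (X (fst z) (snd z)) * ?h (dx \<phi>) z)))"
    by (auto simp: fun_eq_iff F1_def h_def slab_def indicator_def)
  have F2eq: "(\<lambda>z. F2 (fst z) (snd z)) = (\<lambda>z. slab R z * (c1 (snd z) * ?h \<phi> z))"
    by (auto simp: fun_eq_iff F2_def slab_def indicator_def)
  have F1m: "(\<lambda>z. F1 (fst z) (snd z)) \<in> borel_measurable ?P"
    unfolding F1eq by measurable
  have F2m: "(\<lambda>z. F2 (fst z) (snd z)) \<in> borel_measurable ?P"
    unfolding F2eq by measurable
  have F1i: "integrable ?P (\<lambda>z. F1 (fst z) (snd z))"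
  proof (rule Bochner_Integration.integrable_bound[OF _ F1m])
    show "integrable ?P (\<lambda>z. B * (slab R z * (c (fst z) (snd z))\<^sup>2 + slab R z +
        slab R z * (vel (fst z) (X (fst z) (snd z)))\<^sup>2))"
      using sq[of R, folded c_def] vel_slab[of R] one_slab[of R] by simp
    show "AE z in ?P. norm (F1 (fst z) (snd z)) \<le> norm (B * (slab R z * (c (fst z) (snd z))\<^sup>2 + slab R z +
        slab R z * (vel (fst z) (X (fst z) (snd z)))\<^sup>2))"
    proof (rule AE_I2)
      fix z :: "real \<times> real"
      define r m where "r = fst z" and "m = snd z"
      \<comment> \<open>The cross term is absorbed by twice the product being at most the sum of
        squares, which leaves only the squares known to be integrable on slabs.\<close>
      have "\<bar>c r m * h r m\<bar> \<le> B * ((c r m)\<^sup>2 + 1 + (vel r (X r m))\<^sup>2)" if "r \<in> {0..R}"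
      proof -
        let ?v = "vel r (X r m)"
        have "\<bar>h r m\<bar> \<le> \<bar>dt \<phi> (X r m, r)\<bar> + \<bar>?v\<bar> * \<bar>dx \<phi> (X r m, r)\<bar>"
          unfolding h_def by (simp add: abs_mult[symmetric] abs_triangle_ineq)
        also have "\<dots> \<le> B + \<bar>?v\<bar> * B"
          using bound[of r "X r m"] that by (intro add_mono mult_left_mono) auto
        finally have "\<bar>c r m\<bar> * \<bar>h r m\<bar> \<le> \<bar>c r m\<bar> * (B * (1 + \<bar>?v\<bar>))"
          by (intro mult_left_mono) (auto simp: algebra_simps)
        also have "\<dots> = B * (\<bar>c r m\<bar> + \<bar>c r m\<bar> * \<bar>?v\<bar>)" by (simp add: algebra_simps)
        also have "\<dots> \<le> B * ((c r m)\<^sup>2 + 1 + ?v\<^sup>2)"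
        proof (intro mult_left_mono RB)
          have "2 * \<bar>c r m\<bar> \<le> (c r m)\<^sup>2 + 1" "2 * (\<bar>c r m\<bar> * \<bar>?v\<bar>) \<le> (c r m)\<^sup>2 + ?v\<^sup>2"
            using sum_squares_bound[of "\<bar>c r m\<bar>" 1] sum_squares_bound[of "\<bar>c r m\<bar>" "\<bar>?v\<bar>"]
            by simp_all
          moreover have "0 \<le> ?v\<^sup>2" by simp
          ultimately show "\<bar>c r m\<bar> + \<bar>c r m\<bar> * \<bar>?v\<bar> \<le> (c r m)\<^sup>2 + 1 + ?v\<^sup>2" by linarith
        qed
        finally show ?thesis by (simp add: abs_mult)
      qed
      then show "norm (F1 (fst z) (snd z)) \<le> norm (B * (slab R z * (c (fst z) (snd z))\<^sup>2 + slab R z +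
          slab R z * (vel (fst z) (X (fst z) (snd z)))\<^sup>2))"
        using RB by (auto simp: F1_def slab_def indicator_def r_def m_def intro: order_trans[OF _ abs_ge_self])
    qed
  qed
  have F2i: "integrable ?P (\<lambda>z. F2 (fst z) (snd z))"
  proof (rule Bochner_Integration.integrable_bound[OF _ F2m])
    show "integrable ?P (\<lambda>z. B * slab R z)" using one_slab by simp
    show "AE z in ?P. norm (F2 (fst z) (snd z)) \<le> norm (B * slab R z)"
    proof (rule AE_I2)
      fix z :: "real \<times> real" assume "z \<in> space ?P"
      then have "snd z \<in> {0<..<1}" by (auto simp: space_pair_measure)
      from c1[OF this] show "norm (F2 (fst z) (snd z)) \<le> norm (B * slab R z)"
        using bound[of "fst z" "X (fst z) (snd z)"] RB
          mult_mono[of "\<bar>c1 (snd z)\<bar>" 1 "\<bar>\<phi> (X (fst z) (snd z), fst z)\<bar>" B]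
        by (auto simp: F2_def slab_def indicator_def abs_mult)
    qed
  qed
  have 1: "(LBINT r:{0..}. (\<integral>m. c r m * h r m \<partial>unit_leb)) = (\<integral>z. F1 (fst z) (snd z) \<partial>?P)"
  proof -
    have "(LBINT r:{0..}. (\<integral>m. c r m * h r m \<partial>unit_leb)) = (\<integral>r. (\<integral>m. F1 (fst (r, m)) (snd (r, m)) \<partial>unit_leb) \<partial>lborel)"
      unfolding set_lebesgue_integral_def
      by (intro Bochner_Integration.integral_cong refl) (auto simp: F1_def indicator_def h_def zero)
    also have "\<dots> = (\<integral>z. F1 (fst z) (snd z) \<partial>?P)"
      by (rule time_mass.integral_fst'[OF F1i])
    finally show ?thesis .
  qed
  have 2: "(LBINT r:{0..}. (\<integral>m. c1 m * \<phi> (X r m, r) \<partial>unit_leb)) = (\<integral>z. F2 (fst z) (snd z) \<partial>?P)"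
  proof -
    have "(LBINT r:{0..}. (\<integral>m. c1 m * \<phi> (X r m, r) \<partial>unit_leb)) = (\<integral>r. (\<integral>m. F2 (fst (r, m)) (snd (r, m)) \<partial>unit_leb) \<partial>lborel)"
      unfolding set_lebesgue_integral_def
      by (intro Bochner_Integration.integral_cong refl) (auto simp: F2_def indicator_def zero)
    also have "\<dots> = (\<integral>z. F2 (fst z) (snd z) \<partial>?P)"
      by (rule time_mass.integral_fst'[OF F2i])
    finally show ?thesis .
  qed
  have Fi: "integrable ?P (\<lambda>(r, m). F2 r m + F1 r m)"
    using F1i F2i by (simp add: case_prod_beta')
  have "(\<integral>z. F2 (fst z) (snd z) \<partial>?P) + (\<integral>z. F1 (fst z) (snd z) \<partial>?P) = (\<integral>(r, m). F2 r m + F1 r m \<partial>?P)"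
    using F1i F2i by (simp add: case_prod_beta')
  also have "\<dots> = (\<integral>m. (\<integral>r. F2 r m + F1 r m \<partial>lborel) \<partial>unit_leb)"
    by (rule time_mass.integral_snd[OF Fi, symmetric])
  also have "\<dots> = (\<integral>m. - (c0 m * \<phi> (q m, 0)) \<partial>unit_leb)"
  proof (rule integral_cong_AE)
    show "(\<lambda>m. \<integral>r. F2 r m + F1 r m \<partial>lborel) \<in> borel_measurable unit_leb"
      using time_mass.integrable_snd[OF Fi] by simp
    have "continuous_on UNIV (\<lambda>x. \<phi> (x, 0))"
      by (rule continuous_on_compose2[OF d(1)]) (auto intro!: continuous_intros)
    then have [measurable]: "(\<lambda>x. \<phi> (x, 0)) \<in> borel_measurable borel" by (rule borel_measurable_continuous_onI)
    show "(\<lambda>m. - (c0 m * \<phi> (q m, 0))) \<in> borel_measurable unit_leb" by measurable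
    show "AE m in unit_leb. (\<integral>r. F2 r m + F1 r m \<partial>lborel) = - (c0 m * \<phi> (q m, 0))"
      using good_AE
    proof eventually_elim
      case (elim m)
      have "(\<integral>r. F2 r m + F1 r m \<partial>lborel) = (LBINT r:{0..R}. c1 m * \<phi> (X r m, r) +
          (c0 m + r * c1 m) * (dt \<phi> (X r m, r) + vel r (X r m) * dx \<phi> (X r m, r)))"
        unfolding set_lebesgue_integral_def
        by (intro Bochner_Integration.integral_cong refl) (simp add: F1_def F2_def c_def h_def distrib_left)
      also have "\<dots> = - (c0 m * \<phi> (q m, 0))"
        by (rule path_FTC[OF \<phi> elim RB bound]) (auto simp: zero)
      finally show ?case .
    qed
  qed
  finally show ?thesis
    using 1 2 by (simp add: c_def h_def)
qed

text \<open>In the momentum balance one factor \<open>vel t x\<close> is split off, and the rest,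
  including the other factor of the quadratic term, is a function of the position. Against it the
  fibre averages \<open>vel\<close> and \<open>force\<close> may be replaced by
  \<open>free_vel\<close> and \<open>2 * m - 1\<close>, so both equations become instances of
  \<open>weak_identity\<close>.\<close>

lemma continuity_equation:
  assumes \<phi>: "test_function \<phi>"
  shows "(LBINT t:{0..}. (\<integral>x. dt \<phi> (x, t) + vel t x * dx \<phi> (x, t) \<partial>law t)) + (\<integral>m. \<phi> (q m, 0) \<partial>unit_leb) = 0"
  and momentum_equation:
  "(LBINT t:{0..}. (\<integral>x. vel t x * dt \<phi> (x, t) + (vel t x)\<^sup>2 * dx \<phi> (x, t) \<partial>law t))
      + (\<integral>m. \<phi> (q m, 0) * w m \<partial>unit_leb) = (LBINT t:{0..}. (\<integral>x. \<phi> (x, t) * sgn_conv (law t) x \<partial>law t))"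
proof -
  note d = test_function_derivatives[OF \<phi>]
  obtain R B where RB: "0 \<le> R" "0 \<le> B"
    and bound: "\<And>x t. 0 \<le> t \<Longrightarrow> \<bar>\<phi> (x, t)\<bar> \<le> B \<and> \<bar>dx \<phi> (x, t)\<bar> \<le> B \<and> \<bar>dt \<phi> (x, t)\<bar> \<le> B"
    and zero: "\<And>x t. R \<le> t \<Longrightarrow> \<phi> (x, t) = 0 \<and> dx \<phi> (x, t) = 0 \<and> dt \<phi> (x, t) = 0"
    by (rule test_function_support[OF \<phi>]) (rule that)
  have slice: "(\<lambda>x. f (x, t)) \<in> borel_measurable borel" if "continuous_on half_plane f" "0 \<le> t"
    for f :: "real \<times> real \<Rightarrow> real" and t
    by (intro borel_measurable_continuous_onI continuous_on_compose2[OF that(1)])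
       (use that in \<open>auto intro!: continuous_intros\<close>)
  have eq_on: "(LBINT t:{0..}. f t) = (LBINT t:{0..}. g t)" if "\<And>t. 0 \<le> t \<Longrightarrow> f t = g t" for f g :: "real \<Rightarrow> real"
    unfolding set_lebesgue_integral_def
    by (intro Bochner_Integration.integral_cong refl) (auto simp: indicator_def that)
  have "(LBINT t:{0..}. (\<integral>x. dt \<phi> (x, t) + vel t x * dx \<phi> (x, t) \<partial>law t)) =
      (LBINT t:{0..}. (\<integral>m. (1 + t * 0) * (dt \<phi> (X t m, t) + vel t (X t m) * dx \<phi> (X t m, t)) \<partial>unit_leb))"
  proof (rule eq_on)
    fix t :: real assume "0 \<le> t"
    note [measurable] = slice[OF d(2) this] slice[OF d(3) this]
    have "(\<integral>x. dt \<phi> (x, t) + vel t x * dx \<phi> (x, t) \<partial>law t) =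
        (\<integral>m. dt \<phi> (X t m, t) + vel t (X t m) * dx \<phi> (X t m, t) \<partial>unit_leb)"
      by (rule integral_law) measurable
    then show "(\<integral>x. dt \<phi> (x, t) + vel t x * dx \<phi> (x, t) \<partial>law t) =
        (\<integral>m. (1 + t * 0) * (dt \<phi> (X t m, t) + vel t (X t m) * dx \<phi> (X t m, t)) \<partial>unit_leb)"
      by simp
  qed
  then show "(LBINT t:{0..}. (\<integral>x. dt \<phi> (x, t) + vel t x * dx \<phi> (x, t) \<partial>law t)) + (\<integral>m. \<phi> (q m, 0) \<partial>unit_leb) = 0"
    using weak_identity[OF \<phi>, of "\<lambda>_. 1" "\<lambda>_. 0"] one_slab by (simp add: set_lebesgue_integral_def)
  have le: "\<bar>1 - 2 * m\<bar> \<le> 1" if "m \<in> {0<..<1}" for m :: real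
    using that by auto
  have sq: "integrable (lborel \<Otimes>\<^sub>M unit_leb) (\<lambda>z. slab R z * (w (snd z) + fst z * (1 - 2 * snd z))\<^sup>2)" for R
    using free_vel_slab[of R] by (simp add: free_vel_def algebra_simps)
  have "(LBINT t:{0..}. (\<integral>x. vel t x * dt \<phi> (x, t) + (vel t x)\<^sup>2 * dx \<phi> (x, t) \<partial>law t)) =
      (LBINT t:{0..}. (\<integral>m. (w m + t * (1 - 2 * m)) * (dt \<phi> (X t m, t) + vel t (X t m) * dx \<phi> (X t m, t)) \<partial>unit_leb))"
  proof (rule eq_on)
    fix t :: real assume t: "0 \<le> t"
    note [measurable] = slice[OF d(2) t] slice[OF d(3) t]
    \<comment> \<open>The cofactor of \<open>vel t x\<close> in the integrand; its square
      integrability along \<open>X t\<close> is what the exchange of average and free velocity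
      requires.\<close>
    define \<kappa> where "\<kappa> x = dt \<phi> (x, t) + vel t x * dx \<phi> (x, t)" for x
    have [measurable]: "\<kappa> \<in> borel_measurable borel" unfolding \<kappa>_def[abs_def] by measurable
    have \<kappa>sq: "integrable unit_leb (\<lambda>m. (\<kappa> (X t m))\<^sup>2)"
    proof (rule Bochner_Integration.integrable_bound[where f="\<lambda>m. 2 * B\<^sup>2 + 2 * B\<^sup>2 * (vel t (X t m))\<^sup>2"])
      show "integrable unit_leb (\<lambda>m. 2 * B\<^sup>2 + 2 * B\<^sup>2 * (vel t (X t m))\<^sup>2)"
        using vel_square_integrable by simp
      show "AE m in unit_leb. norm ((\<kappa> (X t m))\<^sup>2) \<le> norm (2 * B\<^sup>2 + 2 * B\<^sup>2 * (vel t (X t m))\<^sup>2)"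
      proof (rule AE_I2)
        fix m
        let ?a = "dt \<phi> (X t m, t)" and ?b = "dx \<phi> (X t m, t)" and ?v = "vel t (X t m)"
        have "?a\<^sup>2 \<le> B\<^sup>2" "?b\<^sup>2 \<le> B\<^sup>2"
          using bound[OF t, of "X t m"] RB by (auto simp: abs_le_square_iff[symmetric])
        then have "?v\<^sup>2 * ?b\<^sup>2 \<le> ?v\<^sup>2 * B\<^sup>2" "?a\<^sup>2 \<le> B\<^sup>2" by (auto intro: mult_left_mono)
        moreover have "(?a + ?v * ?b)\<^sup>2 + (?a - ?v * ?b)\<^sup>2 = 2 * ?a\<^sup>2 + 2 * (?v\<^sup>2 * ?b\<^sup>2)"
          by (simp add: power2_sum power2_diff power_mult_distrib)
        moreover have "0 \<le> (?a - ?v * ?b)\<^sup>2" by simp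
        ultimately have "(?a + ?v * ?b)\<^sup>2 \<le> 2 * B\<^sup>2 + 2 * (?v\<^sup>2 * B\<^sup>2)" by linarith
        then show "norm ((\<kappa> (X t m))\<^sup>2) \<le> norm (2 * B\<^sup>2 + 2 * B\<^sup>2 * ?v\<^sup>2)"
          by (simp add: \<kappa>_def algebra_simps)
      qed
    qed measurable
    have "(\<integral>x. vel t x * dt \<phi> (x, t) + (vel t x)\<^sup>2 * dx \<phi> (x, t) \<partial>law t) = (\<integral>x. vel t x * \<kappa> x \<partial>law t)"
      by (simp add: \<kappa>_def algebra_simps power2_eq_square)
    also have "\<dots> = (\<integral>m. vel t (X t m) * \<kappa> (X t m) \<partial>unit_leb)"
      by (rule integral_law) measurable
    also have "\<dots> = (\<integral>m. free_vel t m * \<kappa> (X t m) \<partial>unit_leb)"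
      unfolding vel_K by (rule integral_K_mult_X[symmetric]) (auto intro: free_square \<kappa>sq)
    finally show "(\<integral>x. vel t x * dt \<phi> (x, t) + (vel t x)\<^sup>2 * dx \<phi> (x, t) \<partial>law t) =
        (\<integral>m. (w m + t * (1 - 2 * m)) * (dt \<phi> (X t m, t) + vel t (X t m) * dx \<phi> (X t m, t)) \<partial>unit_leb)"
      by (simp add: \<kappa>_def free_vel_def algebra_simps)
  qed
  moreover have "(LBINT t:{0..}. (\<integral>x. \<phi> (x, t) * sgn_conv (law t) x \<partial>law t)) =
      (LBINT t:{0..}. - (\<integral>m. (1 - 2 * m) * \<phi> (X t m, t) \<partial>unit_leb))"
  proof (rule eq_on)
    fix t :: real assume t: "0 \<le> t"
    note [measurable] = slice[OF d(1) t]
    have "(\<integral>x. \<phi> (x, t) * sgn_conv (law t) x \<partial>law t) = (\<integral>x. force t x * \<phi> (x, t) \<partial>law t)"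
      by (simp add: sgn_conv_law mult.commute)
    also have "\<dots> = (\<integral>m. force t (X t m) * \<phi> (X t m, t) \<partial>unit_leb)"
      by (rule integral_law) measurable
    also have "\<dots> = (\<integral>m. (2 * m - 1) * \<phi> (X t m, t) \<partial>unit_leb)"
      unfolding force_K
    proof (rule integral_K_mult_X[symmetric])
      show "integrable unit_leb (\<lambda>m. (2 * m - 1)\<^sup>2)"
        by (rule unit_leb.integrable_const_bound[where B=1])
           (auto simp: AE_unit_leb_iff abs_square_le_1)
      show "integrable unit_leb (\<lambda>m. (\<phi> (X t m, t))\<^sup>2)"
        by (rule unit_leb.integrable_const_bound[where B="B\<^sup>2"])
           (use bound[OF t] RB in \<open>auto simp: abs_le_square_iff[symmetric]\<close>)
    qed auto
    also have "\<dots> = (\<integral>m. - ((1 - 2 * m) * \<phi> (X t m, t)) \<partial>unit_leb)"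
      by (simp add: algebra_simps)
    finally show "(\<integral>x. \<phi> (x, t) * sgn_conv (law t) x \<partial>law t) = - (\<integral>m. (1 - 2 * m) * \<phi> (X t m, t) \<partial>unit_leb)"
      by simp
  qed
  moreover have "(LBINT t:{0..}. - (\<integral>m. (1 - 2 * m) * \<phi> (X t m, t) \<partial>unit_leb)) =
      - (LBINT t:{0..}. (\<integral>m. (1 - 2 * m) * \<phi> (X t m, t) \<partial>unit_leb))"
    by (simp add: set_lebesgue_integral_def)
  moreover have "(\<integral>m. \<phi> (q m, 0) * w m \<partial>unit_leb) = (\<integral>m. w m * \<phi> (q m, 0) \<partial>unit_leb)"
    by (simp add: mult.commute)
  ultimately show "(LBINT t:{0..}. (\<integral>x. vel t x * dt \<phi> (x, t) + (vel t x)\<^sup>2 * dx \<phi> (x, t) \<partial>law t))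
      + (\<integral>m. \<phi> (q m, 0) * w m \<partial>unit_leb) = (LBINT t:{0..}. (\<integral>x. \<phi> (x, t) * sgn_conv (law t) x \<partial>law t))"
    using weak_identity[OF \<phi> w_meas _ le sq] by simp
qed

end

theorem corollary5p7:
  fixes \<rho>0 :: "real measure" and v0 :: "real \<Rightarrow> real"
  assumes "real_distribution \<rho>0"
    and "integrable \<rho>0 (\<lambda>x. x\<^sup>2)"
    and "abs_cont_on_line v0"
  shows "\<exists>(\<rho> :: real \<Rightarrow> real measure) (v :: real \<times> real \<Rightarrow> real).
    euler_poisson_weak_solution \<rho>0 v0 \<rho> v \<and>
    (AE (s, t) in lborel \<Otimes>\<^sub>M lborel. 0 \<le> s \<and> s \<le> t \<longrightarrow>
      energy (\<rho> t) (\<lambda>x. v (x, t)) \<le> energy (\<rho> s) (\<lambda>x. v (x, s))) \<and>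
    (AE t in lborel. 0 < t \<longrightarrow>
      (AE (x, y) in \<rho> t \<Otimes>\<^sub>M \<rho> t.
        (v (x, t) - v (y, t)) * (x - y) \<le> 1 / t * (x - y)\<^sup>2))"
proof -
  interpret cdf_distribution \<rho>0 using assms(1) by (simp add: cdf_distribution_def)
  \<comment> \<open>\<open>I\<close> is the pseudo-inverse of the distribution function of
    \<open>\<rho>0\<close>. The value 0 outside the open unit interval makes \<open>q\<close> Borel
    on the whole line.\<close>
  define q where "q m = (if m \<in> {0<..<1} then I m else 0)" for m
  define w where "w m = v0 (q m)" for m
  have cont: "isCont v0 x" for x by (rule abs_cont_imp_isCont[OF assms(3)])
  then have v0m [measurable]: "v0 \<in> borel_measurable borel"
    by (intro borel_measurable_continuous_onI) (simp add: continuous_on_eq_continuous_at)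
  have qm [measurable]: "q \<in> borel_measurable borel"
    using measurable_CI unfolding q_def[abs_def] by (subst (asm) measurable_restrict_space_iff) auto
  have \<rho>0: "distr unit_leb borel q = \<rho>0"
  proof -
    have "distr unit_leb borel q = distr unit_leb borel I"
      by (intro distr_cong) (auto simp: q_def)
    then show ?thesis by (simp add: distr_I_eq_M)
  qed
  have q_unit: "q \<in> borel_measurable unit_leb"
    by (simp add: unit_leb_measurable_iff measurable_restrict_space1)
  have int: "integrable unit_leb (\<lambda>m. f (q m)) \<longleftrightarrow> integrable \<rho>0 f"
    if "f \<in> borel_measurable borel" for f :: "real \<Rightarrow> real"
    unfolding \<rho>0[symmetric] using q_unit that by (simp add: integrable_distr_eq)
  have val: "(\<integral>m. f (q m) \<partial>unit_leb) = (\<integral>x. f x \<partial>\<rho>0)"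
    if "f \<in> borel_measurable borel" for f :: "real \<Rightarrow> real"
    unfolding \<rho>0[symmetric] using q_unit that by (simp add: integral_distr)
  obtain C where C: "\<And>x. \<bar>v0 x\<bar> \<le> C * (1 + \<bar>x\<bar>)" by (rule abs_cont_linear_growth[OF assms(3)]) (rule that)
  have v0_sq: "integrable \<rho>0 (\<lambda>x. (v0 x)\<^sup>2)"
  proof (rule Bochner_Integration.integrable_bound[where f="\<lambda>x. 2 * C\<^sup>2 + 2 * C\<^sup>2 * x\<^sup>2"])
    show "integrable \<rho>0 (\<lambda>x. 2 * C\<^sup>2 + 2 * C\<^sup>2 * x\<^sup>2)" using assms(2) by simp
    show "AE x in \<rho>0. norm ((v0 x)\<^sup>2) \<le> norm (2 * C\<^sup>2 + 2 * C\<^sup>2 * x\<^sup>2)"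
    proof (rule AE_I2)
      fix x
      have "(v0 x)\<^sup>2 \<le> (C * (1 + \<bar>x\<bar>))\<^sup>2"
        using C[of x] by (simp add: abs_le_square_iff[symmetric])
      also have "\<dots> = C\<^sup>2 * (1 + \<bar>x\<bar>)\<^sup>2" by (simp add: power_mult_distrib)
      also have "\<dots> \<le> C\<^sup>2 * (2 + 2 * x\<^sup>2)"
        using sum_squares_bound[of 1 "\<bar>x\<bar>"] by (intro mult_left_mono) (auto simp: power2_sum)
      finally show "norm ((v0 x)\<^sup>2) \<le> norm (2 * C\<^sup>2 + 2 * C\<^sup>2 * x\<^sup>2)" by (simp add: algebra_simps)
    qed
    show "(\<lambda>x. (v0 x)\<^sup>2) \<in> borel_measurable \<rho>0"
      unfolding measurable_cong_sets[OF events_eq_borel refl] by measurable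
  qed
  interpret sticky_flow q w
  proof
    show "w \<in> borel_measurable borel" unfolding w_def[abs_def] by measurable
    show "integrable unit_leb (\<lambda>m. (q m)\<^sup>2)" using assms(2) by (subst int) auto
    show "integrable unit_leb (\<lambda>m. (w m)\<^sup>2)" unfolding w_def using v0_sq by (subst int) auto
    show "mono_on {0<..<1} q" using mono_I by (auto simp: mono_on_def q_def)
    show "isCont w m" if "isCont q m" for m
      unfolding w_def[abs_def] by (rule isCont_o2[OF that cont])
  qed (rule qm)
  define v where "v z = vel (snd z) (fst z)" for z
  have "euler_poisson_weak_solution \<rho>0 v0 law v"
    unfolding euler_poisson_weak_solution_def
  proof (intro conjI allI impI)
    show "narrowly_continuous law" by (rule narrowly_continuous_law)
    have "v \<in> borel_measurable (borel \<Otimes>\<^sub>M borel)" unfolding v_def[abs_def] by measurable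
    then show "v \<in> borel_measurable (restrict_space borel half_plane)"
      by (intro measurable_restrict_space1) (simp add: borel_prod)
    show "(\<integral>\<^sup>+t\<in>{0..T}. (\<integral>\<^sup>+x. ennreal ((v (x, t))\<^sup>2) \<partial>law t) \<partial>lborel) < \<infinity>" for T
      using vel_locally_square_integrable by (simp add: v_def)
    fix \<phi> assume \<phi>: "test_function \<phi>"
    have "continuous_on UNIV (\<lambda>x. \<phi> (x, 0))"
      by (rule continuous_on_compose2[OF test_function_derivatives(1)[OF \<phi>]]) (auto intro!: continuous_intros)
    then have [measurable]: "(\<lambda>x. \<phi> (x, 0)) \<in> borel_measurable borel" by (rule borel_measurable_continuous_onI)
    show "(LBINT t:{0..}. (\<integral>x. dt \<phi> (x, t) + v (x, t) * dx \<phi> (x, t) \<partial>law t)) + (\<integral>x. \<phi> (x, 0) \<partial>\<rho>0) = 0"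
      using continuity_equation[OF \<phi>] val[of "\<lambda>x. \<phi> (x, 0)"] by (simp add: v_def)
    have "(\<integral>m. \<phi> (q m, 0) * w m \<partial>unit_leb) = (\<integral>x. \<phi> (x, 0) * v0 x \<partial>\<rho>0)"
      using val[of "\<lambda>x. \<phi> (x, 0) * v0 x"] by (simp add: w_def)
    then show "(LBINT t:{0..}. (\<integral>x. v (x, t) * dt \<phi> (x, t) + (v (x, t))\<^sup>2 * dx \<phi> (x, t) \<partial>law t)) +
        (\<integral>x. \<phi> (x, 0) * v0 x \<partial>\<rho>0) = (LBINT t:{0..}. (\<integral>x. \<phi> (x, t) * sgn_conv (law t) x \<partial>law t))"
      using momentum_equation[OF \<phi>] by (simp add: v_def)
  qed
  moreover have "AE (s, t) in lborel \<Otimes>\<^sub>M lborel. 0 \<le> s \<and> s \<le> t \<longrightarrow>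
      energy (law t) (\<lambda>x. v (x, t)) \<le> energy (law s) (\<lambda>x. v (x, s))"
  proof -
    \<comment> \<open>The energy comparison was shown for a positive earlier time; the pairs with
      earlier time 0 form a null set.\<close>
    have "AE z in lborel \<Otimes>\<^sub>M lborel. fst z \<noteq> (0 :: real)"
    proof (rule lborel_pair.AE_pair_measure)
      show "{z \<in> space (lborel \<Otimes>\<^sub>M lborel). fst z \<noteq> (0 :: real)} \<in> sets (lborel \<Otimes>\<^sub>M lborel)"
        by measurable
      show "AE x in lborel. AE y in lborel. fst (x, y) \<noteq> (0 :: real)"
        using AE_lborel_singleton[of "0 :: real"] by eventually_elim simp
    qed
    then show ?thesis
      by eventually_elim (auto simp: v_def intro!: energy_decrease)
  qed
  moreover have "AE t in lborel. 0 < t \<longrightarrow>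
      (AE (x, y) in law t \<Otimes>\<^sub>M law t. (v (x, t) - v (y, t)) * (x - y) \<le> 1 / t * (x - y)\<^sup>2)"
    using oleinik by (intro AE_I2) (simp add: v_def)
  ultimately show ?thesis by blast
qed

end
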